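(* Let $((\rho_{\alpha,0})_{\alpha},\boldsymbol v_0,\chi_0,\chi_1,\varphi_0,(R_{\alpha,0})_{\alpha},(R_{\alpha,1})_{\alpha},\boldsymbol V_0,X_0,X_1,\Phi_0,\Phi_1)$ be a matching solution of the uncoupled regime (as defined in the context). Then the following equations hold in the bulk regions $\Omega^\pm$: $$\chi_0=\pm1 \text{ in }\Omega^\pm,\qquad \chi_1=0,$$ $$0=\partial_t\rho_{\alpha,0}+\operatorname{div}(\rho_{\alpha,0}\boldsymbol v_0)-\operatorname{div}\Big(\sum_{\beta=1}^{N-1}M_{\alpha\beta}\nabla\Big(\mu_{\beta,0}-\mu_{N,0}+\Big(\frac{z_\beta}{m_\beta}-\frac{z_N}{m_N}\Big)\varphi_0\Big)\Big)-\sum_{i=1}^{N_R}m_\alpha\gamma_\alpha^iM_{\mathrm r}^i\Big(1-\exp\Big(\sum_{\beta=1}^Nm_\beta\gamma^i_\beta\mu_{\beta,0}\Big)\Big)$$ for $\alpha=1,\dots,N-1$, $$0=\partial_t\rho_0+\operatorname{div}(\rho_0\boldsymbol v_0),$$ $$0=\partial_t(\rho_0\boldsymbol v_0)+\operatorname{div}(\rho_0\boldsymbol v_0\otimes\boldsymbol v_0)+\nabla\Big(\sum_{\alpha=1}^N\rho_{\alpha,0}\mu_{\alpha,0}-\rho f_0+\frac{\varepsilon_0}{2}(1+s(\chi_0))|\nabla\varphi_0|^2\Big)-\operatorname{div}\big(\varepsilon_0(1+s(\chi_0))\nabla\varphi_0\otimes\nabla\varphi_0\big),$$ $$0=\varepsilon_0\operatorname{div}((1+s(\chi_0))\nabla\varphi_0)+\sum_{\alpha=1}^N\frac{z_\alpha}{m_\alpha}\rho_{\alpha,0}.$$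 Moreover, with $j_0:=\rho_0^\pm(\boldsymbol v_0^\pm\cdot\boldsymbol\nu-w_{\boldsymbol\nu})$, the following conditions hold at the interface $\Gamma$: $$0=[\![\mu_{\alpha,0}-\mu_{N,0}]\!]\quad(\alpha=1,\dots,N-1),$$ $$0=[\![\rho_0(\boldsymbol v_0\cdot\boldsymbol\nu-w_{\boldsymbol\nu})]\!],$$ $$0=[\![\rho_{\alpha,0}(\boldsymbol v_0\cdot\boldsymbol\nu-w_{\boldsymbol\nu})]\!]-\Big[\!\Big[\sum_{\beta=1}^{N-1}M_{\alpha\beta}\nabla\Big(\mu_{\beta,0}-\mu_{N,0}+\Big(\frac{z_\beta}{m_\beta}-\frac{z_N}{m_N}\Big)\varphi_0\Big)\cdot\boldsymbol\nu\Big]\!\Big]\quad(\alpha=1,\dots,N-1),$$ $$0=\Big[\!\Big[j_0\boldsymbol v_0+\Big(\sum_{\alpha=1}^N\rho_{\alpha,0}\mu_{\alpha,0}-\rho f_0\Big)\boldsymbol\nu+\varepsilon_0(1+s(\chi_0))\Big(\frac12|\nabla\varphi_0|^2\mathbf 1-\nabla\varphi_0\otimes\nabla\varphi_0\Big)\boldsymbol\nu\Big]\!\Big]-\gamma\kappa\boldsymbol\nu\int_{-\infty}^\infty(X_{0,z})^2\,dz,$$ $$0=\Big[\!\Big[\frac{j_0^2}{2\rho_0^2}+\mu_{N,0}\Big]\!\Big]+\frac{j_0}{\tau}\int_{-\infty}^\infty\frac1{R_0}(X_{0,z})^2\,dz,$$ $$0=[\![(1+s(\chi_0))\nabla\varphi_0\cdot\boldsymbol\nu]\!],\qquad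 0=[\![\varphi_0]\!].$$ Moreover, $[\![\varphi_0]\!]=0$ implies $[\![\nabla\varphi_0-(\nabla\varphi_0\cdot\boldsymbol\nu)\boldsymbol\nu]\!]=0$.
   Context: **Data (nondimensional).** $N\ge2$ constituents, $N_R$ reactions; masses $m_\alpha>0$, charge numbers $z_\alpha\in\mathbb R$, stoichiometric coefficients $\gamma^i_\alpha$, reaction mobilities $M^i_{\mathrm r}$; constants $\gamma,\tau,\varepsilon_0>0$; $(M_{\alpha\beta})_{\alpha,\beta=1}^{N-1}$ a constant symmetric positive definite matrix. $W(\chi)=(\chi-1)^2(\chi+1)^2$. $h:\mathbb R\to[0,1]$ is smooth with $h(z)=1$ for $z\ge1$, $h(z)=0$ for $z\le-1$, $h'(z)=0$ for $|z|\ge1$. $s(\chi)=h(\chi)s_L+(1-h(\chi))s_V$ with constants $s_L,s_V\ge0$. $(\rho f)(\rho_1,\dots,\rho_N,\chi)=h(\chi)\,\rho\psi_L(\rho_1,\dots,\rho_N)+(1-h(\chi))\,\rho\psi_V(\rho_1,\dots,\rho_N)$, where, with $n_\alpha=\rho_\alpha/m_\alpha$, $n=\sum_\alpha n_\alpha$, $$\rho\psi_{L/V}=\sum_\alpha\rho_\alpha\psi^R_\alpha+(K_{L/V}-p^R)\Big(1-\frac n{n^R}\Big)+K_{L/V}\frac n{n^R}\ln\frac n{n^R}+kT\sum_\alpha n_\alpha\ln\frac{n_\alpha}n,$$ with constants $K_{L/V},n^R,k,T>0$ and $p^R,\psi^R_\alpha\in\mathbb R$. Chemical potentials: $\mu_\alpha=\partial(\rho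 f)/\partial\rho_\alpha$. **Geometry.** $T_f>0$. For $t\in[0,T_f)$ the fluid domain is split by a smooth hypersurface $\Gamma=\Gamma(t)\subset\mathbb R^3$ (the zeroth-order interface) into the bulk regions $\Omega^+$ (liquid, where $\chi_0>0$) and $\Omega^-$ (vapor, where $\chi_0<0$). $\boldsymbol\nu$ is the unit normal to $\Gamma$ pointing into the liquid $\Omega^+$, $w_{\boldsymbol\nu}$ the normal velocity, $\kappa$ the mean curvature of $\Gamma$, $\nabla_\Gamma$ the surface gradient. Outer fields and their first spatial derivatives are assumed to have one-sided traces $f^\pm$ on $\Gamma$ from $\Omega^\pm$; $[\![f]\!]=f^+-f^-$. $U$ is a parameter domain of $\Gamma$; inner functions depend on $(t,\boldsymbol s,z)\in[0,T_f)\times U\times\mathbb R$, where $z$ is the stretched normal coordinate, and a subscript $z$ denotes $\partial_z$. **Outer solution.** A tuple $((\rho_{\alpha,0})_{\alpha=1}^N,\boldsymbol v_0,\chi_0,\chi_1,\varphi_0)$ with $\rho_{\alpha,0}\in C^0([0,T_f),C^2(\Omega^\pm,\mathbb R_+))\cap C^1([0,T_f),C^0(\Omega^\pm,\mathbb R_+))$, $\boldsymbol v_0\in C^0([0,T_f),C^1(\Omega^\pm,\mathbb R^3))\cap C^1([0,T_f),C^0(\Omega^\pm,\mathbb R^3))$, $\chi_0,\varphi_0\in C^0([0,T_f),C^2(\Omega^\pm,\mathbb R))$, $\chi_1\in C^0([0,T_f),C^1(\Omega^\pm,\mathbb R))$, is an outer solution of the uncoupled regime if, with $\rho_0=\sum_{\alpha=1}^N\rho_{\alpha,0}$,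 $\mu_{\alpha,0}=\mu_\alpha(\rho_{1,0},\dots,\rho_{N,0},\chi_0)$, $\rho f_0=\rho f(\rho_{1,0},\dots,\rho_{N,0},\chi_0)$, in $\Omega^\pm$: - for $\alpha=1,\dots,N-1$: $0=\partial_t\rho_{\alpha,0}+\operatorname{div}(\rho_{\alpha,0}\boldsymbol v_0)-\operatorname{div}\big(\sum_{\beta=1}^{N-1}M_{\alpha\beta}\nabla(\mu_{\beta,0}-\mu_{N,0}+(\frac{z_\beta}{m_\beta}-\frac{z_N}{m_N})\varphi_0)\big)-\sum_{i=1}^{N_R}m_\alpha\gamma^i_\alpha M^i_{\mathrm r}\big(1-\exp(\sum_{\beta=1}^Nm_\beta\gamma_\beta^i\mu_{\beta,0})\big)$; - $0=\partial_t\rho_0+\operatorname{div}(\rho_0\boldsymbol v_0)$; $\;0=W'(\chi_0)$; - $0=\partial_t(\rho_0\boldsymbol v_0)+\operatorname{div}(\rho_0\boldsymbol v_0\otimes\boldsymbol v_0)+\nabla(\sum_\alpha\rho_{\alpha,0}\mu_{\alpha,0}-\rho f_0)-\nabla(W'(\chi_0)\chi_1)+\varepsilon_0\operatorname{div}\big((1+s(\chi_0))(\frac12|\nabla\varphi_0|^2\mathbf1-\nabla\varphi_0\otimes\nabla\varphi_0)\big)$; - $0=W''(\chi_0)\chi_1+\frac{\partial\rho f}{\partial\chi}(\rho_{1,0},\dots,\rho_{N,0},\chi_0)-\frac{\varepsilon_0}2s'(\chi_0)|\nabla\varphi_0|^2$; - $0=\varepsilon_0\operatorname{div}((1+s(\chi_0))\nabla\varphi_0)+\sum_{\alpha=1}^N\frac{z_\alpha}{m_\alpha}\rho_{\alpha,0}$.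 **Inner solution.** A tuple $((R_{\alpha,0})_{\alpha},(R_{\alpha,1})_{\alpha},\boldsymbol V_0,X_0,X_1,\Phi_0,\Phi_1)$ with $X_0\not\equiv0$, all components continuous in $(t,\boldsymbol s)$, with $R_{\alpha,0}$ ($>0$), $R_{\alpha,1},X_0,X_1,\Phi_0,\Phi_1$ of class $C^2$ in $z$, $\boldsymbol V_0$ ($\mathbb R^3$-valued) of class $C^1$ in $z$, and $X_0,\Phi_0$ also $C^1$ in $\boldsymbol s$, is an inner solution of the uncoupled regime with normal velocity $w_{\boldsymbol\nu}$ if, with $R_0=\sum_\alpha R_{\alpha,0}$, $\mathcal M_{\beta,0}=\mu_\beta(R_{1,0},\dots,R_{N,0},X_0)$, $RF_0=\rho f(R_{1,0},\dots,R_{N,0},X_0)$, $\frac{\partial RF_0}{\partial\chi}=\frac{\partial\rho f}{\partial\chi}(R_{1,0},\dots,R_{N,0},X_0)$, $j_0=R_0(\boldsymbol V_0\cdot\boldsymbol\nu-w_{\boldsymbol\nu})$, $\mathcal M_{\beta,1}=\sum_\alpha\frac{\partial\mu_\beta}{\partial\rho_\alpha}(R_{1,0},\dots,R_{N,0},X_0)R_{\alpha,1}+\frac{\partial\mu_\beta}{\partial\chi}(R_{1,0},\dots,R_{N,0},X_0)X_1$: - $0=\big(\frac12(1+s(X_0))|\Phi_{0,z}|^2-(1+s(X_0))|\Phi_{0,z}|^2\big)_z$; - $0=\big(\sum_{\beta=1}^{N-1}M_{\alpha\beta}(\mathcal M_{\beta,0}-\mathcal M_{N,0})_z\big)_z$,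 $\alpha=1,\dots,N-1$; - $0=W'(X_0)-\gamma X_{0,zz}$ (in particular $0=(-W(X_0)+\frac\gamma2X_{0,z}^2)_z$); - $0=(R_0(\boldsymbol V_0\cdot\boldsymbol\nu-w_{\boldsymbol\nu}))_z=(j_0)_z$; - $0=j_0\boldsymbol V_{0,z}+\boldsymbol\nu\big(\sum_\alpha R_{\alpha,0}\mathcal M_{\alpha,0}-RF_0-W'(X_0)X_1\big)_z+\gamma\boldsymbol\nu(X_{0,z}X_{1,zz}+X_{0,zz}X_{1,z}-\kappa X_{0,z}^2)-\nabla_\Gamma W(X_0)+\gamma X_{0,zz}\nabla_\Gamma X_0+\frac{\varepsilon_0}2\big((\Phi_{1,z})^2+|\nabla_\Gamma\Phi_0|^2\big)(1+s(X_0))_z\boldsymbol\nu-\varepsilon_0((1+s(X_0))\Phi_{1,z})_z(\Phi_{1,z}\boldsymbol\nu+\nabla_\Gamma\Phi_0)$; - $0=\frac{j_0}\tau X_{0,z}+W''(X_0)X_1-\gamma X_{1,zz}+\gamma\kappa X_{0,z}+\frac{\partial RF_0}{\partial\chi}-\frac{\varepsilon_0}2s'(X_0)\big((\Phi_{1,z})^2+|\nabla_\Gamma\Phi_0|^2\big)$; - $0=((1+s(X_0))\Phi_{1,z})_z$; - for $\alpha=1,\dots,N-1$: $0=(R_{\alpha,0}(\boldsymbol V_0\cdot\boldsymbol\nu-w_{\boldsymbol\nu}))_z-\sum_{\beta=1}^{N-1}M_{\alpha\beta}\big((\mathcal M_{\beta,1}-\mathcal M_{N,1})_{zz}-\kappa(\mathcal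 M_{\beta,0}-\mathcal M_{N,0})_z+(\frac{z_\beta}{m_\beta}-\frac{z_N}{m_N})\Phi_{1,zz}\big)$. **Matching solution.** An outer and an inner solution together form a matching solution if the standard matching conditions hold at each point of $\Gamma$ as $z\to\pm\infty$: $R_{\alpha,0}\to\rho_{\alpha,0}^\pm>0$, $\boldsymbol V_0\to\boldsymbol v_0^\pm$, $X_0\to\chi_0^\pm$, $\Phi_0\to\varphi_0^\pm$; the $z$-derivatives of $R_{\alpha,0},\boldsymbol V_0,X_0,\Phi_0,\mathcal M_{\beta,0}$ tend to $0$; $X_1-\chi_1^\pm-z(\nabla\chi_0)^\pm\cdot\boldsymbol\nu\to0$, $X_{1,z}\to(\nabla\chi_0)^\pm\cdot\boldsymbol\nu$; $R_{\alpha,1,z}\to(\nabla\rho_{\alpha,0})^\pm\cdot\boldsymbol\nu$; $\Phi_{1,z}\to(\nabla\varphi_0)^\pm\cdot\boldsymbol\nu$; $(\mathcal M_{\beta,1})_z\to(\nabla\mu_{\beta,0})^\pm\cdot\boldsymbol\nu$. *)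

theory Defs
  imports "HOL-Analysis.Analysis"
begin

section \<open>Differentiability classes\<close>

text \<open>On an open set, or on an open set intersected with \<open>[0,T) \<times> UNIV\<close>, the derivative within \<open>S\<close> is
  unique, so this is the usual notion of \<open>C^k\<close> (one-sided in time at \<open>t = 0\<close>).\<close>

primrec Ck_on :: "nat \<Rightarrow> 'a::euclidean_space set \<Rightarrow> ('a \<Rightarrow> 'b::real_normed_vector) \<Rightarrow> bool" where
  "Ck_on 0 S f = continuous_on S f"
| "Ck_on (Suc k) S f =
     (f differentiable_on S \<and> (\<forall>e. Ck_on k S (\<lambda>x. frechet_derivative f (at x within S) e)))"

definition smooth_on :: "'a::euclidean_space set \<Rightarrow> ('a \<Rightarrow> 'b::real_normed_vector) \<Rightarrow> bool" where
  "smooth_on S f \<longleftrightarrow> (\<forall>k. Ck_on k S f)"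

text \<open>\<open>C^0([0,T), C^k)\<close> on a space-time set \<open>Q\<close> with open time slices: all spatial derivatives up to order
  \<open>k\<close> exist and are continuous on \<open>Q\<close>.\<close>

primrec space_Ck :: "nat \<Rightarrow> (real \<times> 'a::euclidean_space) set \<Rightarrow>
    (real \<Rightarrow> 'a \<Rightarrow> 'b::real_normed_vector) \<Rightarrow> bool" where
  "space_Ck 0 Q f = continuous_on Q (\<lambda>(t, x). f t x)"
| "space_Ck (Suc k) Q f =
     (continuous_on Q (\<lambda>(t, x). f t x) \<and>
      (\<forall>(t, x)\<in>Q. f t differentiable (at x)) \<and>
      (\<forall>e. space_Ck k Q (\<lambda>t x. frechet_derivative (f t) (at x) e)))"

definition time_deriv :: "real \<Rightarrow> (real \<Rightarrow> 'a \<Rightarrow> 'b::real_normed_vector) \<Rightarrow> real \<Rightarrow> 'a \<Rightarrow> 'b" where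
  "time_deriv Tf f t x = vector_derivative (\<lambda>t'. f t' x) (at t within {0..<Tf})"

text \<open>\<open>C^1([0,T), C^0)\<close> on a space-time set \<open>Q\<close> that is relatively open in \<open>[0,T) \<times> UNIV\<close>.\<close>

definition time_C1 :: "real \<Rightarrow> (real \<times> 'a::euclidean_space) set \<Rightarrow>
    (real \<Rightarrow> 'a \<Rightarrow> 'b::real_normed_vector) \<Rightarrow> bool" where
  "time_C1 Tf Q f \<longleftrightarrow>
     continuous_on Q (\<lambda>(t, x). f t x) \<and>
     (\<forall>(t, x)\<in>Q. (\<lambda>t'. f t' x) differentiable (at t within {0..<Tf})) \<and>
     continuous_on Q (\<lambda>(t, x). time_deriv Tf f t x)"


section \<open>Vector calculus in three dimensions\<close>

definition grad :: "(real^3 \<Rightarrow> real) \<Rightarrow> real^3 \<Rightarrow> real^3" where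
  "grad f x = (\<chi> i. frechet_derivative f (at x) (axis i 1))"

definition dvg :: "(real^3 \<Rightarrow> real^3) \<Rightarrow> real^3 \<Rightarrow> real" where
  "dvg F x = trace (jacobian F (at x))"

definition tensor_dvg :: "(real^3 \<Rightarrow> real^3^3) \<Rightarrow> real^3 \<Rightarrow> real^3" where
  "tensor_dvg A x = (\<chi> i. dvg (\<lambda>y. A y $ i) x)"

definition outer :: "real^3 \<Rightarrow> real^3 \<Rightarrow> real^3^3" where
  "outer a b = (\<chi> i j. a $ i * b $ j)"


section \<open>Constitutive data\<close>

text \<open>Constituents are numbered \<open>1..nc\<close>, reactions \<open>1..nr\<close>; \<open>stoich P i \<alpha>\<close> is the coefficient of
  constituent \<open>\<alpha>\<close> in reaction \<open>i\<close>.\<close>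

record fluid_data =
  nc :: nat
  nr :: nat
  mass :: "nat \<Rightarrow> real"
  charge :: "nat \<Rightarrow> real"
  stoich :: "nat \<Rightarrow> nat \<Rightarrow> real"
  react_mob :: "nat \<Rightarrow> real"
  diff_mob :: "nat \<Rightarrow> nat \<Rightarrow> real"
  cap :: real  \<comment> \<open>the capillarity constant \<open>\<gamma>\<close>\<close>
  relax :: real  \<comment> \<open>the relaxation constant \<open>\<tau>\<close>\<close>
  eps0 :: real
  hint :: "real \<Rightarrow> real"  \<comment> \<open>the interpolation function \<open>h\<close>\<close>
  susL :: real
  susV :: real
  bulkL :: real  \<comment> \<open>\<open>K_L\<close>\<close>
  bulkV :: real  \<comment> \<open>\<open>K_V\<close>\<close>
  nref :: real  \<comment> \<open>\<open>n^R\<close>\<close>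
  pref :: real  \<comment> \<open>\<open>p^R\<close>\<close>
  psiref :: "nat \<Rightarrow> real"  \<comment> \<open>\<open>\<psi>^R\<close>\<close>
  boltz :: real
  temp :: real

definition fluid :: "fluid_data \<Rightarrow> bool" where
  "fluid P \<longleftrightarrow>
     2 \<le> nc P \<and>
     (\<forall>\<alpha>\<in>{1..nc P}. 0 < mass P \<alpha>) \<and>
     0 < cap P \<and> 0 < relax P \<and> 0 < eps0 P \<and>
     (\<forall>\<alpha>\<in>{1..nc P - 1}. \<forall>\<beta>\<in>{1..nc P - 1}. diff_mob P \<alpha> \<beta> = diff_mob P \<beta> \<alpha>) \<and>
     (\<forall>\<xi>::nat \<Rightarrow> real. (\<exists>\<alpha>\<in>{1..nc P - 1}. \<xi> \<alpha> \<noteq> 0) \<longrightarrow>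
        0 < (\<Sum>\<alpha>=1..nc P - 1. \<Sum>\<beta>=1..nc P - 1. diff_mob P \<alpha> \<beta> * \<xi> \<alpha> * \<xi> \<beta>)) \<and>
     smooth_on UNIV (hint P) \<and>
     (\<forall>z. 0 \<le> hint P z \<and> hint P z \<le> 1) \<and>
     (\<forall>z\<ge>1. hint P z = 1) \<and> (\<forall>z\<le>-1. hint P z = 0) \<and>
     (\<forall>z. 1 \<le> \<bar>z\<bar> \<longrightarrow> deriv (hint P) z = 0) \<and>
     0 \<le> susL P \<and> 0 \<le> susV P \<and>
     0 < bulkL P \<and> 0 < bulkV P \<and> 0 < nref P \<and> 0 < boltz P \<and> 0 < temp P"

definition dwell :: "real \<Rightarrow> real" where
  "dwell chi = (chi - 1)\<^sup>2 * (chi + 1)\<^sup>2"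

definition sus :: "fluid_data \<Rightarrow> real \<Rightarrow> real" where
  "sus P chi = hint P chi * susL P + (1 - hint P chi) * susV P"

definition ndens :: "fluid_data \<Rightarrow> (nat \<Rightarrow> real) \<Rightarrow> real" where
  "ndens P \<rho> = (\<Sum>\<alpha>=1..nc P. \<rho> \<alpha> / mass P \<alpha>)"

definition rhopsi :: "fluid_data \<Rightarrow> real \<Rightarrow> (nat \<Rightarrow> real) \<Rightarrow> real" where
  "rhopsi P K \<rho> =
     (\<Sum>\<alpha>=1..nc P. \<rho> \<alpha> * psiref P \<alpha>) + (K - pref P) * (1 - ndens P \<rho> / nref P)
     + K * (ndens P \<rho> / nref P) * ln (ndens P \<rho> / nref P)
     + boltz P * temp P *
       (\<Sum>\<alpha>=1..nc P. \<rho> \<alpha> / mass P \<alpha> * ln (\<rho> \<alpha> / mass P \<alpha> / ndens P \<rho>))"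

definition rhof :: "fluid_data \<Rightarrow> (nat \<Rightarrow> real) \<Rightarrow> real \<Rightarrow> real" where
  "rhof P \<rho> chi = hint P chi * rhopsi P (bulkL P) \<rho> + (1 - hint P chi) * rhopsi P (bulkV P) \<rho>"

definition drhof_dchi :: "fluid_data \<Rightarrow> (nat \<Rightarrow> real) \<Rightarrow> real \<Rightarrow> real" where
  "drhof_dchi P \<rho> chi = deriv (rhof P \<rho>) chi"

definition mu :: "fluid_data \<Rightarrow> nat \<Rightarrow> (nat \<Rightarrow> real) \<Rightarrow> real \<Rightarrow> real" where
  "mu P \<alpha> \<rho> chi = deriv (\<lambda>r. rhof P (\<rho>(\<alpha> := r)) chi) (\<rho> \<alpha>)"

definition dmu_drho :: "fluid_data \<Rightarrow> nat \<Rightarrow> nat \<Rightarrow> (nat \<Rightarrow> real) \<Rightarrow> real \<Rightarrow> real" where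
  "dmu_drho P \<beta> \<alpha> \<rho> chi = deriv (\<lambda>r. mu P \<beta> (\<rho>(\<alpha> := r)) chi) (\<rho> \<alpha>)"

definition dmu_dchi :: "fluid_data \<Rightarrow> nat \<Rightarrow> (nat \<Rightarrow> real) \<Rightarrow> real \<Rightarrow> real" where
  "dmu_dchi P \<beta> \<rho> chi = deriv (mu P \<beta> \<rho>) chi"

text \<open>The factor multiplying \<open>\<phi>\<close> in the diffusion fluxes.\<close>

definition zm :: "fluid_data \<Rightarrow> nat \<Rightarrow> real" where
  "zm P \<beta> = charge P \<beta> / mass P \<beta> - charge P (nc P) / mass P (nc P)"


section \<open>Geometry\<close>

record geometry =
  Tf :: real
  fluid_dom :: "(real^3) set"
  liquid :: "real \<Rightarrow> (real^3) set"  \<comment> \<open>\<open>\<Omega>^+(t)\<close>\<close>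
  vapor :: "real \<Rightarrow> (real^3) set"  \<comment> \<open>\<open>\<Omega>^-(t)\<close>\<close>
  Gam :: "real \<Rightarrow> (real^3) set"
  nu :: "real \<Rightarrow> real^3 \<Rightarrow> real^3"  \<comment> \<open>unit normal at points of \<open>\<Gamma>(t)\<close>\<close>
  params :: "(real^2) set"  \<comment> \<open>the parameter domain \<open>U\<close>\<close>
  chart :: "real \<Rightarrow> real^2 \<Rightarrow> real^3"  \<comment> \<open>parametrization of \<open>\<Gamma>(t)\<close> over \<open>U\<close>\<close>

definition spacetime :: "geometry \<Rightarrow> (real \<Rightarrow> (real^3) set) \<Rightarrow> (real \<times> (real^3)) set" where
  "spacetime G Om = {(t, x). t \<in> {0..<Tf G} \<and> x \<in> Om t}"

text \<open>Near each of its points, \<open>\<Gamma>\<close> is the regular zero set of a smooth function \<open>F\<close> of time and space that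
  is positive exactly in the liquid and negative exactly in the vapor; hence the normal pointing into
  the liquid is the normalized gradient of \<open>F\<close>.
  The parametrization is an immersion onto \<open>\<Gamma>(t)\<close>; it need not be injective and \<open>U\<close> need not be
  connected, so that closed surfaces are covered (take the disjoint union of the domains of an atlas).\<close>

definition evolving_interface :: "geometry \<Rightarrow> bool" where
  "evolving_interface G \<longleftrightarrow>
     0 < Tf G \<and> open (fluid_dom G) \<and> open (params G) \<and>
     openin (top_of_set ({0..<Tf G} \<times> UNIV)) (spacetime G (liquid G)) \<and>
     openin (top_of_set ({0..<Tf G} \<times> UNIV)) (spacetime G (vapor G)) \<and>
     (\<forall>t\<in>{0..<Tf G}.
        liquid G t \<union> Gam G t \<union> vapor G t = fluid_dom G \<and>
        liquid G t \<inter> Gam G t = {} \<and> vapor G t \<inter> Gam G t = {} \<and> liquid G t \<inter> vapor G t = {}) \<and>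
     (\<forall>t\<in>{0..<Tf G}. \<forall>x\<in>Gam G t. \<exists>B F.
        open B \<and> (t, x) \<in> B \<and> smooth_on (B \<inter> {0..<Tf G} \<times> UNIV) F \<and>
        (\<forall>(t', y) \<in> B \<inter> {0..<Tf G} \<times> UNIV.
           (y \<in> Gam G t' \<longleftrightarrow> F (t', y) = (0::real)) \<and>
           (y \<in> liquid G t' \<longleftrightarrow> 0 < F (t', y)) \<and>
           (y \<in> vapor G t' \<longleftrightarrow> F (t', y) < 0) \<and>
           grad (\<lambda>y. F (t', y)) y \<noteq> 0 \<and>
           (y \<in> Gam G t' \<longrightarrow> nu G t' y = sgn (grad (\<lambda>y. F (t', y)) y)))) \<and>
     smooth_on ({0..<Tf G} \<times> params G) (\<lambda>(t, s). chart G t s) \<and>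
     (\<forall>t\<in>{0..<Tf G}. chart G t ` params G = Gam G t \<and>
        (\<forall>s\<in>params G. inj (frechet_derivative (chart G t) (at s))))"

definition tangent :: "geometry \<Rightarrow> real \<Rightarrow> real^2 \<Rightarrow> 2 \<Rightarrow> real^3" where
  "tangent G t s i = frechet_derivative (chart G t) (at s) (axis i 1)"

definition metric :: "geometry \<Rightarrow> real \<Rightarrow> real^2 \<Rightarrow> real^2^2" where
  "metric G t s = (\<chi> i j. tangent G t s i \<bullet> tangent G t s j)"

text \<open>Surface gradient of a function on \<open>\<Gamma>(t)\<close> given in the parameter \<open>s\<close>.\<close>

definition surf_grad :: "geometry \<Rightarrow> real \<Rightarrow> (real^2 \<Rightarrow> real) \<Rightarrow> real^2 \<Rightarrow> real^3" where
  "surf_grad G t f s =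
     (\<Sum>i\<in>UNIV. \<Sum>j\<in>UNIV.
        (matrix_inv (metric G t s) $ i $ j * frechet_derivative f (at s) (axis j 1)) *\<^sub>R tangent G t s i)"

text \<open>Mean curvature is the sum of the principal curvatures, with the sign convention that it equals
  minus the surface divergence of \<open>\<nu>\<close>. This is the convention for which the Laplacian
  expands as \<open>\<epsilon>^-2 \<partial>_zz - \<epsilon>^-1 \<kappa> \<partial>_z + ...\<close> in the stretched coordinate, as in the inner equations.\<close>

definition mean_curv :: "geometry \<Rightarrow> real \<Rightarrow> real^2 \<Rightarrow> real" where
  "mean_curv G t s = - (\<Sum>k\<in>UNIV. surf_grad G t (\<lambda>s'. nu G t (chart G t s') $ k) s $ k)"

definition normal_vel :: "geometry \<Rightarrow> real \<Rightarrow> real^2 \<Rightarrow> real" where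
  "normal_vel G t s = time_deriv (Tf G) (chart G) t s \<bullet> nu G t (chart G t s)"

definition one_sided :: "(real^3) set \<Rightarrow> (real^3 \<Rightarrow> 'b::t2_space) \<Rightarrow> real^3 \<Rightarrow> 'b" where
  "one_sided S f x = Lim (at x within S) f"

definition jump :: "geometry \<Rightarrow> real \<Rightarrow> (real^3 \<Rightarrow> 'b::real_normed_vector) \<Rightarrow> real^3 \<Rightarrow> 'b" where
  "jump G t f x = one_sided (liquid G t) f x - one_sided (vapor G t) f x"

definition has_traces :: "geometry \<Rightarrow> (real \<Rightarrow> real^3 \<Rightarrow> 'b::real_normed_vector) \<Rightarrow> bool" where
  "has_traces G f \<longleftrightarrow>
     (\<forall>t\<in>{0..<Tf G}. \<forall>x\<in>Gam G t. \<forall>S\<in>{liquid G t, vapor G t}.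
        (\<exists>l. (f t \<longlongrightarrow> l) (at x within S)) \<and>
        (\<forall>e. \<exists>l. ((\<lambda>y. frechet_derivative (f t) (at y) e) \<longlongrightarrow> l) (at x within S)))"


section \<open>Outer solutions\<close>

definition rho_tot :: "fluid_data \<Rightarrow> (nat \<Rightarrow> real \<Rightarrow> real^3 \<Rightarrow> real) \<Rightarrow> real \<Rightarrow> real^3 \<Rightarrow> real" where
  "rho_tot P rho t x = (\<Sum>\<alpha>=1..nc P. rho \<alpha> t x)"

definition mu_out :: "fluid_data \<Rightarrow> (nat \<Rightarrow> real \<Rightarrow> real^3 \<Rightarrow> real) \<Rightarrow> (real \<Rightarrow> real^3 \<Rightarrow> real)
    \<Rightarrow> nat \<Rightarrow> real \<Rightarrow> real^3 \<Rightarrow> real" where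
  "mu_out P rho chi0 \<alpha> t x = mu P \<alpha> (\<lambda>\<beta>. rho \<beta> t x) (chi0 t x)"

definition rhof_out :: "fluid_data \<Rightarrow> (nat \<Rightarrow> real \<Rightarrow> real^3 \<Rightarrow> real) \<Rightarrow> (real \<Rightarrow> real^3 \<Rightarrow> real)
    \<Rightarrow> real \<Rightarrow> real^3 \<Rightarrow> real" where
  "rhof_out P rho chi0 t x = rhof P (\<lambda>\<beta>. rho \<beta> t x) (chi0 t x)"

definition outer_solution :: "fluid_data \<Rightarrow> geometry \<Rightarrow>
    (nat \<Rightarrow> real \<Rightarrow> real^3 \<Rightarrow> real) \<Rightarrow> (real \<Rightarrow> real^3 \<Rightarrow> real^3) \<Rightarrow>
    (real \<Rightarrow> real^3 \<Rightarrow> real) \<Rightarrow> (real \<Rightarrow> real^3 \<Rightarrow> real) \<Rightarrow> (real \<Rightarrow> real^3 \<Rightarrow> real) \<Rightarrow> bool" where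
  "outer_solution P G rho v chi0 chi1 \<phi> \<longleftrightarrow>
     (\<forall>Q\<in>{spacetime G (liquid G), spacetime G (vapor G)}.
        (\<forall>\<alpha>\<in>{1..nc P}. space_Ck 2 Q (rho \<alpha>) \<and> time_C1 (Tf G) Q (rho \<alpha>) \<and>
           (\<forall>(t, x)\<in>Q. 0 < rho \<alpha> t x)) \<and>
        space_Ck 1 Q v \<and> time_C1 (Tf G) Q v \<and>
        space_Ck 2 Q chi0 \<and> space_Ck 2 Q \<phi> \<and> space_Ck 1 Q chi1) \<and>
     (\<forall>\<alpha>\<in>{1..nc P}. has_traces G (rho \<alpha>)) \<and>
     has_traces G v \<and> has_traces G chi0 \<and> has_traces G chi1 \<and> has_traces G \<phi> \<and>
     (\<forall>(t, x)\<in>spacetime G (liquid G). 0 < chi0 t x) \<and>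
     (\<forall>(t, x)\<in>spacetime G (vapor G). chi0 t x < 0) \<and>
     (\<forall>(t, x)\<in>spacetime G (liquid G) \<union> spacetime G (vapor G).
        (\<forall>\<alpha>\<in>{1..nc P - 1}.
           0 = time_deriv (Tf G) (rho \<alpha>) t x + dvg (\<lambda>y. rho \<alpha> t y *\<^sub>R v t y) x
             - dvg (\<lambda>y. \<Sum>\<beta>=1..nc P - 1. diff_mob P \<alpha> \<beta> *\<^sub>R
                 grad (\<lambda>y. mu_out P rho chi0 \<beta> t y - mu_out P rho chi0 (nc P) t y + zm P \<beta> * \<phi> t y) y) x
             - (\<Sum>i=1..nr P. mass P \<alpha> * stoich P i \<alpha> * react_mob P i *
                 (1 - exp (\<Sum>\<beta>=1..nc P. mass P \<beta> * stoich P i \<beta> * mu_out P rho chi0 \<beta> t x)))) \<and>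
        0 = time_deriv (Tf G) (rho_tot P rho) t x + dvg (\<lambda>y. rho_tot P rho t y *\<^sub>R v t y) x \<and>
        0 = deriv dwell (chi0 t x) \<and>
        0 = time_deriv (Tf G) (\<lambda>t y. rho_tot P rho t y *\<^sub>R v t y) t x
          + tensor_dvg (\<lambda>y. rho_tot P rho t y *\<^sub>R outer (v t y) (v t y)) x
          + grad (\<lambda>y. (\<Sum>\<alpha>=1..nc P. rho \<alpha> t y * mu_out P rho chi0 \<alpha> t y) - rhof_out P rho chi0 t y) x
          - grad (\<lambda>y. deriv dwell (chi0 t y) * chi1 t y) x
          + eps0 P *\<^sub>R tensor_dvg (\<lambda>y. (1 + sus P (chi0 t y)) *\<^sub>R
              ((1/2 * (norm (grad (\<phi> t) y))\<^sup>2) *\<^sub>R mat 1 - outer (grad (\<phi> t) y) (grad (\<phi> t) y))) x \<and>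
        0 = deriv (deriv dwell) (chi0 t x) * chi1 t x + drhof_dchi P (\<lambda>\<beta>. rho \<beta> t x) (chi0 t x)
          - eps0 P / 2 * deriv (sus P) (chi0 t x) * (norm (grad (\<phi> t) x))\<^sup>2 \<and>
        0 = eps0 P * dvg (\<lambda>y. (1 + sus P (chi0 t y)) *\<^sub>R grad (\<phi> t) y) x
          + (\<Sum>\<alpha>=1..nc P. charge P \<alpha> / mass P \<alpha> * rho \<alpha> t x))"


section \<open>Inner solutions\<close>

type_synonym inner_scalar = "real \<Rightarrow> real^2 \<Rightarrow> real \<Rightarrow> real"  \<comment> \<open>arguments \<open>t\<close>, \<open>s\<close>, \<open>z\<close>\<close>
type_synonym inner_vector = "real \<Rightarrow> real^2 \<Rightarrow> real \<Rightarrow> real^3"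

definition mu_in0 :: "fluid_data \<Rightarrow> (nat \<Rightarrow> inner_scalar) \<Rightarrow> inner_scalar \<Rightarrow> nat \<Rightarrow> inner_scalar" where
  "mu_in0 P R0 X0 \<beta> t s z = mu P \<beta> (\<lambda>\<alpha>. R0 \<alpha> t s z) (X0 t s z)"

definition mu_in1 :: "fluid_data \<Rightarrow> (nat \<Rightarrow> inner_scalar) \<Rightarrow> (nat \<Rightarrow> inner_scalar) \<Rightarrow>
    inner_scalar \<Rightarrow> inner_scalar \<Rightarrow> nat \<Rightarrow> inner_scalar" where
  "mu_in1 P R0 R1 X0 X1 \<beta> t s z =
     (\<Sum>\<alpha>=1..nc P. dmu_drho P \<beta> \<alpha> (\<lambda>\<alpha>. R0 \<alpha> t s z) (X0 t s z) * R1 \<alpha> t s z)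
     + dmu_dchi P \<beta> (\<lambda>\<alpha>. R0 \<alpha> t s z) (X0 t s z) * X1 t s z"

definition R_tot :: "fluid_data \<Rightarrow> (nat \<Rightarrow> inner_scalar) \<Rightarrow> inner_scalar" where
  "R_tot P R0 t s z = (\<Sum>\<alpha>=1..nc P. R0 \<alpha> t s z)"

definition cont_ts :: "geometry \<Rightarrow> (real \<Rightarrow> real^2 \<Rightarrow> real \<Rightarrow> 'b::topological_space) \<Rightarrow> bool" where
  "cont_ts G f \<longleftrightarrow> (\<forall>z. continuous_on ({0..<Tf G} \<times> params G) (\<lambda>(t, s). f t s z))"

definition Ck_z :: "geometry \<Rightarrow> nat \<Rightarrow> (real \<Rightarrow> real^2 \<Rightarrow> real \<Rightarrow> 'b::real_normed_vector) \<Rightarrow> bool" where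
  "Ck_z G k f \<longleftrightarrow> (\<forall>t\<in>{0..<Tf G}. \<forall>s\<in>params G. Ck_on k UNIV (f t s))"

definition C1_s :: "geometry \<Rightarrow> inner_scalar \<Rightarrow> bool" where
  "C1_s G f \<longleftrightarrow> (\<forall>t\<in>{0..<Tf G}. \<forall>z. Ck_on 1 (params G) (\<lambda>s. f t s z))"

definition inner_solution :: "fluid_data \<Rightarrow> geometry \<Rightarrow>
    (nat \<Rightarrow> inner_scalar) \<Rightarrow> (nat \<Rightarrow> inner_scalar) \<Rightarrow> inner_vector \<Rightarrow>
    inner_scalar \<Rightarrow> inner_scalar \<Rightarrow> inner_scalar \<Rightarrow> inner_scalar \<Rightarrow> bool" where
  "inner_solution P G R0 R1 V0 X0 X1 \<Phi>0 \<Phi>1 \<longleftrightarrow>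
     (\<exists>t\<in>{0..<Tf G}. \<exists>s\<in>params G. \<exists>z. X0 t s z \<noteq> 0) \<and>
     (\<forall>\<alpha>\<in>{1..nc P}. cont_ts G (R0 \<alpha>) \<and> cont_ts G (R1 \<alpha>) \<and> Ck_z G 2 (R0 \<alpha>) \<and> Ck_z G 2 (R1 \<alpha>) \<and>
        (\<forall>t\<in>{0..<Tf G}. \<forall>s\<in>params G. \<forall>z. 0 < R0 \<alpha> t s z)) \<and>
     cont_ts G V0 \<and> Ck_z G 1 V0 \<and>
     (\<forall>f\<in>{X0, X1, \<Phi>0, \<Phi>1}. cont_ts G f \<and> Ck_z G 2 f) \<and>
     C1_s G X0 \<and> C1_s G \<Phi>0 \<and>
     (\<forall>t\<in>{0..<Tf G}. \<forall>s\<in>params G. \<forall>z.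
       (let n = nu G t (chart G t s); w = normal_vel G t s; \<kappa> = mean_curv G t s;
            \<gamma> = cap P; X = X0 t s; X' = X1 t s; d\<Phi> = deriv (\<Phi>1 t s); V = V0 t s;
            R = (\<lambda>\<alpha>. R0 \<alpha> t s); M0 = (\<lambda>\<beta>. mu_in0 P R0 X0 \<beta> t s);
            M1 = (\<lambda>\<beta>. mu_in1 P R0 R1 X0 X1 \<beta> t s);
            RF = (\<lambda>z. rhof P (\<lambda>\<alpha>. R \<alpha> z) (X z));
            j = (\<lambda>z. R_tot P R0 t s z * (V z \<bullet> n - w));
            E = (\<lambda>z. 1 + sus P (X z));
            gX = surf_grad G t (\<lambda>s'. X0 t s' z) s;
            gW = surf_grad G t (\<lambda>s'. dwell (X0 t s' z)) s;
            g\<Phi> = surf_grad G t (\<lambda>s'. \<Phi>0 t s' z) s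
        in
          0 = deriv (\<lambda>z. 1/2 * E z * (deriv (\<Phi>0 t s) z)\<^sup>2 - E z * (deriv (\<Phi>0 t s) z)\<^sup>2) z \<and>
          (\<forall>\<alpha>\<in>{1..nc P - 1}.
             0 = deriv (\<lambda>z. \<Sum>\<beta>=1..nc P - 1. diff_mob P \<alpha> \<beta> * deriv (\<lambda>z. M0 \<beta> z - M0 (nc P) z) z) z) \<and>
          0 = deriv dwell (X z) - \<gamma> * deriv (deriv X) z \<and>
          0 = deriv j z \<and>
          0 = j z *\<^sub>R vector_derivative V (at z)
            + deriv (\<lambda>z. (\<Sum>\<alpha>=1..nc P. R \<alpha> z * M0 \<alpha> z) - RF z - deriv dwell (X z) * X' z) z *\<^sub>R n
            + (\<gamma> * (deriv X z * deriv (deriv X') z + deriv (deriv X) z * deriv X' z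
                    - \<kappa> * (deriv X z)\<^sup>2)) *\<^sub>R n
            - gW + (\<gamma> * deriv (deriv X) z) *\<^sub>R gX
            + (eps0 P / 2 * ((d\<Phi> z)\<^sup>2 + (norm g\<Phi>)\<^sup>2) * deriv E z) *\<^sub>R n
            - (eps0 P * deriv (\<lambda>z. E z * d\<Phi> z) z) *\<^sub>R (d\<Phi> z *\<^sub>R n + g\<Phi>) \<and>
          0 = j z / relax P * deriv X z + deriv (deriv dwell) (X z) * X' z - \<gamma> * deriv (deriv X') z
            + \<gamma> * \<kappa> * deriv X z + drhof_dchi P (\<lambda>\<alpha>. R \<alpha> z) (X z)
            - eps0 P / 2 * deriv (sus P) (X z) * ((d\<Phi> z)\<^sup>2 + (norm g\<Phi>)\<^sup>2) \<and>
          0 = deriv (\<lambda>z. E z * d\<Phi> z) z \<and>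
          (\<forall>\<alpha>\<in>{1..nc P - 1}.
             0 = deriv (\<lambda>z. R \<alpha> z * (V z \<bullet> n - w)) z
               - (\<Sum>\<beta>=1..nc P - 1. diff_mob P \<alpha> \<beta> *
                   (deriv (deriv (\<lambda>z. M1 \<beta> z - M1 (nc P) z)) z
                    - \<kappa> * deriv (\<lambda>z. M0 \<beta> z - M0 (nc P) z) z
                    + zm P \<beta> * deriv d\<Phi> z)))))"


section \<open>Matching solutions\<close>

text \<open>Matching at the parameter point \<open>(t, s)\<close> with the bulk region \<open>S\<close>, where \<open>Z\<close> is the filter for
  \<open>z\<close> tending to plus infinity (liquid) or minus infinity (vapor).\<close>

definition matches :: "fluid_data \<Rightarrow> geometry \<Rightarrow> real \<Rightarrow> real^2 \<Rightarrow> (real^3) set \<Rightarrow> real filter \<Rightarrow>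
    (nat \<Rightarrow> real \<Rightarrow> real^3 \<Rightarrow> real) \<Rightarrow> (real \<Rightarrow> real^3 \<Rightarrow> real^3) \<Rightarrow>
    (real \<Rightarrow> real^3 \<Rightarrow> real) \<Rightarrow> (real \<Rightarrow> real^3 \<Rightarrow> real) \<Rightarrow> (real \<Rightarrow> real^3 \<Rightarrow> real) \<Rightarrow>
    (nat \<Rightarrow> inner_scalar) \<Rightarrow> (nat \<Rightarrow> inner_scalar) \<Rightarrow> inner_vector \<Rightarrow>
    inner_scalar \<Rightarrow> inner_scalar \<Rightarrow> inner_scalar \<Rightarrow> inner_scalar \<Rightarrow> bool" where
  "matches P G t s S Z rho v chi0 chi1 \<phi> R0 R1 V0 X0 X1 \<Phi>0 \<Phi>1 \<longleftrightarrow>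
     (let x = chart G t s; n = nu G t x in
       (\<forall>\<alpha>\<in>{1..nc P}.
          0 < one_sided S (rho \<alpha> t) x \<and>
          (R0 \<alpha> t s \<longlongrightarrow> one_sided S (rho \<alpha> t) x) Z \<and>
          (deriv (R0 \<alpha> t s) \<longlongrightarrow> 0) Z \<and>
          (deriv (R1 \<alpha> t s) \<longlongrightarrow> one_sided S (grad (rho \<alpha> t)) x \<bullet> n) Z \<and>
          (deriv (mu_in0 P R0 X0 \<alpha> t s) \<longlongrightarrow> 0) Z \<and>
          (deriv (mu_in1 P R0 R1 X0 X1 \<alpha> t s) \<longlongrightarrow> one_sided S (grad (mu_out P rho chi0 \<alpha> t)) x \<bullet> n) Z) \<and>
       (V0 t s \<longlongrightarrow> one_sided S (v t) x) Z \<and>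
       ((\<lambda>z. vector_derivative (V0 t s) (at z)) \<longlongrightarrow> 0) Z \<and>
       (X0 t s \<longlongrightarrow> one_sided S (chi0 t) x) Z \<and>
       (deriv (X0 t s) \<longlongrightarrow> 0) Z \<and>
       (\<Phi>0 t s \<longlongrightarrow> one_sided S (\<phi> t) x) Z \<and>
       (deriv (\<Phi>0 t s) \<longlongrightarrow> 0) Z \<and>
       ((\<lambda>z. X1 t s z - one_sided S (chi1 t) x - z * (one_sided S (grad (chi0 t)) x \<bullet> n)) \<longlongrightarrow> 0) Z \<and>
       (deriv (X1 t s) \<longlongrightarrow> one_sided S (grad (chi0 t)) x \<bullet> n) Z \<and>
       (deriv (\<Phi>1 t s) \<longlongrightarrow> one_sided S (grad (\<phi> t)) x \<bullet> n) Z)"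

definition matching_solution :: "fluid_data \<Rightarrow> geometry \<Rightarrow>
    (nat \<Rightarrow> real \<Rightarrow> real^3 \<Rightarrow> real) \<Rightarrow> (real \<Rightarrow> real^3 \<Rightarrow> real^3) \<Rightarrow>
    (real \<Rightarrow> real^3 \<Rightarrow> real) \<Rightarrow> (real \<Rightarrow> real^3 \<Rightarrow> real) \<Rightarrow> (real \<Rightarrow> real^3 \<Rightarrow> real) \<Rightarrow>
    (nat \<Rightarrow> inner_scalar) \<Rightarrow> (nat \<Rightarrow> inner_scalar) \<Rightarrow> inner_vector \<Rightarrow>
    inner_scalar \<Rightarrow> inner_scalar \<Rightarrow> inner_scalar \<Rightarrow> inner_scalar \<Rightarrow> bool" where
  "matching_solution P G rho v chi0 chi1 \<phi> R0 R1 V0 X0 X1 \<Phi>0 \<Phi>1 \<longleftrightarrow>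
     outer_solution P G rho v chi0 chi1 \<phi> \<and>
     inner_solution P G R0 R1 V0 X0 X1 \<Phi>0 \<Phi>1 \<and>
     (\<forall>t\<in>{0..<Tf G}. \<forall>s\<in>params G.
        matches P G t s (liquid G t) at_top rho v chi0 chi1 \<phi> R0 R1 V0 X0 X1 \<Phi>0 \<Phi>1 \<and>
        matches P G t s (vapor G t) at_bot rho v chi0 chi1 \<phi> R0 R1 V0 X0 X1 \<Phi>0 \<Phi>1)"

text \<open>The one-sided interfacial mass flux \<open>\<rho>\<^sub>0^\<plusminus> (v\<^sub>0^\<plusminus> \<bullet> \<nu> - w)\<close>.\<close>

definition mass_flux :: "fluid_data \<Rightarrow> geometry \<Rightarrow> (nat \<Rightarrow> real \<Rightarrow> real^3 \<Rightarrow> real) \<Rightarrow>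
    (real \<Rightarrow> real^3 \<Rightarrow> real^3) \<Rightarrow> (real \<Rightarrow> (real^3) set) \<Rightarrow> real \<Rightarrow> real^2 \<Rightarrow> real" where
  "mass_flux P G rho v Om t s =
     one_sided (Om t) (rho_tot P rho t) (chart G t s) *
     (one_sided (Om t) (v t) (chart G t s) \<bullet> nu G t (chart G t s) - normal_vel G t s)"

end

theory Submission
  imports Defs
begin

text \<open>In the bulk, \<open>W'(\<chi>\<^sub>0) = 0\<close> forces \<open>\<chi>\<^sub>0 = 1\<close> or \<open>\<chi>\<^sub>0 = -1\<close>, where \<open>h'\<close> and \<open>s'\<close> vanish, so that \<open>W'' \<chi>\<^sub>1 = 0\<close>.
  At a point of the interface every inner equation is a total \<open>z\<close>-derivative of an expression whose limits for
  \<open>z\<close> tending to plus or minus infinity are given by the matching conditions. The jump conditions without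
  capillary or dissipative terms are constancy statements. The momentum equation integrates to the jump of
  the stress, because the terms in \<open>X\<^sub>1\<close> combine to \<open>(\<gamma> X' X\<^sub>1' - W'(X) X\<^sub>1)'\<close>; the normal momentum equation plus
  \<open>X'\<close> times the phase field equation integrates to the jump of the energy, by the Gibbs-Duhem relation and because
  \<open>\<mu>\<^sub>\<alpha> - \<mu>\<^sub>N\<close> is constant in \<open>z\<close>. Since \<open>\<Phi>\<^sub>0\<close> is constant in \<open>z\<close>, it is the trace of \<open>\<phi>\<^sub>0\<close> from both sides, and its
  surface gradient is the tangential part of both one-sided limits of \<open>\<nabla>\<phi>\<^sub>0\<close>.\<close>

text \<open>\<open>deriv\<close> and \<open>one_sided\<close> are total, so
  \<open>0 = deriv f z\<close> has content only once \<open>f\<close> is known to be differentiable,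
  and \<open>one_sided\<close> is a trace only once the limit exists. Closed forms of the chemical
  potentials on positive densities supply both: derivatives along the profile, and traces of the
  bulk gradients of \<open>mu_out\<close>, which are not among the assumed traces. The integrals run
  over the whole line, while matching gives decay of \<open>X'\<close> without a rate; integrability
  has to be extracted from the profile equation. That
  \<open>\<mu>\<^sub>\<alpha> - \<mu>\<^sub>N\<close> is constant in \<open>z\<close> rests on
  definiteness of the mobility matrix: the diffusion fluxes are constant, vanish at infinity, and
  the matrix has trivial kernel. The matching condition allows \<open>X1\<close> to grow linearly;
  it does not, because the phase variable is constant in each bulk region, and so
  \<open>W'(X) X1\<close> leaves no boundary term. Tangential momentum closes for two reasons: the
  surface gradients of \<open>X0\<close> cancel by the profile equation, and the tangential Maxwell
  traction is a product of the normal displacement and the tangential field, both continuous across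
  the interface.\<close>

section \<open>Calculus of twice differentiable functions on the line\<close>

text \<open>A class closed under arithmetic, composition, inverse and logarithm, so that
  differentiability of the explicit formulas below follows by introduction rules. The first
  derivative is automatically continuous, which is what the integrands require.\<close>

definition twice_differentiable :: "(real \<Rightarrow> real) \<Rightarrow> bool" where
  "twice_differentiable f \<longleftrightarrow>
     (\<exists>f' f''. (\<forall>z. (f has_real_derivative f' z) (at z)) \<and> (\<forall>z. (f' has_real_derivative f'' z) (at z)))"

lemma twice_differentiableI:
  assumes "\<And>z. (f has_real_derivative f' z) (at z)" "\<And>z. (f' has_real_derivative f'' z) (at z)"
  shows "twice_differentiable f"
  using assms unfolding twice_differentiable_def by blast

lemma twice_differentiable_deriv:
  assumes "twice_differentiable f"
  shows "(f has_real_derivative deriv f z) (at z)"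
    and "(deriv f has_real_derivative deriv (deriv f) z) (at z)"
proof -
  obtain f' f'' where f: "\<And>z. (f has_real_derivative f' z) (at z)" "\<And>z. (f' has_real_derivative f'' z) (at z)"
    using assms unfolding twice_differentiable_def by blast
  have "deriv f = f'" using f(1) by (auto intro: DERIV_imp_deriv)
  moreover have "deriv f' = f''" using f(2) by (auto intro: DERIV_imp_deriv)
  ultimately show "(f has_real_derivative deriv f z) (at z)"
    and "(deriv f has_real_derivative deriv (deriv f) z) (at z)" using f by auto
qed

lemma twice_differentiable_continuous:
  assumes "twice_differentiable f"
  shows "continuous_on S f" "continuous_on S (deriv f)"
  using twice_differentiable_deriv[OF assms]
  by (meson DERIV_isCont continuous_at_imp_continuous_on)+

lemma twice_differentiable_const: "twice_differentiable (\<lambda>z. c)"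
  by (rule twice_differentiableI[where f' = "\<lambda>_. 0" and f'' = "\<lambda>_. 0"]) auto

lemma twice_differentiable_add:
  assumes "twice_differentiable f" "twice_differentiable g"
  shows "twice_differentiable (\<lambda>z. f z + g z)"
  by (rule twice_differentiableI)
     (rule derivative_eq_intros twice_differentiable_deriv[OF assms(1)] twice_differentiable_deriv[OF assms(2)] refl)+

lemma twice_differentiable_mult:
  assumes "twice_differentiable f" "twice_differentiable g"
  shows "twice_differentiable (\<lambda>z. f z * g z)"
  by (rule twice_differentiableI)
     (rule derivative_eq_intros twice_differentiable_deriv[OF assms(1)] twice_differentiable_deriv[OF assms(2)] refl)+

lemma twice_differentiable_diff:
  assumes "twice_differentiable f" "twice_differentiable g"
  shows "twice_differentiable (\<lambda>z. f z - g z)"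
  by (rule twice_differentiableI)
     (rule derivative_eq_intros twice_differentiable_deriv[OF assms(1)] twice_differentiable_deriv[OF assms(2)] refl)+

lemma twice_differentiable_divide_const:
  "twice_differentiable f \<Longrightarrow> twice_differentiable (\<lambda>z. f z / c)"
  using twice_differentiable_mult[OF _ twice_differentiable_const[of "1/c"], of f] by simp

lemma twice_differentiable_sum:
  assumes "\<And>i. i \<in> I \<Longrightarrow> twice_differentiable (f i)"
  shows "twice_differentiable (\<lambda>z. \<Sum>i\<in>I. f i z)"
  using assms
  by (induction I rule: infinite_finite_induct)
     (auto intro: twice_differentiable_const twice_differentiable_add)

lemma twice_differentiable_compose:
  assumes f: "twice_differentiable f" and g: "twice_differentiable g"
  shows "twice_differentiable (\<lambda>z. f (g z))"
proof (rule twice_differentiableI)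
  show "((\<lambda>z. f (g z)) has_real_derivative deriv f (g z) * deriv g z) (at z)" for z
    by (rule DERIV_chain2 twice_differentiable_deriv f g)+
  show "((\<lambda>z. deriv f (g z) * deriv g z) has_real_derivative
     deriv (deriv f) (g z) * deriv g z * deriv g z + deriv (deriv g) z * deriv f (g z)) (at z)" for z
    by (rule DERIV_mult DERIV_chain2 twice_differentiable_deriv f g)+
qed

lemma twice_differentiable_inverse:
  assumes f: "twice_differentiable f" and nz: "\<And>z. f z \<noteq> 0"
  shows "twice_differentiable (\<lambda>z. inverse (f z))"
  by (rule twice_differentiableI)
     (rule derivative_eq_intros twice_differentiable_deriv[OF f] refl nz | simp add: nz)+

lemma twice_differentiable_ln:
  assumes f: "twice_differentiable f" and pos: "\<And>z. 0 < f z"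
  shows "twice_differentiable (\<lambda>z. ln (f z))"
proof -
  have nz: "f z \<noteq> 0" for z using pos[of z] by simp
  show ?thesis
  proof (rule twice_differentiableI)
    show "((\<lambda>z. ln (f z)) has_real_derivative inverse (f z) * deriv f z) (at z)" for z
      using DERIV_chain2[OF DERIV_ln[OF pos] twice_differentiable_deriv(1)[OF f]] by simp
    show "((\<lambda>z. inverse (f z) * deriv f z) has_real_derivative
       deriv (\<lambda>z. inverse (f z)) z * deriv f z + deriv (deriv f) z * inverse (f z)) (at z)" for z
      by (rule DERIV_mult twice_differentiable_deriv twice_differentiable_inverse f nz)+
  qed
qed

text \<open>A linear map on the line is determined by its value at 1. This passes from the
  directional Frechet derivatives in \<open>Ck_on\<close> to ordinary derivatives.\<close>

lemma Ck_on_Suc_real: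
  fixes f :: "real \<Rightarrow> 'b::real_normed_vector"
  assumes "Ck_on (Suc k) UNIV f"
  shows "(f has_vector_derivative frechet_derivative f (at z) 1) (at z)"
    and "Ck_on k UNIV (\<lambda>z. frechet_derivative f (at z) 1)"
proof -
  have "f differentiable (at z)" for z
    using assms by (simp add: differentiable_on_def)
  then have D: "(f has_derivative frechet_derivative f (at z)) (at z)" for z
    by (simp add: frechet_derivative_works)
  have "frechet_derivative f (at z) = (\<lambda>x. x *\<^sub>R frechet_derivative f (at z) 1)"
    using linear.scaleR[OF linear_frechet_derivative[of f "at z"]] \<open>f differentiable (at z)\<close>
    by (metis mult.right_neutral real_scaleR_def)
  then show "(f has_vector_derivative frechet_derivative f (at z) 1) (at z)"
    using D[of z] by (simp add: has_vector_derivative_def)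
  show "Ck_on k UNIV (\<lambda>z. frechet_derivative f (at z) 1)"
    using assms by simp
qed

lemma Ck_on_Suc_deriv:
  fixes f :: "real \<Rightarrow> real"
  assumes "Ck_on (Suc k) UNIV f"
  shows "(f has_real_derivative deriv f z) (at z)" and "Ck_on k UNIV (deriv f)"
proof -
  have D: "(f has_real_derivative frechet_derivative f (at z) 1) (at z)" for z
    using Ck_on_Suc_real(1)[OF assms] by (simp add: has_real_derivative_iff_has_vector_derivative)
  then have "deriv f = (\<lambda>z. frechet_derivative f (at z) 1)"
    by (auto intro: DERIV_imp_deriv)
  then show "(f has_real_derivative deriv f z) (at z)" "Ck_on k UNIV (deriv f)"
    using D Ck_on_Suc_real(2)[OF assms] by auto
qed

lemma Ck_on_2_twice_differentiable:
  fixes f :: "real \<Rightarrow> real"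
  assumes "Ck_on 2 UNIV f"
  shows "twice_differentiable f"
proof -
  have *: "Ck_on (Suc (Suc 0)) UNIV f" using assms by (simp add: numeral_2_eq_2)
  show ?thesis
    by (rule twice_differentiableI[OF Ck_on_Suc_deriv(1)[OF *] Ck_on_Suc_deriv(1)[OF Ck_on_Suc_deriv(2)[OF *]]])
qed

lemma smooth_on_twice_differentiable:
  fixes f :: "real \<Rightarrow> real"
  assumes "smooth_on UNIV f"
  shows "twice_differentiable f" "twice_differentiable (deriv f)"
proof -
  show "twice_differentiable f"
    using assms by (intro Ck_on_2_twice_differentiable) (auto simp: smooth_on_def)
  have "Ck_on (Suc 2) UNIV f" using assms unfolding smooth_on_def by blast
  then show "twice_differentiable (deriv f)"
    by (intro Ck_on_2_twice_differentiable Ck_on_Suc_deriv(2))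
qed

section \<open>Constancy and integration over the whole line\<close>

text \<open>Serves every inner equation without a source: the two far-field limits agree with each
  other and with the value at each \<open>z\<close>.\<close>

lemma constant_of_deriv_zero:
  fixes g :: "real \<Rightarrow> real"
  assumes D: "\<And>z. (g has_real_derivative 0) (at z)"
    and "(g \<longlongrightarrow> a) at_top" "(g \<longlongrightarrow> b) at_bot"
  shows "g z = a" "g z = b"
proof -
  have c: "g = (\<lambda>_. g z)" using DERIV_isconst_all[of g] D by blast
  show "g z = a" using tendsto_unique[OF _ assms(2), of "g z"] c by (metis tendsto_const trivial_limit_at_top_linorder)
  show "g z = b" using tendsto_unique[OF _ assms(3), of "g z"] c by (metis tendsto_const trivial_limit_at_bot_linorder)
qed

text \<open>Comparison with an exact derivative: the majorant \<open>g\<close> has an antiderivative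
  with a finite limit, so its integral over the half line is finite, and that of \<open>f\<close>
  with it.\<close>

lemma integrable_halfline_bound:
  fixes f g G :: "real \<Rightarrow> real"
  assumes "continuous_on UNIV f" "continuous_on UNIV g"
    and "\<And>x. a \<le> x \<Longrightarrow> (G has_real_derivative g x) (at x)"
    and "\<And>x. a \<le> x \<Longrightarrow> 0 \<le> f x" "\<And>x. a \<le> x \<Longrightarrow> f x \<le> g x"
    and "(G \<longlongrightarrow> T) at_top"
  shows "set_integrable lborel {a..} f"
proof -
  have fb: "f \<in> borel_measurable borel" and gb: "g \<in> borel_measurable borel"
    using assms(1,2) by (auto intro: borel_measurable_continuous_onI)
  have "(\<integral>\<^sup>+x. ennreal (g x) * indicator {a ..} x \<partial>lborel) = T - G a"
    using assms by (intro nn_integral_FTC_atLeast gb) (auto intro: order_trans)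
  moreover have "(\<integral>\<^sup>+x. ennreal (f x) * indicator {a ..} x \<partial>lborel)
      \<le> (\<integral>\<^sup>+x. ennreal (g x) * indicator {a ..} x \<partial>lborel)"
    using assms by (intro nn_integral_mono) (auto simp: indicator_def ennreal_leI)
  ultimately have fin: "(\<integral>\<^sup>+x. ennreal (f x) * indicator {a ..} x \<partial>lborel) < \<infinity>"
    by (metis ennreal_less_top infinity_ennreal_def order_le_less_trans)
  show ?thesis
    unfolding set_integrable_def
  proof (rule integrableI_bounded)
    show "(\<lambda>x. indicator {a..} x *\<^sub>R f x) \<in> borel_measurable lborel" using fb by measurable
    have "(\<integral>\<^sup>+ x. ennreal (norm (indicator {a..} x *\<^sub>R f x)) \<partial>lborel)
        = (\<integral>\<^sup>+x. ennreal (f x) * indicator {a ..} x \<partial>lborel)"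
      using assms(4) by (intro nn_integral_cong) (auto simp: indicator_def)
    then show "(\<integral>\<^sup>+ x. ennreal (norm (indicator {a..} x *\<^sub>R f x)) \<partial>lborel) < \<infinity>" using fin by simp
  qed
qed

text \<open>The left end is given in reflected form, so that one estimate near plus infinity can be
  applied at both ends. The compact middle piece is handled by continuity; overlaps do no
  harm.\<close>

lemma integrable_of_halflines:
  fixes f :: "real \<Rightarrow> real"
  assumes c: "continuous_on UNIV f" and a: "set_integrable lborel {a..} f"
    and b: "set_integrable lborel {b..} (\<lambda>z. f (- z))"
  shows "integrable lborel f"
proof -
  have "(\<lambda>x. indicator {b..} (- x) *\<^sub>R f (- (- x))) = (\<lambda>x. indicator {..-b} x *\<^sub>R f x)"
    by (auto simp: indicator_def)
  then have b': "set_integrable lborel {..-b} f"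
    using lborel_integrable_real_affine[OF b[unfolded set_integrable_def], of "-1" 0]
    by (simp add: set_integrable_def)
  have m: "set_integrable lborel {-b..a} f"
    using c by (intro borel_integrable_atLeastAtMost') (auto intro: continuous_on_subset)
  have "set_integrable lborel ({..-b} \<union> {-b..a} \<union> {a..}) f"
    by (intro set_integrable_Un a b' m) auto
  moreover have "{..-b} \<union> {-b..a} \<union> {a..} = (UNIV :: real set)" by auto
  ultimately show ?thesis by (simp add: set_integrable_def)
qed

text \<open>The integrand is a scalar function times a fixed vector: the vector-valued momentum
  balance and the scalar energy balance both have this form.\<close>

lemma LINT_derivative:
  fixes F :: "real \<Rightarrow> 'a::euclidean_space"
  assumes "\<And>x. (F has_vector_derivative f x *\<^sub>R c) (at x)" "continuous_on UNIV f" "integrable lborel f"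
    and "(F \<longlongrightarrow> A) at_bot" "(F \<longlongrightarrow> B) at_top"
  shows "B - A = (LINT x|lborel. f x) *\<^sub>R c"
proof -
  have "(LBINT x=-\<infinity>..\<infinity>. f x *\<^sub>R c) = B - A"
  proof (rule interval_integral_FTC_integrable)
    show "isCont (\<lambda>x. f x *\<^sub>R c) x" for x
      using assms(2) by (intro continuous_intros) (simp add: continuous_on_eq_continuous_at)
    show "set_integrable lborel (einterval (-\<infinity>) \<infinity>) (\<lambda>x. f x *\<^sub>R c)"
      using assms(3) by (simp add: set_integrable_def)
    show "((F \<circ> real_of_ereal) \<longlongrightarrow> A) (at_right (-\<infinity>))" "((F \<circ> real_of_ereal) \<longlongrightarrow> B) (at_left \<infinity>)"
      using assms(4,5) by (simp_all add: ereal_tendsto_simps)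
  qed (use assms(1) in auto)
  then show ?thesis
    using assms(3) by (simp add: interval_lebesgue_integral_def set_lebesgue_integral_def)
qed

section \<open>The double well and square integrability of the phase profile\<close>

lemma has_real_derivative_dwell:
  "(dwell has_real_derivative 4 * x * (x\<^sup>2 - 1)) (at x)"
proof -
  have "((\<lambda>x. (x - 1)\<^sup>2 * (x + 1)\<^sup>2) has_real_derivative 4 * x * (x\<^sup>2 - 1)) (at x)"
    by (rule derivative_eq_intros refl)+ (simp add: algebra_simps power2_eq_square)
  then show ?thesis by (simp add: dwell_def[abs_def])
qed

lemma deriv_dwell: "deriv dwell = (\<lambda>x. 4 * x * (x\<^sup>2 - 1))"
  using has_real_derivative_dwell by (auto intro: DERIV_imp_deriv)

lemma has_real_derivative_deriv_dwell:
  "(deriv dwell has_real_derivative 12 * x\<^sup>2 - 4) (at x)"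
  unfolding deriv_dwell by (rule derivative_eq_intros refl)+ (simp add: algebra_simps power2_eq_square)

lemma deriv_deriv_dwell: "deriv (deriv dwell) = (\<lambda>x. 12 * x\<^sup>2 - 4)"
  using has_real_derivative_deriv_dwell by (auto intro: DERIV_imp_deriv)

lemma twice_differentiable_deriv_dwell: "twice_differentiable (deriv dwell)"
proof (rule twice_differentiableI[OF has_real_derivative_deriv_dwell])
  show "((\<lambda>x. 12 * x\<^sup>2 - 4) has_real_derivative 24 * x) (at x)" for x :: real
    by (rule derivative_eq_intros refl)+ simp
qed

text \<open>The limits carry no rate of decay. Testing the profile equation with
  \<open>X - 1\<close> produces \<open>X'\<close> squared plus a term of favourable sign, and the
  total is the derivative of a convergent function.\<close>

lemma profile_halfline_integrable:
  assumes X: "twice_differentiable X" and g: "0 < \<gamma>"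
    and ode: "\<And>z. \<gamma> * deriv (deriv X) z = deriv dwell (X z)"
    and lim: "(X \<longlongrightarrow> 1) at_top" "(deriv X \<longlongrightarrow> 0) at_top"
  shows "\<exists>a. set_integrable lborel {a..} (\<lambda>z. (deriv X z)\<^sup>2)"
proof -
  have "eventually (\<lambda>z. 0 < X z) at_top" using order_tendstoD(1)[OF lim(1), of 0] by simp
  then obtain a where a: "\<And>z. a \<le> z \<Longrightarrow> 0 < X z" by (auto simp: eventually_at_top_linorder)
  note c = twice_differentiable_continuous[OF X]
  have ode': "deriv (deriv X) z = 4 * X z * ((X z)\<^sup>2 - 1) / \<gamma>" for z
    using ode[of z] g by (simp add: deriv_dwell field_simps)
  \<comment> \<open>\<open>(X - 1) X'\<close> has the derivative \<open>X'\<^sup>2 + (X - 1) W'(X) / \<gamma>\<close>, and \<open>(X - 1) W'(X) \<ge> 0\<close> where \<open>X > 0\<close>.\<close>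
  let ?g = "\<lambda>z. (deriv X z)\<^sup>2 + 4 * X z * (X z + 1) * (X z - 1)\<^sup>2 / \<gamma>"
  have "set_integrable lborel {a..} (\<lambda>z. (deriv X z)\<^sup>2)"
  \<comment> \<open>\<open>T\<close> is the limit of \<open>(X - 1) X'\<close>, left unevaluated in
    the shape that the limit rules produce.\<close>
  proof (rule integrable_halfline_bound[where G = "\<lambda>z. (X z - 1) * deriv X z" and g = ?g and T = "(1 - 1) * 0"])
    show "continuous_on UNIV (\<lambda>z. (deriv X z)\<^sup>2)" by (intro continuous_intros c)
    show "continuous_on UNIV ?g" using g by (intro continuous_intros c) auto
    show "((\<lambda>z. (X z - 1) * deriv X z) \<longlongrightarrow> (1 - 1) * 0) at_top" by (intro tendsto_intros lim)
    show "((\<lambda>z. (X z - 1) * deriv X z) has_real_derivative ?g z) (at z)" for z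
      by (rule derivative_eq_intros twice_differentiable_deriv[OF X] refl)+
         (use g in \<open>simp add: ode' field_simps power2_eq_square\<close>)
    show "(deriv X z)\<^sup>2 \<le> ?g z" if "a \<le> z" for z using a[OF that] g by simp
  qed simp
  then show ?thesis by blast
qed

text \<open>\<open>W'\<close> is odd, so \<open>- X (- z)\<close> solves the same equation; the
  reflection exchanges the two ends and reduces the vapor side to the half line already
  treated.\<close>

lemma profile_integrable:
  assumes X: "twice_differentiable X" and g: "0 < \<gamma>"
    and ode: "\<And>z. \<gamma> * deriv (deriv X) z = deriv dwell (X z)"
    and top: "(X \<longlongrightarrow> 1) at_top" "(deriv X \<longlongrightarrow> 0) at_top"
    and bot: "(X \<longlongrightarrow> -1) at_bot" "(deriv X \<longlongrightarrow> 0) at_bot"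
  shows "integrable lborel (\<lambda>z. (deriv X z)\<^sup>2)"
proof -
  let ?Y = "\<lambda>z. - X (- z)"
  have D: "(?Y has_real_derivative deriv X (- z)) (at z)" for z
    by (rule derivative_eq_intros DERIV_chain2[OF twice_differentiable_deriv(1)[OF X]] refl)+ simp
  have D2: "((\<lambda>z. deriv X (- z)) has_real_derivative - deriv (deriv X) (- z)) (at z)" for z
    using DERIV_chain2[OF twice_differentiable_deriv(2)[OF X] DERIV_minus[OF DERIV_ident]] by simp
  have Y: "twice_differentiable ?Y" by (rule twice_differentiableI[OF D D2])
  have dY: "deriv ?Y = (\<lambda>z. deriv X (- z))" using D by (auto intro: DERIV_imp_deriv)
  have ddY: "deriv (deriv ?Y) = (\<lambda>z. - deriv (deriv X) (- z))"
    unfolding dY using D2 by (auto intro: DERIV_imp_deriv)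
  have "\<exists>b. set_integrable lborel {b..} (\<lambda>z. (deriv ?Y z)\<^sup>2)"
  proof (rule profile_halfline_integrable[OF Y g])
    show "\<gamma> * deriv (deriv ?Y) z = deriv dwell (?Y z)" for z
      using ode[of "- z"] by (simp add: ddY deriv_dwell)
    show "(?Y \<longlongrightarrow> 1) at_top"
      using tendsto_minus[OF filterlim_compose[OF bot(1) filterlim_uminus_at_bot_at_top]] by simp
    show "(deriv ?Y \<longlongrightarrow> 0) at_top"
      unfolding dY by (rule filterlim_compose[OF bot(2) filterlim_uminus_at_bot_at_top])
  qed
  then obtain b where b: "set_integrable lborel {b..} (\<lambda>z. (deriv X (- z))\<^sup>2)" by (auto simp: dY)
  obtain a where "set_integrable lborel {a..} (\<lambda>z. (deriv X z)\<^sup>2)"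
    using profile_halfline_integrable[OF X g ode top] by blast
  with b show ?thesis
    by (intro integrable_of_halflines[where a = a and b = b] continuous_intros
        twice_differentiable_continuous[OF X]) auto
qed

section \<open>Constitutive relations: chemical potentials and pressure\<close>

lemma fluidD:
  assumes "fluid P"
  shows "2 \<le> nc P" "\<And>\<alpha>. \<alpha> \<in> {1..nc P} \<Longrightarrow> 0 < mass P \<alpha>"
    "0 < cap P" "0 < relax P" "0 < eps0 P" "smooth_on UNIV (hint P)"
    "\<And>z. 0 \<le> hint P z" "\<And>z. hint P z \<le> 1" "hint P 1 = 1" "hint P (-1) = 0"
    "deriv (hint P) 1 = 0" "deriv (hint P) (-1) = 0"
    "0 \<le> susL P" "0 \<le> susV P" "0 < nref P"
  using assms unfolding fluid_def by simp_all

text \<open>Pairing \<open>M \<xi> = 0\<close> with \<open>\<xi>\<close> gives a vanishing quadratic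
  form, which definiteness forbids for nonzero \<open>\<xi>\<close>.\<close>

lemma diff_mob_injective:
  assumes "fluid P"
    and "\<And>\<alpha>. \<alpha> \<in> {1..nc P - 1} \<Longrightarrow> (\<Sum>\<beta>=1..nc P - 1. diff_mob P \<alpha> \<beta> * \<xi> \<beta>) = 0"
    and "\<alpha> \<in> {1..nc P - 1}"
  shows "\<xi> \<alpha> = 0"
proof (rule ccontr)
  assume "\<xi> \<alpha> \<noteq> 0"
  then have "0 < (\<Sum>\<alpha>=1..nc P - 1. \<Sum>\<beta>=1..nc P - 1. diff_mob P \<alpha> \<beta> * \<xi> \<alpha> * \<xi> \<beta>)"
    using assms(3) assms(1)[unfolded fluid_def, THEN conjunct2, THEN conjunct2, THEN conjunct2, THEN conjunct2,
        THEN conjunct2, THEN conjunct2, THEN conjunct1] by blast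
  also have "\<dots> = (\<Sum>\<alpha>=1..nc P - 1. \<xi> \<alpha> * (\<Sum>\<beta>=1..nc P - 1. diff_mob P \<alpha> \<beta> * \<xi> \<beta>))"
    by (simp add: sum_distrib_left mult_ac)
  also have "\<dots> = 0" by (intro sum.neutral) (use assms(2) in simp)
  finally show False by simp
qed

text \<open>The free energy is affine in the bulk modulus, so the mixture of the two phases is the free energy of
  a single phase with the interpolated modulus.\<close>

definition bulk_mod :: "fluid_data \<Rightarrow> real \<Rightarrow> real" where
  "bulk_mod P chi = hint P chi * bulkL P + (1 - hint P chi) * bulkV P"

text \<open>The partial derivative of \<open>rhopsi P K\<close> in the density of constituent
  \<open>\<alpha>\<close>, in closed form: a reference part, a compression part with logarithm of
  the total number density, and the ideal mixing part. It agrees with the derivative where all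
  densities are positive.\<close>

definition chem_pot :: "fluid_data \<Rightarrow> real \<Rightarrow> nat \<Rightarrow> (nat \<Rightarrow> real) \<Rightarrow> real" where
  "chem_pot P K \<alpha> \<rho> = psiref P \<alpha> + pref P / (mass P \<alpha> * nref P)
     + K / (mass P \<alpha> * nref P) * ln (ndens P \<rho> / nref P)
     + boltz P * temp P / mass P \<alpha> * ln (\<rho> \<alpha> / mass P \<alpha> / ndens P \<rho>)"

lemma convex_combination_affine:
  "h * (a + K * b) + (1 - h) * (a + L * b) = a + (h * K + (1 - h) * L) * (b::real)"
  by (simp add: algebra_simps)

lemma rhof_eq: "rhof P \<rho> chi = rhopsi P (bulk_mod P chi) \<rho>"
proof -
  have "rhopsi P K \<rho> = rhopsi P 0 \<rho> + K * (1 - ndens P \<rho> / nref P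
      + ndens P \<rho> / nref P * ln (ndens P \<rho> / nref P))" for K
    unfolding rhopsi_def by (simp only: left_diff_distrib) (simp add: ring_distribs mult.assoc)
  then show ?thesis
    unfolding rhof_def bulk_mod_def by (metis (no_types, lifting) convex_combination_affine)
qed

lemma ndens_pos:
  assumes "fluid P" "\<And>\<alpha>. \<alpha> \<in> {1..nc P} \<Longrightarrow> 0 < \<rho> \<alpha>"
  shows "0 < ndens P \<rho>"
  unfolding ndens_def using assms fluidD[OF assms(1)] by (intro sum_pos) auto

lemma ndens_has_derivative:
  assumes "\<And>\<beta>. \<beta> \<in> {1..nc P} \<Longrightarrow> (\<rho> \<beta> has_derivative \<rho>' \<beta>) F"
  shows "((\<lambda>y. ndens P (\<lambda>\<beta>. \<rho> \<beta> y)) has_derivative (\<lambda>h. ndens P (\<lambda>\<beta>. \<rho>' \<beta> h))) F"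
  unfolding ndens_def divide_inverse
  by (intro has_derivative_sum has_derivative_mult_left assms)

lemma ndens_linear:
  "ndens P (\<lambda>\<beta>. c * \<rho> \<beta>) = c * ndens P \<rho>"
  by (simp add: ndens_def sum_distrib_left)

text \<open>Stated for densities on an arbitrary normed space and a varying modulus, because it is
  applied in three settings: one density varied alone, all fields along the stretched normal, and
  the densities in a bulk region with the modulus frozen.\<close>

lemma chem_pot_has_derivative:
  fixes \<rho> :: "nat \<Rightarrow> 'a::real_normed_vector \<Rightarrow> real"
  assumes P: "fluid P" and pos: "\<And>\<beta>. \<beta> \<in> {1..nc P} \<Longrightarrow> 0 < \<rho> \<beta> y" and \<alpha>: "\<alpha> \<in> {1..nc P}"
    and \<rho>: "\<And>\<beta>. \<beta> \<in> {1..nc P} \<Longrightarrow> (\<rho> \<beta> has_derivative \<rho>' \<beta>) (at y)"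
    and K: "(K has_derivative K') (at y)"
  shows "((\<lambda>y. chem_pot P (K y) \<alpha> (\<lambda>\<beta>. \<rho> \<beta> y)) has_derivative
     (\<lambda>h. (K' h * ln (ndens P (\<lambda>\<beta>. \<rho> \<beta> y) / nref P)
             + K y * (ndens P (\<lambda>\<beta>. \<rho>' \<beta> h) / ndens P (\<lambda>\<beta>. \<rho> \<beta> y))) / (mass P \<alpha> * nref P)
         + boltz P * temp P / mass P \<alpha> * (\<rho>' \<alpha> h / \<rho> \<alpha> y - ndens P (\<lambda>\<beta>. \<rho>' \<beta> h) / ndens P (\<lambda>\<beta>. \<rho> \<beta> y)))) (at y)"
proof -
  note n = ndens_has_derivative[of P \<rho> \<rho>', OF \<rho>]
  have npos: "0 < ndens P (\<lambda>\<beta>. \<rho> \<beta> y)" using ndens_pos[OF P] pos .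
  have m: "0 < mass P \<alpha>" and r: "0 < nref P" using fluidD[OF P] \<alpha> by auto
  let ?n = "\<lambda>y. ndens P (\<lambda>\<beta>. \<rho> \<beta> y)" and ?n' = "\<lambda>h. ndens P (\<lambda>\<beta>. \<rho>' \<beta> h)"
  have ln1: "((\<lambda>y. ln (?n y / nref P)) has_derivative (\<lambda>h. ?n' h / ?n y)) (at y)"
  proof -
    have "((\<lambda>y. ?n y / nref P) has_derivative (\<lambda>h. ?n' h / nref P)) (at y)"
      unfolding divide_inverse by (intro has_derivative_mult_left n)
    from has_derivative_ln[OF _ this] show ?thesis
      using npos r by (auto simp: field_simps elim!: has_derivative_eq_rhs)
  qed
  have ln2: "((\<lambda>y. ln (\<rho> \<alpha> y / mass P \<alpha> / ?n y)) has_derivative (\<lambda>h. \<rho>' \<alpha> h / \<rho> \<alpha> y - ?n' h / ?n y)) (at y)"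
  proof -
    have "((\<lambda>y. \<rho> \<alpha> y / mass P \<alpha>) has_derivative (\<lambda>h. \<rho>' \<alpha> h / mass P \<alpha>)) (at y)"
      unfolding divide_inverse by (intro has_derivative_mult_left \<rho> \<alpha>)
    from has_derivative_divide[OF this n] npos
    have "((\<lambda>y. \<rho> \<alpha> y / mass P \<alpha> / ?n y) has_derivative
       (\<lambda>h. (\<rho>' \<alpha> h / \<rho> \<alpha> y - ?n' h / ?n y) * (\<rho> \<alpha> y / mass P \<alpha> / ?n y))) (at y)"
      using pos[OF \<alpha>] m by (auto simp: field_simps power2_eq_square elim!: has_derivative_eq_rhs)
    from has_derivative_ln[OF _ this] show ?thesis
      using npos m pos[OF \<alpha>] by (auto simp: elim!: has_derivative_eq_rhs)
  qed
  have Kc: "((\<lambda>y. K y / (mass P \<alpha> * nref P)) has_derivative (\<lambda>h. K' h / (mass P \<alpha> * nref P))) (at y)"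
    unfolding divide_inverse by (rule has_derivative_mult_left[OF K])
  show ?thesis
    unfolding chem_pot_def
    by (rule has_derivative_eq_rhs[OF has_derivative_add[OF has_derivative_add[OF has_derivative_const
          has_derivative_mult[OF Kc ln1]] has_derivative_mult_right[OF ln2]]])
       (simp add: fun_eq_iff divide_inverse algebra_simps)
qed

text \<open>The chain rule along a curve of densities, at a fixed modulus. That the coefficients are
  exactly \<open>chem_pot\<close> rests on two cancellations, one in the mixing entropy and one in
  the compression energy.\<close>

lemma rhopsi_has_derivative:
  fixes \<rho> :: "nat \<Rightarrow> real \<Rightarrow> real"
  assumes P: "fluid P" and pos: "\<And>\<beta>. \<beta> \<in> {1..nc P} \<Longrightarrow> 0 < \<rho> \<beta> y"
    and \<rho>: "\<And>\<beta>. \<beta> \<in> {1..nc P} \<Longrightarrow> (\<rho> \<beta> has_real_derivative \<rho>' \<beta>) (at y)"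
  shows "((\<lambda>y. rhopsi P K (\<lambda>\<beta>. \<rho> \<beta> y)) has_real_derivative
     (\<Sum>\<alpha>=1..nc P. chem_pot P K \<alpha> (\<lambda>\<beta>. \<rho> \<beta> y) * \<rho>' \<alpha>)) (at y)"
proof -
  have npos: "0 < ndens P (\<lambda>\<beta>. \<rho> \<beta> y)" using ndens_pos[OF P] pos .
  have m: "\<And>\<beta>. \<beta> \<in> {1..nc P} \<Longrightarrow> 0 < mass P \<beta>" and r: "0 < nref P" using fluidD[OF P] by auto
  let ?n = "\<lambda>y. ndens P (\<lambda>\<beta>. \<rho> \<beta> y)" and ?n' = "ndens P \<rho>'"
  have n: "(?n has_real_derivative ?n') (at y)"
    unfolding ndens_def divide_inverse by (intro DERIV_sum DERIV_cmult_right \<rho>)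
  have ent: "((\<lambda>y. \<rho> \<beta> y / mass P \<beta> * ln (\<rho> \<beta> y / mass P \<beta> / ?n y)) has_real_derivative
      \<rho>' \<beta> / mass P \<beta> * ln (\<rho> \<beta> y / mass P \<beta> / ?n y) + (\<rho>' \<beta> / mass P \<beta> - \<rho> \<beta> y / mass P \<beta> * ?n' / ?n y)) (at y)"
    if "\<beta> \<in> {1..nc P}" for \<beta>
  proof -
    have a: "0 < \<rho> \<beta> y / mass P \<beta>" using m[OF that] pos[OF that] by simp
    have q: "((\<lambda>y. \<rho> \<beta> y / mass P \<beta>) has_real_derivative \<rho>' \<beta> / mass P \<beta>) (at y)"
      by (intro DERIV_cdivide \<rho> that)
    have alg: "b * ln (a / k) + 1 / (a / k) * ((b * k - a * k') / (k * k)) * a = b * ln (a / k) + (b - a * k' / k)"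
      if "0 < a" "0 < k" for a b k k' :: real
      using that by (simp add: field_simps)
    show ?thesis
      by (rule DERIV_cong[OF DERIV_mult[OF q DERIV_chain2[OF DERIV_ln_divide DERIV_divide[OF q n]]] alg[OF a npos]])
         (rule divide_pos_pos[OF a npos], use npos in simp)
  qed
  \<comment> \<open>Differentiating the logarithms of the mole fractions contributes nothing: the
    sum of \<open>\<rho>' / mass\<close> is \<open>?n'\<close>, and the sum of
    \<open>\<rho> / mass\<close> times \<open>?n' / ?n\<close> is \<open>?n'\<close> again.\<close>
  have sum_ent: "(\<Sum>\<beta>=1..nc P. \<rho>' \<beta> / mass P \<beta> * ln (\<rho> \<beta> y / mass P \<beta> / ?n y) + (\<rho>' \<beta> / mass P \<beta> - \<rho> \<beta> y / mass P \<beta> * ?n' / ?n y))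
    = (\<Sum>\<beta>=1..nc P. \<rho>' \<beta> / mass P \<beta> * ln (\<rho> \<beta> y / mass P \<beta> / ?n y))"
  proof -
    have "(\<Sum>\<beta>=1..nc P. \<rho> \<beta> y / mass P \<beta> * ?n' / ?n y) = ?n y * (?n' / ?n y)"
      unfolding ndens_def[of P "\<lambda>\<beta>. \<rho> \<beta> y"] sum_distrib_right by (simp add: mult.assoc)
    then have "(\<Sum>\<beta>=1..nc P. \<rho> \<beta> y / mass P \<beta> * ?n' / ?n y) = ?n'" using npos by simp
    then show ?thesis by (simp add: sum.distrib sum_subtractf ndens_def)
  qed
  have "((\<lambda>y. rhopsi P K (\<lambda>\<beta>. \<rho> \<beta> y)) has_real_derivative
     (\<Sum>\<alpha>=1..nc P. \<rho>' \<alpha> * psiref P \<alpha>) + (pref P / nref P * ?n' + K / nref P * ?n' * ln (?n y / nref P))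
      + boltz P * temp P * (\<Sum>\<beta>=1..nc P. \<rho>' \<beta> / mass P \<beta> * ln (\<rho> \<beta> y / mass P \<beta> / ?n y))) (at y)"
  proof -
    have 1: "((\<lambda>y. (K - pref P) * (1 - ?n y / nref P) + K * (?n y / nref P) * ln (?n y / nref P)) has_real_derivative
      pref P / nref P * ?n' + K / nref P * ?n' * ln (?n y / nref P)) (at y)"
    proof -
      have q: "((\<lambda>y. ?n y / nref P) has_real_derivative ?n' / nref P) (at y)" by (rule DERIV_cdivide[OF n])
      have a: "0 < ?n y / nref P" using npos r by simp
      \<comment> \<open>Here \<open>x\<close> is the number density relative to
        \<open>nref P\<close>. The terms \<open>K x'\<close> coming from the linear and from the
        logarithmic part cancel, so that \<open>pref P\<close> alone remains without a
        logarithm.\<close>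
      have alg: "(K - pref P) * (0 - x') + (K * x' * ln x + 1 / x * x' * (K * x)) = pref P * x' + K * x' * ln x"
        if "0 < x" for x x' :: real using that by (simp add: algebra_simps)
      have "((\<lambda>y. (K - pref P) * (1 - ?n y / nref P) + K * (?n y / nref P) * ln (?n y / nref P)) has_real_derivative
          pref P * (?n' / nref P) + K * (?n' / nref P) * ln (?n y / nref P)) (at y)"
        by (rule DERIV_cong[OF DERIV_add[OF DERIV_cmult[OF DERIV_diff[OF DERIV_const q]]
              DERIV_mult[OF DERIV_cmult[OF q] DERIV_chain2[OF DERIV_ln_divide[OF a] q]]] alg[OF a]])
      then show ?thesis by simp
    qed
    have 2: "((\<lambda>y. \<Sum>\<alpha>=1..nc P. \<rho> \<alpha> y * psiref P \<alpha>) has_real_derivative (\<Sum>\<alpha>=1..nc P. \<rho>' \<alpha> * psiref P \<alpha>)) (at y)"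
      by (intro DERIV_sum DERIV_cmult_right \<rho>)
    have 3: "((\<lambda>y. boltz P * temp P * (\<Sum>\<beta>=1..nc P. \<rho> \<beta> y / mass P \<beta> * ln (\<rho> \<beta> y / mass P \<beta> / ?n y))) has_real_derivative
       boltz P * temp P * (\<Sum>\<beta>=1..nc P. \<rho>' \<beta> / mass P \<beta> * ln (\<rho> \<beta> y / mass P \<beta> / ?n y))) (at y)"
      unfolding sum_ent[symmetric] by (intro DERIV_cmult DERIV_sum ent)
    from DERIV_add[OF DERIV_add[OF 2 1] 3] show ?thesis by (simp add: rhopsi_def add_ac)
  qed
  also have "(\<Sum>\<alpha>=1..nc P. \<rho>' \<alpha> * psiref P \<alpha>) + (pref P / nref P * ?n' + K / nref P * ?n' * ln (?n y / nref P))
      + boltz P * temp P * (\<Sum>\<beta>=1..nc P. \<rho>' \<beta> / mass P \<beta> * ln (\<rho> \<beta> y / mass P \<beta> / ?n y))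
      = (\<Sum>\<alpha>=1..nc P. chem_pot P K \<alpha> (\<lambda>\<beta>. \<rho> \<beta> y) * \<rho>' \<alpha>)"
    unfolding chem_pot_def distrib_right sum.distrib
    by (simp add: ndens_def[of P \<rho>'] sum_distrib_left mult_ac)
  finally show ?thesis .
qed

text \<open>The chain rule along the coordinate line of one density: the velocities are a Kronecker
  delta and a single term of the sum survives.\<close>

lemma mu_eq:
  assumes P: "fluid P" and pos: "\<And>\<beta>. \<beta> \<in> {1..nc P} \<Longrightarrow> 0 < \<rho> \<beta>" and \<alpha>: "\<alpha> \<in> {1..nc P}"
  shows "mu P \<alpha> \<rho> chi = chem_pot P (bulk_mod P chi) \<alpha> \<rho>"
proof -
  have "((\<lambda>r. rhopsi P (bulk_mod P chi) (\<lambda>\<beta>. (\<rho>(\<alpha> := r)) \<beta>)) has_real_derivative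
     (\<Sum>\<beta>=1..nc P. chem_pot P (bulk_mod P chi) \<beta> (\<lambda>\<beta>. (\<rho>(\<alpha> := \<rho> \<alpha>)) \<beta>) * (if \<beta> = \<alpha> then 1 else 0))) (at (\<rho> \<alpha>))"
    by (rule rhopsi_has_derivative[OF P]) (use pos in \<open>auto simp: fun_upd_def\<close>)
  also have "(\<Sum>\<beta>=1..nc P. chem_pot P (bulk_mod P chi) \<beta> (\<lambda>\<beta>. (\<rho>(\<alpha> := \<rho> \<alpha>)) \<beta>) * (if \<beta> = \<alpha> then 1 else 0))
      = chem_pot P (bulk_mod P chi) \<alpha> \<rho>"
    using \<alpha> by (simp add: if_distrib cong: if_cong)
  finally have "((\<lambda>r. rhof P (\<rho>(\<alpha> := r)) chi) has_real_derivative chem_pot P (bulk_mod P chi) \<alpha> \<rho>) (at (\<rho> \<alpha>))"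
    by (simp only: rhof_eq)
  then show ?thesis by (simp add: mu_def DERIV_imp_deriv)
qed

text \<open>Euler's relation: the reference, logarithmic and mixing terms in the sum of
  \<open>\<rho> \<mu>\<close> cancel against those of the free energy. What remains is an equation
  of state that is affine in the number density and free of logarithms, hence easy to differentiate
  and to pass to the limit in.\<close>

lemma pressure_eq:
  assumes P: "fluid P" and pos: "\<And>\<beta>. \<beta> \<in> {1..nc P} \<Longrightarrow> 0 < \<rho> \<beta>"
  shows "(\<Sum>\<alpha>=1..nc P. \<rho> \<alpha> * mu P \<alpha> \<rho> chi) - rhof P \<rho> chi
     = pref P + bulk_mod P chi * (ndens P \<rho> / nref P - 1)"
proof -
  have "(\<Sum>\<alpha>=1..nc P. \<rho> \<alpha> * mu P \<alpha> \<rho> chi) = (\<Sum>\<alpha>=1..nc P. \<rho> \<alpha> * chem_pot P (bulk_mod P chi) \<alpha> \<rho>)"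
    by (intro sum.cong refl) (simp only: mu_eq[of P, OF P pos])
  also have "\<dots> = (\<Sum>\<alpha>=1..nc P. \<rho> \<alpha> * psiref P \<alpha>) + (pref P / nref P * ndens P \<rho>
      + bulk_mod P chi / nref P * ndens P \<rho> * ln (ndens P \<rho> / nref P))
      + boltz P * temp P * (\<Sum>\<beta>=1..nc P. \<rho> \<beta> / mass P \<beta> * ln (\<rho> \<beta> / mass P \<beta> / ndens P \<rho>))"
  proof -
    have "(\<Sum>\<alpha>=1..nc P. \<rho> \<alpha> * (pref P / (mass P \<alpha> * nref P))) = pref P / nref P * ndens P \<rho>"
      by (simp add: ndens_def sum_distrib_left mult_ac)
    moreover have "(\<Sum>\<alpha>=1..nc P. \<rho> \<alpha> * (bulk_mod P chi / (mass P \<alpha> * nref P) * ln (ndens P \<rho> / nref P)))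
        = bulk_mod P chi / nref P * (\<Sum>\<alpha>=1..nc P. \<rho> \<alpha> / mass P \<alpha>) * ln (ndens P \<rho> / nref P)"
      unfolding sum_distrib_left sum_distrib_right by (simp add: mult_ac)
    ultimately show ?thesis
      unfolding chem_pot_def distrib_left sum.distrib ndens_def[symmetric]
      by (simp add: sum_distrib_left mult_ac)
  qed
  finally show ?thesis by (simp add: rhof_eq rhopsi_def algebra_simps diff_divide_distrib)
qed

lemma hint_twice_differentiable:
  assumes "fluid P"
  shows "twice_differentiable (hint P)" "twice_differentiable (deriv (hint P))"
  using smooth_on_twice_differentiable[OF fluidD(6)[OF assms]] by auto

lemma bulk_mod_twice_differentiable: "fluid P \<Longrightarrow> twice_differentiable (bulk_mod P)"
  unfolding bulk_mod_def[abs_def]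
  by (intro twice_differentiable_add twice_differentiable_mult twice_differentiable_diff
      twice_differentiable_const hint_twice_differentiable)

lemma sus_twice_differentiable: "fluid P \<Longrightarrow> twice_differentiable (sus P)"
  unfolding sus_def[abs_def]
  by (intro twice_differentiable_add twice_differentiable_mult twice_differentiable_diff
      twice_differentiable_const hint_twice_differentiable)

lemma deriv_bulk_mod:
  assumes "fluid P"
  shows "deriv (bulk_mod P) chi = deriv (hint P) chi * (bulkL P - bulkV P)"
proof -
  have "(bulk_mod P has_real_derivative deriv (hint P) chi * (bulkL P - bulkV P)) (at chi)"
    unfolding bulk_mod_def[abs_def]
    by (rule derivative_eq_intros twice_differentiable_deriv(1)[OF hint_twice_differentiable(1)[OF assms]] refl)+
       (simp add: algebra_simps)
  then show ?thesis by (rule DERIV_imp_deriv)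
qed

lemma deriv_sus:
  assumes "fluid P"
  shows "deriv (sus P) chi = deriv (hint P) chi * (susL P - susV P)"
proof -
  have "(sus P has_real_derivative deriv (hint P) chi * (susL P - susV P)) (at chi)"
    unfolding sus_def[abs_def]
    by (rule derivative_eq_intros twice_differentiable_deriv(1)[OF hint_twice_differentiable(1)[OF assms]] refl)+
       (simp add: algebra_simps)
  then show ?thesis by (rule DERIV_imp_deriv)
qed

lemma sus_nonneg: "fluid P \<Longrightarrow> 0 \<le> sus P chi"
  using fluidD[of P] by (simp add: sus_def)

lemma drhof_dchi_eq:
  assumes "fluid P"
  shows "drhof_dchi P \<rho> chi = deriv (bulk_mod P) chi *
     (1 - ndens P \<rho> / nref P + ndens P \<rho> / nref P * ln (ndens P \<rho> / nref P))"
proof -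
  have "((\<lambda>chi. rhopsi P (bulk_mod P chi) \<rho>) has_real_derivative deriv (bulk_mod P) chi *
     (1 - ndens P \<rho> / nref P + ndens P \<rho> / nref P * ln (ndens P \<rho> / nref P))) (at chi)"
    unfolding rhopsi_def
    by (rule derivative_eq_intros twice_differentiable_deriv(1)[OF bulk_mod_twice_differentiable[OF assms]] refl)+
       (simp add: algebra_simps)
  then show ?thesis unfolding drhof_dchi_def rhof_eq by (rule DERIV_imp_deriv)
qed

lemma drhof_dchi_pure:
  assumes "fluid P" "\<bar>chi\<bar> = 1"
  shows "drhof_dchi P \<rho> chi = 0" "deriv (sus P) chi = 0"
proof -
  have "deriv (hint P) chi = 0" using fluidD[OF assms(1)] assms(2) by (cases "chi = 1") (auto simp: abs_if split: if_splits)
  then show "drhof_dchi P \<rho> chi = 0" "deriv (sus P) chi = 0"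
    by (simp_all add: drhof_dchi_eq deriv_bulk_mod deriv_sus assms(1))
qed

text \<open>The right-hand side is written with \<open>inverse\<close> so that, along the profile,
  the closure rules for \<open>twice_differentiable\<close> apply to it directly.\<close>

lemma dmu_drho_eq:
  assumes P: "fluid P" and pos: "\<And>\<beta>. \<beta> \<in> {1..nc P} \<Longrightarrow> 0 < \<rho> \<beta>"
    and \<alpha>: "\<alpha> \<in> {1..nc P}" and \<beta>: "\<beta> \<in> {1..nc P}"
  shows "dmu_drho P \<beta> \<alpha> \<rho> chi = bulk_mod P chi / (mass P \<beta> * nref P) * (1 / mass P \<alpha> * inverse (ndens P \<rho>))
     + boltz P * temp P / mass P \<beta> * ((if \<alpha> = \<beta> then 1 else 0) * inverse (\<rho> \<beta>) - 1 / mass P \<alpha> * inverse (ndens P \<rho>))"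
proof -
  let ?d = "\<lambda>\<gamma>. \<lambda>h::real. if \<gamma> = \<alpha> then h else 0"
  have nd: "ndens P (\<lambda>\<gamma>. ?d \<gamma> h) = h / mass P \<alpha>" for h
  proof -
    have "ndens P (\<lambda>\<gamma>. ?d \<gamma> h) = (\<Sum>\<gamma>=1..nc P. if \<gamma> = \<alpha> then h / mass P \<alpha> else 0)"
      unfolding ndens_def by (intro sum.cong refl) auto
    then show ?thesis using \<alpha> by simp
  qed
  have "((\<lambda>r. chem_pot P (bulk_mod P chi) \<beta> (\<lambda>\<gamma>. (\<rho>(\<alpha> := r)) \<gamma>)) has_derivative
     (\<lambda>h. (0 * ln (ndens P (\<lambda>\<gamma>. (\<rho>(\<alpha> := \<rho> \<alpha>)) \<gamma>) / nref P)
             + bulk_mod P chi * (ndens P (\<lambda>\<gamma>. ?d \<gamma> h) / ndens P (\<lambda>\<gamma>. (\<rho>(\<alpha> := \<rho> \<alpha>)) \<gamma>))) / (mass P \<beta> * nref P)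
         + boltz P * temp P / mass P \<beta> * (?d \<beta> h / (\<rho>(\<alpha> := \<rho> \<alpha>)) \<beta> - ndens P (\<lambda>\<gamma>. ?d \<gamma> h) / ndens P (\<lambda>\<gamma>. (\<rho>(\<alpha> := \<rho> \<alpha>)) \<gamma>)))) (at (\<rho> \<alpha>))"
  proof (rule chem_pot_has_derivative[OF P _ \<beta>])
    show "((\<lambda>r. (\<rho>(\<alpha> := r)) \<gamma>) has_derivative ?d \<gamma>) (at (\<rho> \<alpha>))" for \<gamma>
      by (cases "\<gamma> = \<alpha>") auto
  qed (use pos in auto)
  then have "((\<lambda>r. chem_pot P (bulk_mod P chi) \<beta> (\<rho>(\<alpha> := r))) has_real_derivative
     bulk_mod P chi / (mass P \<beta> * nref P) * (1 / mass P \<alpha> * inverse (ndens P \<rho>))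
     + boltz P * temp P / mass P \<beta> * ((if \<alpha> = \<beta> then 1 else 0) * inverse (\<rho> \<beta>) - 1 / mass P \<alpha> * inverse (ndens P \<rho>))) (at (\<rho> \<alpha>))"
    unfolding has_field_derivative_def
    by (rule has_derivative_eq_rhs) (auto simp: nd fun_eq_iff divide_inverse algebra_simps)
  then have "((\<lambda>r. mu P \<beta> (\<rho>(\<alpha> := r)) chi) has_real_derivative
     bulk_mod P chi / (mass P \<beta> * nref P) * (1 / mass P \<alpha> * inverse (ndens P \<rho>))
     + boltz P * temp P / mass P \<beta> * ((if \<alpha> = \<beta> then 1 else 0) * inverse (\<rho> \<beta>) - 1 / mass P \<alpha> * inverse (ndens P \<rho>))) (at (\<rho> \<alpha>))"
    \<comment> \<open>\<open>mu\<close> coincides with \<open>chem_pot\<close> only while the varied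
      density stays positive, so the formulas are exchanged on the open half line around
      \<open>\<rho> \<alpha>\<close>.\<close>
    by (rule has_field_derivative_transform_within_open[where S = "{0<..}"])
       (use pos \<alpha> in \<open>auto intro!: mu_eq[OF P _ \<beta>, symmetric]\<close>)
  then show ?thesis unfolding dmu_drho_def by (rule DERIV_imp_deriv)
qed

lemma dmu_dchi_eq:
  assumes P: "fluid P" and pos: "\<And>\<beta>. \<beta> \<in> {1..nc P} \<Longrightarrow> 0 < \<rho> \<beta>" and \<beta>: "\<beta> \<in> {1..nc P}"
  shows "dmu_dchi P \<beta> \<rho> chi = deriv (hint P) chi * (bulkL P - bulkV P) / (mass P \<beta> * nref P) * ln (ndens P \<rho> / nref P)"
proof -
  have "mu P \<beta> \<rho> = (\<lambda>chi. chem_pot P (bulk_mod P chi) \<beta> \<rho>)"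
    using mu_eq[OF P pos \<beta>] by auto
  moreover have "((\<lambda>chi. chem_pot P (bulk_mod P chi) \<beta> \<rho>) has_real_derivative
      deriv (hint P) chi * (bulkL P - bulkV P) / (mass P \<beta> * nref P) * ln (ndens P \<rho> / nref P)) (at chi)"
    unfolding chem_pot_def deriv_bulk_mod[OF P, symmetric]
    by (rule DERIV_cong[OF DERIV_add[OF DERIV_add[OF DERIV_const DERIV_cmult_right[OF DERIV_cdivide[OF
          twice_differentiable_deriv(1)[OF bulk_mod_twice_differentiable[OF P]]]]] DERIV_const]]) simp
  ultimately show ?thesis unfolding dmu_dchi_def by (simp add: DERIV_imp_deriv)
qed

text \<open>The closed form is continuous at the positive limit densities, and \<open>ev\<close>
  allows it to replace \<open>mu\<close> along the filter. The filter is left open: the lemma serves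
  the far field of the profile as well as the bulk traces.\<close>

lemma mu_tendsto:
  assumes P: "fluid P" and \<alpha>: "\<alpha> \<in> {1..nc P}"
    and \<rho>: "\<And>\<beta>. \<beta> \<in> {1..nc P} \<Longrightarrow> ((\<lambda>y. \<rho> y \<beta>) \<longlongrightarrow> r \<beta>) F" "\<And>\<beta>. \<beta> \<in> {1..nc P} \<Longrightarrow> 0 < r \<beta>"
    and ev: "eventually (\<lambda>y. \<forall>\<beta>\<in>{1..nc P}. 0 < \<rho> y \<beta>) F"
    and chi: "(chi \<longlongrightarrow> c) F"
  shows "((\<lambda>y. mu P \<alpha> (\<rho> y) (chi y)) \<longlongrightarrow> mu P \<alpha> r c) F"
proof -
  have "((\<lambda>y. ndens P (\<rho> y)) \<longlongrightarrow> ndens P r) F"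
    unfolding ndens_def using fluidD(2)[OF P] by (intro tendsto_sum tendsto_divide tendsto_const \<rho>) force+
  moreover have "((\<lambda>y. bulk_mod P (chi y)) \<longlongrightarrow> bulk_mod P c) F"
    using isCont_tendsto_compose[OF DERIV_isCont[OF twice_differentiable_deriv(1)[OF bulk_mod_twice_differentiable[OF P]]] chi] .
  moreover have "0 < ndens P r" by (rule ndens_pos[OF P \<rho>(2)])
  ultimately have "((\<lambda>y. chem_pot P (bulk_mod P (chi y)) \<alpha> (\<rho> y)) \<longlongrightarrow> chem_pot P (bulk_mod P c) \<alpha> r) F"
    unfolding chem_pot_def
    using \<rho>(2)[OF \<alpha>] fluidD(2)[OF P \<alpha>] fluidD(15)[OF P]
    by (intro tendsto_intros \<rho>(1) \<alpha>) auto
  moreover have "mu P \<alpha> r c = chem_pot P (bulk_mod P c) \<alpha> r" by (rule mu_eq[OF P \<rho>(2) \<alpha>])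
  moreover have "\<forall>\<^sub>F y in F. chem_pot P (bulk_mod P (chi y)) \<alpha> (\<rho> y) = mu P \<alpha> (\<rho> y) (chi y)"
    using ev by eventually_elim (rule mu_eq[OF P _ \<alpha>, symmetric], blast)
  ultimately show ?thesis by (simp add: Lim_transform_eventually)
qed

section \<open>Vector calculus in the bulk\<close>

text \<open>\<open>frechet_derivative\<close> is a choice among all derivatives at the point, and
  which maps are derivatives depends only on the function near the point; the two choices therefore
  coincide.\<close>

lemma frechet_derivative_cong_open:
  assumes "open S" "x \<in> S" "\<And>y. y \<in> S \<Longrightarrow> f y = g y"
  shows "frechet_derivative f (at x) = frechet_derivative g (at x)"
proof -
  have "(f has_derivative D) (at x) \<longleftrightarrow> (g has_derivative D) (at x)" for D
    using has_derivative_transform_within_open[of f D x UNIV S g] has_derivative_transform_within_open[of g D x UNIV S f] assms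
    by auto
  then show ?thesis unfolding frechet_derivative_def by simp
qed

lemma grad_cong_open:
  assumes "open S" "x \<in> S" "\<And>y. y \<in> S \<Longrightarrow> f y = g y"
  shows "grad f x = grad g x"
  unfolding grad_def using frechet_derivative_cong_open[OF assms] by simp

lemma tensor_dvg_cong_open:
  assumes "open S" "x \<in> S" "\<And>y. y \<in> S \<Longrightarrow> A y = B y"
  shows "tensor_dvg A x = tensor_dvg B x"
proof -
  have "frechet_derivative (\<lambda>y. A y $ i) (at x) = frechet_derivative (\<lambda>y. B y $ i) (at x)" for i
    by (rule frechet_derivative_cong_open[OF assms(1,2)]) (simp add: assms(3))
  then show ?thesis unfolding tensor_dvg_def dvg_def jacobian_def by simp
qed

lemma axis_expansion: "(\<Sum>i\<in>UNIV. c $ i *\<^sub>R axis i 1) = (c :: real^'n)"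
  by (simp add: basis_expansion flip: scalar_mult_eq_scaleR)

lemma frechet_derivative_grad:
  assumes "f differentiable (at x)"
  shows "frechet_derivative f (at x) h = grad f x \<bullet> h"
proof -
  interpret L: linear "frechet_derivative f (at x)" by (rule linear_frechet_derivative[OF assms])
  have "frechet_derivative f (at x) h = frechet_derivative f (at x) (\<Sum>i\<in>UNIV. h $ i *\<^sub>R axis i 1)"
    by (simp only: axis_expansion)
  also have "\<dots> = (\<Sum>i\<in>UNIV. h $ i * frechet_derivative f (at x) (axis i 1))"
    by (simp add: L.scaleR L.sum)
  finally show ?thesis by (simp add: grad_def inner_vec_def mult.commute)
qed

lemma has_derivative_grad:
  assumes "f differentiable (at x)"
  shows "(f has_derivative (\<lambda>h. grad f x \<bullet> h)) (at x)"
proof -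
  have "frechet_derivative f (at x) = (\<lambda>h. grad f x \<bullet> h)" by (rule ext) (rule frechet_derivative_grad[OF assms])
  then show ?thesis using assms frechet_derivative_works[of f "at x"] by simp
qed

lemma grad_component:
  assumes "(f has_derivative D) (at x)"
  shows "grad f x $ i = D (axis i 1)"
  using frechet_derivative_at[OF assms] by (simp add: grad_def)

lemma grad_eqI:
  assumes "(f has_derivative (\<lambda>h. g \<bullet> h)) (at x)"
  shows "grad f x = g"
  using grad_component[OF assms] by (simp add: vec_eq_iff inner_axis)

lemma dvg_eq:
  assumes "(F has_derivative D) (at x)"
  shows "dvg F x = (\<Sum>j\<in>UNIV. D (axis j 1) $ j)"
  using frechet_derivative_at[OF assms] by (simp add: dvg_def jacobian_def trace_def matrix_def)

text \<open>In the bulk \<open>q\<close> is the pressure, \<open>p\<close> the gradient of the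
  potential and \<open>c\<close> the permittivity factor. Since \<open>c\<close> is constant within
  a phase, the isotropic part of the Maxwell stress can be moved into the pressure gradient.\<close>

lemma maxwell_stress_divergence:
  assumes p: "p differentiable (at x)" and q: "q differentiable (at x)"
  shows "grad (\<lambda>y. q y + e / 2 * c * (norm (p y))\<^sup>2) x - tensor_dvg (\<lambda>y. (e * c) *\<^sub>R outer (p y) (p y)) x
    = grad q x + e *\<^sub>R tensor_dvg (\<lambda>y. c *\<^sub>R ((1/2 * (norm (p y))\<^sup>2) *\<^sub>R mat 1 - outer (p y) (p y))) x"
proof -
  obtain p' q' where p': "(p has_derivative p') (at x)" and q': "(q has_derivative q') (at x)"
    using p q unfolding differentiable_def by blast
  have pi: "((\<lambda>y. p y $ i) has_derivative (\<lambda>h. p' h $ i)) (at x)" for i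
    using bounded_linear.has_derivative[OF bounded_linear_vec_nth p'] .
  have sq: "((\<lambda>y. (norm (p y))\<^sup>2) has_derivative (\<lambda>h. 2 * (p x \<bullet> p' h))) (at x)"
    unfolding power2_norm_eq_inner
    by (rule has_derivative_eq_rhs[OF has_derivative_inner[OF p' p']]) (simp add: inner_commute fun_eq_iff)
  have row1: "(\<lambda>y. ((e * c) *\<^sub>R outer (p y) (p y)) $ i) = (\<lambda>y. (e * c) *\<^sub>R p y $ i *\<^sub>R p y)" for i
    by (simp add: outer_def vec_eq_iff fun_eq_iff)
  have row2: "(\<lambda>y. (c *\<^sub>R ((1/2 * (norm (p y))\<^sup>2) *\<^sub>R mat 1 - outer (p y) (p y))) $ i)
     = (\<lambda>y. c *\<^sub>R ((1/2 * (norm (p y))\<^sup>2) *\<^sub>R axis i 1 - p y $ i *\<^sub>R p y))" for i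
    by (auto simp: outer_def vec_eq_iff fun_eq_iff mat_def axis_def)
  have pp: "((\<lambda>y. p y $ i *\<^sub>R p y) has_derivative (\<lambda>h. p x $ i *\<^sub>R p' h + p' h $ i *\<^sub>R p x)) (at x)" for i
    by (rule has_derivative_scaleR[OF pi p'])
  have d1: "dvg (\<lambda>y. (e * c) *\<^sub>R p y $ i *\<^sub>R p y) x
     = (\<Sum>j\<in>UNIV. ((e * c) *\<^sub>R (p x $ i *\<^sub>R p' (axis j 1) + p' (axis j 1) $ i *\<^sub>R p x)) $ j)" for i
    by (rule dvg_eq[OF has_derivative_scaleR_right[OF pp]])
  have d2: "dvg (\<lambda>y. c *\<^sub>R ((1/2 * (norm (p y))\<^sup>2) *\<^sub>R axis i 1 - p y $ i *\<^sub>R p y)) x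
     = (\<Sum>j\<in>UNIV. (c *\<^sub>R ((1/2 * (2 * (p x \<bullet> p' (axis j 1)))) *\<^sub>R axis i 1
          - (p x $ i *\<^sub>R p' (axis j 1) + p' (axis j 1) $ i *\<^sub>R p x))) $ j)" for i
    by (rule dvg_eq[OF has_derivative_scaleR_right[OF has_derivative_diff[OF has_derivative_scaleR_left[OF
          has_derivative_mult_right[OF sq]] pp]]])
  have g: "grad (\<lambda>y. q y + e / 2 * c * (norm (p y))\<^sup>2) x $ i
      = q' (axis i 1) + e / 2 * c * (2 * (p x \<bullet> p' (axis i 1)))" for i
    by (rule grad_component[OF has_derivative_add[OF q' has_derivative_mult_right[OF sq]]])
  \<comment> \<open>The i-th row of a scalar multiple of the identity is that scalar times
    \<open>axis i 1\<close>; its divergence picks out the i-th partial derivative, so the divergence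
    of the isotropic part is a gradient.\<close>
  have ax: "(\<Sum>j\<in>UNIV. a j * axis i (1::real) $ j) = a i" for a :: "3 \<Rightarrow> real" and i
    by (simp add: axis_def if_distrib cong: if_cong)
  show ?thesis
  proof (rule vec_eq_iff[THEN iffD2], rule allI)
    fix i :: 3
    have "e * (\<Sum>j\<in>UNIV. (c *\<^sub>R ((1/2 * (2 * (p x \<bullet> p' (axis j 1)))) *\<^sub>R axis i 1
          - (p x $ i *\<^sub>R p' (axis j 1) + p' (axis j 1) $ i *\<^sub>R p x))) $ j)
        = e * c * (\<Sum>j\<in>UNIV. (p x \<bullet> p' (axis j 1)) * axis i 1 $ j)
        - (\<Sum>j\<in>UNIV. ((e * c) *\<^sub>R (p x $ i *\<^sub>R p' (axis j 1) + p' (axis j 1) $ i *\<^sub>R p x)) $ j)"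
      by (simp add: sum_distrib_left sum_subtractf[symmetric] algebra_simps)
    moreover have "tensor_dvg (\<lambda>y. (e * c) *\<^sub>R outer (p y) (p y)) x $ i
        = (\<Sum>j\<in>UNIV. ((e * c) *\<^sub>R (p x $ i *\<^sub>R p' (axis j 1) + p' (axis j 1) $ i *\<^sub>R p x)) $ j)"
      by (simp only: tensor_dvg_def vec_lambda_beta row1 d1)
    moreover have "tensor_dvg (\<lambda>y. c *\<^sub>R ((1/2 * (norm (p y))\<^sup>2) *\<^sub>R mat 1 - outer (p y) (p y))) x $ i
        = (\<Sum>j\<in>UNIV. (c *\<^sub>R ((1/2 * (2 * (p x \<bullet> p' (axis j 1)))) *\<^sub>R axis i 1
          - (p x $ i *\<^sub>R p' (axis j 1) + p' (axis j 1) $ i *\<^sub>R p x))) $ j)"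
      by (simp only: tensor_dvg_def vec_lambda_beta row2 d2)
    moreover note g[of i] grad_component[OF q', of i] ax[of "\<lambda>j. p x \<bullet> p' (axis j 1)" i]
    ultimately show "(grad (\<lambda>y. q y + e / 2 * c * (norm (p y))\<^sup>2) x
          - tensor_dvg (\<lambda>y. (e * c) *\<^sub>R outer (p y) (p y)) x) $ i
      = (grad q x + e *\<^sub>R tensor_dvg (\<lambda>y. c *\<^sub>R ((1/2 * (norm (p y))\<^sup>2) *\<^sub>R mat 1 - outer (p y) (p y))) x) $ i"
      by (simp only: vector_minus_component vector_add_component vector_scaleR_component) simp
  qed
qed

lemma space_Ck_differentiable:
  assumes "space_Ck (Suc k) Q f" "(t, x) \<in> Q"
  shows "f t differentiable (at x)"
  using assms by auto

lemma space_Ck_grad_differentiable: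
  assumes "space_Ck 2 Q f" "(t, x) \<in> Q"
  shows "grad (f t) differentiable (at x)"
proof -
  have "(\<lambda>x. frechet_derivative (f t) (at x) e) differentiable (at x)" for e
    using assms by (auto simp: numeral_2_eq_2)
  then show ?thesis
    unfolding grad_def[abs_def]
    by (subst differentiable_componentwise_within) (auto simp: Basis_vec_def inner_axis)
qed

section \<open>Geometry of the interface\<close>

text \<open>Space-time regularity is formulated with derivatives within \<open>S\<close>, because
  time is one-sided at 0. Freezing the time leaves an open set of positions, on which the
  restriction is an ordinary derivative in direction \<open>(0, h)\<close>.\<close>

lemma C1_slice:
  assumes S: "Ck_on (Suc 0) S F" and U: "open U" and US: "{t} \<times> U \<subseteq> S"
  shows "\<And>y. y \<in> U \<Longrightarrow> (\<lambda>y. F (t, y)) differentiable (at y)"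
    and "\<And>h. continuous_on U (\<lambda>y. frechet_derivative (\<lambda>y. F (t, y)) (at y) h)"
proof -
  have D: "((\<lambda>y. F (t, y)) has_derivative (\<lambda>h. frechet_derivative F (at (t, y) within S) (0, h))) (at y)"
    if y: "y \<in> U" for y
  proof -
    have "(F has_derivative frechet_derivative F (at (t, y) within S)) (at (t, y) within S)"
      using S US y by (auto simp: differentiable_on_def frechet_derivative_works[symmetric])
    then have "(F has_derivative frechet_derivative F (at (t, y) within S)) (at (t, y) within Pair t ` U)"
      by (rule has_derivative_subset) (use US in auto)
    from has_derivative_in_compose[OF has_derivative_Pair[OF has_derivative_const has_derivative_ident] this]
    have "((\<lambda>y. F (t, y)) has_derivative (\<lambda>h. frechet_derivative F (at (t, y) within S) (0, h))) (at y within U)"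
      by simp
    then show ?thesis using at_within_open[OF y U] by simp
  qed
  show "\<And>y. y \<in> U \<Longrightarrow> (\<lambda>y. F (t, y)) differentiable (at y)"
    using D unfolding differentiable_def by blast
  fix h
  have "continuous_on S (\<lambda>x. frechet_derivative F (at x within S) (0, h))" using S by simp
  then have "continuous_on U (\<lambda>y. frechet_derivative F (at (t, y) within S) (0, h))"
    by (rule continuous_on_compose2[where f = "Pair t"]) (use US in \<open>auto intro!: continuous_intros\<close>)
  then show "continuous_on U (\<lambda>y. frechet_derivative (\<lambda>y. F (t, y)) (at y) h)"
    by (rule continuous_on_eq) (use frechet_derivative_at[OF D] in metis)
qed

lemma evolving_interfaceD:
  assumes "evolving_interface G" "t \<in> {0..<Tf G}"
  shows "open (liquid G t)" "open (vapor G t)" "open (params G)"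
    "liquid G t \<inter> Gam G t = {}" "vapor G t \<inter> Gam G t = {}"
    "chart G t ` params G = Gam G t"
    "\<And>s. s \<in> params G \<Longrightarrow> inj (frechet_derivative (chart G t) (at s))"
    "\<And>s. s \<in> params G \<Longrightarrow> chart G t differentiable (at s)"
    "\<And>e. continuous_on (params G) (\<lambda>s. frechet_derivative (chart G t) (at s) e)"
proof -
  note E = assms(1)[unfolded evolving_interface_def]
  note E2 = E[THEN conjunct2, THEN conjunct2]
  note E5 = E2[THEN conjunct2, THEN conjunct2, THEN conjunct2]
  note E8 = E5[THEN conjunct2, THEN conjunct2]
  have slice: "open (Om t)" if op: "openin (top_of_set ({0..<Tf G} \<times> UNIV)) (spacetime G Om)" for Om
  proof -
    obtain T where T: "open T" "spacetime G Om = ({0..<Tf G} \<times> UNIV) \<inter> T"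
      using op unfolding openin_open by blast
    have "Om t = Pair t -` T" using T(2) assms(2) unfolding spacetime_def by auto
    moreover have "open (Pair t -` T)" by (rule open_vimage[OF T(1)]) (intro continuous_intros)
    ultimately show ?thesis by simp
  qed
  show "open (liquid G t)" by (rule slice[OF E2[THEN conjunct2, THEN conjunct1]])
  show "open (vapor G t)" by (rule slice[OF E2[THEN conjunct2, THEN conjunct2, THEN conjunct1]])
  show U: "open (params G)" by (rule E2[THEN conjunct1])
  show "liquid G t \<inter> Gam G t = {}" "vapor G t \<inter> Gam G t = {}" "chart G t ` params G = Gam G t"
    "\<And>s. s \<in> params G \<Longrightarrow> inj (frechet_derivative (chart G t) (at s))"
    using E5[THEN conjunct1] E8[THEN conjunct2] assms(2) by blast+
  have c: "Ck_on (Suc 0) ({0..<Tf G} \<times> params G) (\<lambda>(t, s). chart G t s)"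
    using E8[THEN conjunct1] unfolding smooth_on_def by blast
  have sub: "{t} \<times> params G \<subseteq> {0..<Tf G} \<times> params G" using assms(2) by blast
  show "\<And>s. s \<in> params G \<Longrightarrow> chart G t differentiable (at s)"
    "\<And>e. continuous_on (params G) (\<lambda>s. frechet_derivative (chart G t) (at s) e)"
    using C1_slice[OF c U sub] by simp_all
qed

text \<open>The space-time defining function is frozen at time \<open>t\<close> on a ball inside its
  neighbourhood; continuity of the spatial gradient is the regularity that the later arguments
  use.\<close>

lemma interface_level_set:
  assumes "evolving_interface G" "t \<in> {0..<Tf G}" "x \<in> Gam G t"
  obtains r F where "0 < r" "\<And>y. y \<in> ball x r \<Longrightarrow> F differentiable (at y)"
    "continuous_on (ball x r) (grad F)"
    "\<And>y. y \<in> ball x r \<Longrightarrow> y \<in> Gam G t \<longleftrightarrow> F y = 0"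
    "\<And>y. y \<in> ball x r \<Longrightarrow> y \<in> liquid G t \<longleftrightarrow> 0 < F y"
    "\<And>y. y \<in> ball x r \<Longrightarrow> y \<in> vapor G t \<longleftrightarrow> F y < 0"
    "grad F x \<noteq> 0" "nu G t x = sgn (grad F x)"
proof -
  obtain B F where B: "open B" "(t, x) \<in> B" "smooth_on (B \<inter> {0..<Tf G} \<times> UNIV) F"
    and F: "\<And>t' y. (t', y) \<in> B \<inter> {0..<Tf G} \<times> UNIV \<Longrightarrow>
           (y \<in> Gam G t' \<longleftrightarrow> F (t', y) = (0::real)) \<and>
           (y \<in> liquid G t' \<longleftrightarrow> 0 < F (t', y)) \<and>
           (y \<in> vapor G t' \<longleftrightarrow> F (t', y) < 0) \<and>
           grad (\<lambda>y. F (t', y)) y \<noteq> 0 \<and>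
           (y \<in> Gam G t' \<longrightarrow> nu G t' y = sgn (grad (\<lambda>y. F (t', y)) y))"
  proof -
    note E = assms(1)[unfolded evolving_interface_def, THEN conjunct2, THEN conjunct2, THEN conjunct2, THEN conjunct2,
        THEN conjunct2, THEN conjunct2, THEN conjunct1, rule_format, OF assms(2,3)]
    from E show ?thesis by (elim exE conjE) (rule that, assumption+, blast)
  qed
  have "open (Pair t -` B)" by (rule open_vimage[OF B(1)]) (intro continuous_intros)
  then obtain r where r: "0 < r" "ball x r \<subseteq> Pair t -` B"
    using B(2) by (meson open_contains_ball vimageI)
  have sub: "{t} \<times> ball x r \<subseteq> B \<inter> {0..<Tf G} \<times> UNIV" using r assms(2) by auto
  have F': "y \<in> ball x r \<Longrightarrow> (t, y) \<in> B \<inter> {0..<Tf G} \<times> UNIV" for y using sub by blast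
  have "Ck_on (Suc 0) (B \<inter> {0..<Tf G} \<times> UNIV) F" using B(3) unfolding smooth_on_def by blast
  note C = C1_slice[OF this open_ball sub]
  show ?thesis
  proof (rule that[of r "\<lambda>y. F (t, y)"])
    show "continuous_on (ball x r) (grad (\<lambda>y. F (t, y)))"
      unfolding grad_def[abs_def] by (intro continuous_intros C(2))
  qed (use r(1) C(1) F[OF F'] assms(3) in auto)
qed

lemma norm_nu:
  assumes "evolving_interface G" "t \<in> {0..<Tf G}" "x \<in> Gam G t"
  shows "nu G t x \<bullet> nu G t x = 1"
  by (rule interface_level_set[OF assms]) (simp add: norm_sgn flip: power2_norm_eq_inner)

text \<open>\<open>a\<close> is the unit normal at \<open>x\<close> up to sign. By continuity of the
  gradient the defining function is strictly monotone along \<open>a\<close> near \<open>x\<close>,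
  so one direction and one radius serve all nearby interface points. A difference quotient along the
  surface needs this uniformity.\<close>

lemma shift_into_bulk:
  assumes "evolving_interface G" "t \<in> {0..<Tf G}" "x \<in> Gam G t" "S \<in> {liquid G t, vapor G t}"
  obtains a r where "0 < r" "norm a = 1"
    "\<And>y \<delta>. y \<in> Gam G t \<Longrightarrow> y \<in> ball x r \<Longrightarrow> 0 < \<delta> \<Longrightarrow> \<delta> < r \<Longrightarrow> y + \<delta> *\<^sub>R a \<in> S"
proof -
  obtain r F where r: "0 < r" and D: "\<And>y. y \<in> ball x r \<Longrightarrow> F differentiable (at y)"
    and c: "continuous_on (ball x r) (grad F)"
    and F: "\<And>y. y \<in> ball x r \<Longrightarrow> y \<in> Gam G t \<longleftrightarrow> F y = 0"
    "\<And>y. y \<in> ball x r \<Longrightarrow> y \<in> liquid G t \<longleftrightarrow> 0 < F y"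
    "\<And>y. y \<in> ball x r \<Longrightarrow> y \<in> vapor G t \<longleftrightarrow> F y < 0"
    and nz: "grad F x \<noteq> 0"
    by (rule interface_level_set[OF assms(1-3)]) (rule that)
  define \<sigma> :: real where "\<sigma> = (if S = liquid G t then 1 else - 1)"
  define a where "a = \<sigma> *\<^sub>R sgn (grad F x)"
  have \<sigma>: "\<sigma> * \<sigma> = 1" "\<bar>\<sigma>\<bar> = 1" by (auto simp: \<sigma>_def)
  have na: "norm a = 1" using nz \<sigma> by (simp add: a_def norm_sgn)
  have "isCont (\<lambda>y. \<sigma> * (grad F y \<bullet> a)) x"
    using c r by (intro continuous_intros) (simp add: continuous_on_eq_continuous_at)
  moreover have "0 < \<sigma> * (grad F x \<bullet> a)"
  proof -
    have "\<sigma> * (grad F x \<bullet> a) = (\<sigma> * \<sigma>) * (grad F x \<bullet> sgn (grad F x))" by (simp add: a_def)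
    also have "\<dots> = norm (grad F x)" using nz by (simp add: \<sigma> sgn_div_norm flip: power2_norm_eq_inner) (simp add: power2_eq_square)
    finally show ?thesis using nz by simp
  qed
  ultimately have "\<forall>\<^sub>F y in at x. 0 < \<sigma> * (grad F y \<bullet> a)"
    by (metis isCont_def order_tendstoD(1))
  then obtain d where d: "0 < d" "\<And>y. y \<noteq> x \<Longrightarrow> dist y x < d \<Longrightarrow> 0 < \<sigma> * (grad F y \<bullet> a)"
    by (auto simp: eventually_at)
  \<comment> \<open>Half the radius is spent on the distance of \<open>y\<close> from
    \<open>x\<close>, the other half on the shift, so the whole segment stays where \<open>F\<close>
    is differentiable and monotone along \<open>a\<close>.\<close>
  define r' where "r' = min r d / 2"
  show ?thesis
  proof (rule that[of r' a])
    show "0 < r'" using r d by (simp add: r'_def)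
    fix y \<delta> assume y: "y \<in> Gam G t" "y \<in> ball x r'" and \<delta>: "0 < \<delta>" "\<delta> < r'"
    have near: "dist (y + s *\<^sub>R a) x < min r d" if "0 \<le> s" "s \<le> \<delta>" for s
    proof -
      have "dist (y + s *\<^sub>R a) x \<le> dist (y + s *\<^sub>R a) y + dist y x" by (rule dist_triangle)
      also have "dist (y + s *\<^sub>R a) y = s" using na that by (simp add: dist_norm)
      finally show ?thesis using y(2) that \<delta> unfolding r'_def by (auto simp: dist_commute)
    qed
    have pos: "0 < \<sigma> * (grad F (y + s *\<^sub>R a) \<bullet> a)" if "0 \<le> s" "s \<le> \<delta>" for s
      using d(2)[of "y + s *\<^sub>R a"] near[OF that] \<open>0 < \<sigma> * (grad F x \<bullet> a)\<close> by (cases "y + s *\<^sub>R a = x") auto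
    have "((\<lambda>s. F (y + s *\<^sub>R a)) has_real_derivative grad F (y + s *\<^sub>R a) \<bullet> a) (at s)"
      if "0 \<le> s" "s \<le> \<delta>" for s
    proof -
      have 1: "((\<lambda>s. y + s *\<^sub>R a) has_derivative (\<lambda>h. h *\<^sub>R a)) (at s)" by (auto intro!: derivative_eq_intros)
      have "(F has_derivative (\<lambda>h. grad F (y + s *\<^sub>R a) \<bullet> h)) (at (y + s *\<^sub>R a))"
        by (intro has_derivative_grad D) (use near[OF that] in \<open>simp add: dist_commute\<close>)
      from diff_chain_at[OF 1 this] show ?thesis
        unfolding has_field_derivative_def o_def by (rule has_derivative_eq_rhs) (simp add: fun_eq_iff)
    qed
    then obtain z where z: "0 < z" "z < \<delta>" "F (y + \<delta> *\<^sub>R a) - F (y + 0 *\<^sub>R a) = (\<delta> - 0) * (grad F (y + z *\<^sub>R a) \<bullet> a)"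
      using MVT2[of 0 \<delta> "\<lambda>s. F (y + s *\<^sub>R a)" "\<lambda>s. grad F (y + s *\<^sub>R a) \<bullet> a"] \<delta>(1) by blast
    have inb: "y + \<delta> *\<^sub>R a \<in> ball x r" using near[of \<delta>] \<delta> by (simp add: dist_commute)
    have "F y = 0" using F(1)[of y] y r d unfolding r'_def by auto
    then have "\<sigma> * F (y + \<delta> *\<^sub>R a) = \<delta> * (\<sigma> * (grad F (y + z *\<^sub>R a) \<bullet> a))" using z(3) by simp
    moreover have "0 < \<delta> * (\<sigma> * (grad F (y + z *\<^sub>R a) \<bullet> a))"
      by (rule mult_pos_pos[OF \<delta>(1) pos]) (use z(1,2) in auto)
    ultimately have "0 < \<sigma> * F (y + \<delta> *\<^sub>R a)" by (simp only:)
    then show "y + \<delta> *\<^sub>R a \<in> S" using F(2,3)[OF inb] assms(4) by (auto simp: \<sigma>_def split: if_splits)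
  qed (rule na)
qed

lemma shift_tendsto:
  fixes y a :: "'a::real_normed_vector"
  assumes "y \<notin> S" "0 < r" "\<And>\<delta>. 0 < \<delta> \<Longrightarrow> \<delta> < r \<Longrightarrow> y + \<delta> *\<^sub>R a \<in> S"
  shows "filterlim (\<lambda>\<delta>. y + \<delta> *\<^sub>R a) (at y within S) (at_right 0)"
proof -
  have "((\<lambda>\<delta>. y + \<delta> *\<^sub>R a) \<longlongrightarrow> y + 0 *\<^sub>R a) (at_right 0)" by (intro tendsto_intros)
  moreover have "\<forall>\<^sub>F \<delta> in at_right 0. y + \<delta> *\<^sub>R a \<in> S \<and> y + \<delta> *\<^sub>R a \<noteq> y"
    using eventually_at_right_less eventually_at_right_real[OF assms(2)] 
    by eventually_elim (use assms(1,3) in force)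
  ultimately show ?thesis by (simp add: filterlim_at)
qed

lemma bulk_side:
  assumes "evolving_interface G" "t \<in> {0..<Tf G}" "S \<in> {liquid G t, vapor G t}"
  shows "open S" "x \<in> Gam G t \<Longrightarrow> x \<notin> S"
  using evolving_interfaceD(1,2,4,5)[OF assms(1,2)] assms(3) by auto

text \<open>\<open>Lim\<close> returns the limit only along a nontrivial filter. The shifted points
  \<open>x + \<delta> a\<close> show that each bulk region accumulates at every interface
  point.\<close>

lemma interface_nontrivial:
  assumes "evolving_interface G" "t \<in> {0..<Tf G}" "x \<in> Gam G t" "S \<in> {liquid G t, vapor G t}"
  shows "at x within S \<noteq> bot"
proof -
  obtain a r where "0 < r" "norm a = 1"
    "\<And>y \<delta>. y \<in> Gam G t \<Longrightarrow> y \<in> ball x r \<Longrightarrow> 0 < \<delta> \<Longrightarrow> \<delta> < r \<Longrightarrow> y + \<delta> *\<^sub>R a \<in> S"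
    using shift_into_bulk[OF assms] by metis
  then have "filterlim (\<lambda>\<delta>. x + \<delta> *\<^sub>R a) (at x within S) (at_right 0)"
    using assms(3) bulk_side(2)[OF assms(1,2,4,3)] by (intro shift_tendsto[where r = r]) auto
  then show ?thesis
    by (auto simp: filterlim_def bot_unique filtermap_bot_iff)
qed

lemma one_sided_eq:
  assumes "evolving_interface G" "t \<in> {0..<Tf G}" "x \<in> Gam G t" "S \<in> {liquid G t, vapor G t}"
    and "(f \<longlongrightarrow> l) (at x within S)"
  shows "one_sided S f x = l"
  unfolding one_sided_def by (rule tendsto_Lim[OF interface_nontrivial[OF assms(1-4)] assms(5)])

lemma has_traces_tendsto:
  assumes "evolving_interface G" "has_traces G f"
    and "t \<in> {0..<Tf G}" "x \<in> Gam G t" "S \<in> {liquid G t, vapor G t}"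
  shows "(f t \<longlongrightarrow> one_sided S (f t) x) (at x within S)"
  using assms one_sided_eq[OF assms(1,3-5)] unfolding has_traces_def by metis

lemma has_traces_grad_tendsto:
  assumes "evolving_interface G" "has_traces G f"
    and "t \<in> {0..<Tf G}" "x \<in> Gam G t" "S \<in> {liquid G t, vapor G t}"
  shows "(grad (f t) \<longlongrightarrow> one_sided S (grad (f t)) x) (at x within S)"
proof -
  have "\<forall>e. \<exists>l. ((\<lambda>y. frechet_derivative (f t) (at y) e) \<longlongrightarrow> l) (at x within S)"
    using assms(2-5) unfolding has_traces_def by blast
  then obtain l where "\<And>e. ((\<lambda>y. frechet_derivative (f t) (at y) e) \<longlongrightarrow> l e) (at x within S)" by metis
  then have "(grad (f t) \<longlongrightarrow> (\<chi> i. l (axis i 1))) (at x within S)"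
    unfolding grad_def[abs_def] by (intro tendsto_vec_lambda)
  from one_sided_eq[OF assms(1,3-5) this] this show ?thesis by simp
qed

text \<open>The defining function composed with the chart vanishes near \<open>s\<close>; the chain
  rule then makes its gradient, of which the normal is a multiple, orthogonal to the range of the
  chart derivative.\<close>

lemma nu_orthogonal_tangent:
  assumes "evolving_interface G" "t \<in> {0..<Tf G}" "s \<in> params G"
  shows "nu G t (chart G t s) \<bullet> frechet_derivative (chart G t) (at s) e = 0"
proof -
  note E = evolving_interfaceD[OF assms(1,2)]
  define x where "x = chart G t s"
  have x: "x \<in> Gam G t" using E(6) assms(3) by (auto simp: x_def)
  obtain r F where r: "0 < r" and D: "\<And>y. y \<in> ball x r \<Longrightarrow> F differentiable (at y)"
    and F: "\<And>y. y \<in> ball x r \<Longrightarrow> y \<in> Gam G t \<longleftrightarrow> F y = 0"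
    and nu: "nu G t x = sgn (grad F x)"
    using interface_level_set[OF assms(1,2) x] by metis
  let ?c = "chart G t" and ?D = "frechet_derivative (chart G t) (at s)"
  have c: "(?c has_derivative ?D) (at s)" using E(8)[OF assms(3)] by (simp add: frechet_derivative_works)
  have "isCont ?c s" using c has_derivative_continuous by blast
  then have "(?c \<longlongrightarrow> x) (nhds s)" by (simp add: x_def isCont_def tendsto_at_iff_tendsto_nhds)
  then have "\<forall>\<^sub>F y in nhds s. dist (?c y) x < r" using r by (rule tendstoD)
  moreover have "\<forall>\<^sub>F y in nhds s. y \<in> params G" using E(3) assms(3) by (simp add: eventually_nhds_in_open)
  ultimately have "\<forall>\<^sub>F y in nhds s. 0 = (F \<circ> ?c) y"
    by eventually_elim (metis F E(6) dist_commute imageI mem_ball o_apply)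
  then obtain U where U: "open U" "s \<in> U" "\<And>y. y \<in> U \<Longrightarrow> 0 = (F \<circ> ?c) y" by (auto simp: eventually_nhds)
  have "(F \<circ> ?c has_derivative (\<lambda>h. grad F x \<bullet> ?D h)) (at s)"
    using diff_chain_at[OF c, of F "\<lambda>h. grad F x \<bullet> h"] has_derivative_grad[OF D] r by (simp add: x_def o_def)
  moreover have "(F \<circ> ?c has_derivative (\<lambda>h. 0)) (at s)"
    by (rule has_derivative_transform_within_open[OF has_derivative_const U])
  ultimately have "grad F x \<bullet> ?D e = 0" using has_derivative_unique by metis
  then show ?thesis unfolding x_def[symmetric] nu sgn_div_norm by simp
qed

text \<open>The coordinate formula with the inverse metric is the unique vector with zero normal
  component and the prescribed products with the tangents. The projection of \<open>p\<close> has
  the same products, and the tangents together with the normal span the space.\<close>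

lemma surf_grad_projection:
  assumes "evolving_interface G" "t \<in> {0..<Tf G}" "s \<in> params G"
    and f: "\<And>e. frechet_derivative f (at s) e = p \<bullet> frechet_derivative (chart G t) (at s) e"
  shows "surf_grad G t f s = p - (p \<bullet> nu G t (chart G t s)) *\<^sub>R nu G t (chart G t s)"
proof -
  note E = evolving_interfaceD[OF assms(1,2)]
  define n where "n = nu G t (chart G t s)"
  have nn: "n \<bullet> n = 1" using norm_nu[OF assms(1,2)] E(6) assms(3) by (auto simp: n_def)
  let ?T = "tangent G t s" and ?M = "metric G t s"
  have nT: "n \<bullet> ?T i = 0" for i using nu_orthogonal_tangent[OF assms(1-3)] by (simp add: n_def tangent_def)
  have lin: "linear (frechet_derivative (chart G t) (at s))"
    using E(8)[OF assms(3)] by (rule linear_frechet_derivative)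
  have T0: "c = 0" if "(\<Sum>i\<in>UNIV. c $ i *\<^sub>R ?T i) = 0" for c
  proof -
    have "frechet_derivative (chart G t) (at s) c = frechet_derivative (chart G t) (at s) (\<Sum>i\<in>UNIV. c $ i *\<^sub>R axis i 1)"
      by (simp only: axis_expansion)
    also have "\<dots> = (\<Sum>i\<in>UNIV. c $ i *\<^sub>R ?T i)"
      by (simp add: linear_sum[OF lin] linear_cmul[OF lin] tangent_def)
    finally show ?thesis using that E(7)[OF assms(3)] linear_injective_0[OF lin] by metis
  qed
  \<comment> \<open>\<open>c \<bullet> (?M *v c)\<close> is the squared length of the tangent
    combination with coefficients \<open>c\<close>, so the Gram matrix inherits injectivity from the
    chart derivative.\<close>
  have "c = 0" if "?M *v c = 0" for c
  proof -
    have "(\<Sum>i\<in>UNIV. c $ i *\<^sub>R ?T i) \<bullet> (\<Sum>j\<in>UNIV. c $ j *\<^sub>R ?T j) = c \<bullet> (?M *v c)"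
      unfolding inner_vec_def[of c]
      by (simp add: inner_sum_left inner_sum_right matrix_vector_mult_def metric_def sum_distrib_left mult_ac inner_commute)
    then show ?thesis using that T0 by simp
  qed
  then have "invertible ?M" using matrix_left_invertible_ker invertible_left_inverse by blast
  then have inv: "?M ** matrix_inv ?M = mat 1" 
    unfolding matrix_inv_def invertible_def by (rule someI2_ex) simp
  define q where "q = surf_grad G t f s"
  have q: "q = (\<Sum>i\<in>UNIV. \<Sum>j\<in>UNIV. (matrix_inv ?M $ i $ j * (p \<bullet> ?T j)) *\<^sub>R ?T i)"
    unfolding q_def surf_grad_def f tangent_def ..
  have qn: "q \<bullet> n = 0" unfolding q inner_commute[of _ n] by (simp add: inner_sum_right nT)
  \<comment> \<open>The product with \<open>?T k\<close> places a metric coefficient next to its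
    inverse, leaving the k-th product of \<open>p\<close>.\<close>
  have qT: "q \<bullet> ?T k = p \<bullet> ?T k" for k
  proof -
    have "q \<bullet> ?T k = (\<Sum>j\<in>UNIV. (\<Sum>i\<in>UNIV. ?M $ k $ i * matrix_inv ?M $ i $ j) * (p \<bullet> ?T j))"
    proof -
      have "?M $ k $ i = ?T i \<bullet> ?T k" for i by (simp add: metric_def inner_commute)
      then show ?thesis unfolding q by (subst sum.swap) (simp add: inner_sum_left sum_distrib_right sum_distrib_left mult_ac)
    qed
    also have "\<dots> = (\<Sum>j\<in>UNIV. (?M ** matrix_inv ?M) $ k $ j * (p \<bullet> ?T j))"
      by (simp add: matrix_matrix_mult_def)
    also have "\<dots> = p \<bullet> ?T k" unfolding inv by (simp add: mat_def if_distrib[of "\<lambda>x. x * _"] cong: if_cong)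
    finally show ?thesis .
  qed
  \<comment> \<open>The rows of a square matrix: two tangents and the normal. They are independent,
    so \<open>w\<close>, which is orthogonal to each of them, vanishes.\<close>
  define b where "b = (\<lambda>i::3. if i = 1 then ?T 1 else if i = 2 then ?T 2 else n)"
  define w where "w = q - (p - (p \<bullet> n) *\<^sub>R n)"
  have wT: "w \<bullet> ?T i = 0" and wn: "w \<bullet> n = 0" for i
    unfolding w_def using qT[of i] qn nn nT[of i] by (auto simp: inner_diff_left)
  let ?A = "\<chi> i. b i"
  have "invertible ?A"
  proof -
    have "c i = 0" if "(\<Sum>i\<in>UNIV. c i *s row i ?A) = 0" for c i
    proof -
      have "row i ?A = b i" for i by (simp add: row_def)
      then have *: "c 1 *\<^sub>R ?T 1 + c 2 *\<^sub>R ?T 2 + c 3 *\<^sub>R n = 0"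
        using that by (simp add: sum_3 b_def scalar_mult_eq_scaleR)
      then have "n \<bullet> (c 1 *\<^sub>R ?T 1 + c 2 *\<^sub>R ?T 2 + c 3 *\<^sub>R n) = 0" by simp
      then have c3: "c 3 = 0" using nT nn by (simp add: inner_add_right)
      have "(vector [c 1, c 2] :: real^2) = 0"
        by (rule T0) (use * c3 in \<open>simp add: sum_2\<close>)
      then have "c 1 = 0" "c 2 = 0" by (metis vector_2 zero_index)+
      then show ?thesis using c3 exhaust_3[of i] by auto
    qed
    then show ?thesis
      using matrix_right_invertible_independent_rows invertible_right_inverse by blast
  qed
  moreover have "?A *v w = 0"
    using wT wn by (simp add: vec_eq_iff matrix_vector_mult_def b_def inner_vec_def mult.commute)
  ultimately have "w = 0" by (metis invertible_left_inverse matrix_left_invertible_ker)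
  then show ?thesis by (simp add: w_def q_def n_def)
qed


text \<open>The one-sided trace of \<open>\<phi>\<close> along the surface is differentiated without extending \<open>\<phi>\<close> across it:
  the surface is shifted by \<open>\<delta> a\<close> into \<open>S\<close>, and \<open>\<delta>\<close> tends to \<open>0\<close> in the mean value estimate.\<close>

lemma trace_tangential_derivative:
  fixes \<phi> :: "real \<Rightarrow> real^3 \<Rightarrow> real" and f :: "real^2 \<Rightarrow> real"
  assumes G: "evolving_interface G" and t: "t \<in> {0..<Tf G}" and s: "s \<in> params G"
    and S: "S \<in> {liquid G t, vapor G t}"
    and \<phi>: "\<And>x. x \<in> S \<Longrightarrow> \<phi> t differentiable (at x)" and tr: "has_traces G \<phi>"
    and f: "\<And>s'. s' \<in> params G \<Longrightarrow> f s' = one_sided S (\<phi> t) (chart G t s')" "f differentiable (at s)"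
  shows "frechet_derivative f (at s) e
    = one_sided S (grad (\<phi> t)) (chart G t s) \<bullet> frechet_derivative (chart G t) (at s) e"
proof -
  note E = evolving_interfaceD[OF G t]
  define c where "c = chart G t"
  define x where "x = c s"
  define p where "p = one_sided S (grad (\<phi> t)) x"
  define D where "D = (\<lambda>y. frechet_derivative c (at y) e)"
  define g where "g = (\<lambda>h. f (s + h *\<^sub>R e))"
  have x: "x \<in> Gam G t" using E(6) s by (auto simp: x_def c_def)
  have cG: "c y \<in> Gam G t" if "y \<in> params G" for y using E(6) that by (auto simp: c_def)
  note notin = bulk_side(2)[OF G t S]
  obtain a r where r: "0 < r" and
    shift: "\<And>y \<delta>. y \<in> Gam G t \<Longrightarrow> y \<in> ball x r \<Longrightarrow> 0 < \<delta> \<Longrightarrow> \<delta> < r \<Longrightarrow> y + \<delta> *\<^sub>R a \<in> S" and a: "norm a = 1"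
    using shift_into_bulk[OF G t x S] by metis
  have Dg: "(g has_real_derivative frechet_derivative f (at s) e) (at 0)"
  proof -
    have 1: "((\<lambda>h. s + h *\<^sub>R e) has_derivative (\<lambda>h. h *\<^sub>R e)) (at 0)" by (auto intro!: derivative_eq_intros)
    have 2: "(f has_derivative frechet_derivative f (at s)) (at (s + 0 *\<^sub>R e))"
      using f(2) by (simp add: frechet_derivative_works)
    from diff_chain_at[OF 1 this] show ?thesis
      unfolding has_field_derivative_def g_def o_def
      by (rule has_derivative_eq_rhs) (simp add: fun_eq_iff linear_cmul[OF linear_frechet_derivative[OF f(2)]])
  qed
  have "((\<lambda>h. (g (0 + h) - g 0) / h) \<longlongrightarrow> p \<bullet> D s) (at 0)"
  proof (rule tendstoI)
    fix \<epsilon> :: real assume "0 < \<epsilon>"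
    \<comment> \<open>The margin \<open>\<epsilon> / 2\<close> is kept because the estimate survives
      the limit in \<open>\<delta>\<close> only as a non-strict inequality.\<close>
    have "isCont (\<lambda>z. fst z \<bullet> snd z) (p, D s)" by (intro continuous_intros)
    then obtain \<eta> where "0 < \<eta>" and "\<And>z. dist z (p, D s) < \<eta> \<Longrightarrow> dist (fst z \<bullet> snd z) (p \<bullet> D s) < \<epsilon> / 2"
      using \<open>0 < \<epsilon>\<close> unfolding continuous_at_eps_delta by (metis fst_conv snd_conv half_gt_zero)
    then have \<eta>: "\<bar>q \<bullet> d - p \<bullet> D s\<bar> < \<epsilon> / 2" if "dist q p < \<eta> / 2" "dist d (D s) < \<eta> / 2" for q d
    proof -
      have "dist (q, d) (p, D s) \<le> dist (q, d) (p, d) + dist (p, d) (p, D s)" by (rule dist_triangle)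
      also have "\<dots> < \<eta>" using that by (simp add: dist_Pair_Pair)
      finally show ?thesis
        using \<open>\<And>z. dist z (p, D s) < \<eta> \<Longrightarrow> dist (fst z \<bullet> snd z) (p \<bullet> D s) < \<epsilon> / 2\<close>[of "(q, d)"] by (simp add: dist_real_def)
    qed
    have "\<forall>\<^sub>F y in at x within S. dist (grad (\<phi> t) y) p < \<eta> / 2"
      unfolding p_def by (rule tendstoD[OF has_traces_grad_tendsto[OF G tr t x S]]) (use \<open>0 < \<eta>\<close> in simp)
    then obtain d1 where d1: "0 < d1" "\<And>y. y \<in> S \<Longrightarrow> dist y x < d1 \<Longrightarrow> dist (grad (\<phi> t) y) p < \<eta> / 2"
      unfolding eventually_at using notin[OF x] by metis
    have "isCont D s" using E(9)[of e] E(3) s by (simp add: D_def c_def continuous_on_eq_continuous_at)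
    moreover have "isCont c s"
      using E(8)[OF s] by (simp add: c_def differentiable_imp_continuous_within)
    ultimately have lim: "(D \<longlongrightarrow> D s) (nhds s)" "(c \<longlongrightarrow> x) (nhds s)"
      by (simp_all add: x_def isCont_def tendsto_at_iff_tendsto_nhds)
    have "\<forall>\<^sub>F y in nhds s. y \<in> params G \<and> dist (D y) (D s) < \<eta> / 2 \<and> dist (c y) x < min r (d1 / 2)"
      using E(3) s \<open>0 < \<eta>\<close> r d1(1)
      by (intro eventually_conj tendstoD[OF lim(1)] tendstoD[OF lim(2)]) (auto simp: eventually_nhds_in_open)
    \<comment> \<open>Within \<open>d2\<close> of \<open>s\<close> the tangent vector is nearly
      constant and the surface point is within \<open>d1 / 2\<close> of \<open>x\<close>. The
      remaining \<open>d1 / 2\<close> is the allowance for the shift.\<close>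
    then obtain d2 where "0 < d2" and d2: "\<And>y. dist y s < d2 \<Longrightarrow>
        y \<in> params G \<and> dist (D y) (D s) < \<eta> / 2 \<and> dist (c y) x < min r (d1 / 2)"
      unfolding eventually_nhds_metric by metis
    have "((\<lambda>h. \<bar>h\<bar> * norm e) \<longlongrightarrow> \<bar>0\<bar> * norm e) (at 0)" by (intro tendsto_intros)
    then have "\<forall>\<^sub>F h in at 0. \<bar>h\<bar> * norm e < d2" using \<open>0 < d2\<close> by (intro order_tendstoD(2)) auto
    moreover have "\<forall>\<^sub>F h in at (0::real). h \<noteq> 0" by (simp add: eventually_at_filter)
    ultimately show "\<forall>\<^sub>F h in at 0. dist ((g (0 + h) - g 0) / h) (p \<bullet> D s) < \<epsilon>"
    proof eventually_elim
      fix h :: real assume he: "\<bar>h\<bar> * norm e < d2" and h0: "h \<noteq> 0"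
      have near: "dist (s + (\<theta> * h) *\<^sub>R e) s < d2" if "0 \<le> \<theta>" "\<theta> \<le> 1" for \<theta>
      proof -
        have "dist (s + (\<theta> * h) *\<^sub>R e) s = \<theta> * (\<bar>h\<bar> * norm e)" using that by (simp add: dist_norm abs_mult)
        also have "\<dots> \<le> \<bar>h\<bar> * norm e" using that by (intro mult_left_le_one_le) auto
        finally show ?thesis using he by simp
      qed
      \<comment> \<open>The bound is uniform in \<open>\<delta>\<close>: it comes from the mean
        value theorem on the shifted curve, which lies inside \<open>S\<close>, and involves the
        bulk gradient only near \<open>x\<close>.\<close>
      have bound: "\<bar>\<phi> t (c (s + h *\<^sub>R e) + \<delta> *\<^sub>R a) - \<phi> t (c s + \<delta> *\<^sub>R a) - h * (p \<bullet> D s)\<bar> \<le> \<bar>h\<bar> * (\<epsilon> / 2)"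
        if \<delta>: "0 < \<delta>" "\<delta> < min r (d1 / 2)" for \<delta>
      proof -
        let ?y = "\<lambda>\<theta>. s + (\<theta> * h) *\<^sub>R e"
        have inS: "c (?y \<theta>) + \<delta> *\<^sub>R a \<in> S" and dx: "dist (c (?y \<theta>) + \<delta> *\<^sub>R a) x < d1"
          if "0 \<le> \<theta>" "\<theta> \<le> 1" for \<theta>
        proof -
          have cy: "?y \<theta> \<in> params G" "dist (c (?y \<theta>)) x < min r (d1 / 2)" using d2[OF near[OF that]] by auto
          show "c (?y \<theta>) + \<delta> *\<^sub>R a \<in> S" by (rule shift) (use cG[OF cy(1)] cy(2) \<delta> in \<open>auto simp: dist_commute\<close>)
          have "dist (c (?y \<theta>) + \<delta> *\<^sub>R a) x \<le> dist (c (?y \<theta>) + \<delta> *\<^sub>R a) (c (?y \<theta>)) + dist (c (?y \<theta>)) x"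
            by (rule dist_triangle)
          also have "\<dots> < d1" using cy(2) \<delta> a by (simp add: dist_norm)
          finally show "dist (c (?y \<theta>) + \<delta> *\<^sub>R a) x < d1" .
        qed
        have "((\<lambda>\<theta>. \<phi> t (c (?y \<theta>) + \<delta> *\<^sub>R a)) has_real_derivative
            grad (\<phi> t) (c (?y \<theta>) + \<delta> *\<^sub>R a) \<bullet> D (?y \<theta>) * h) (at \<theta>)"
          if \<theta>: "0 \<le> \<theta>" "\<theta> \<le> 1" for \<theta>
        proof -
          have 1: "(?y has_derivative (\<lambda>k. k *\<^sub>R (h *\<^sub>R e))) (at \<theta>)"
            by (auto intro!: derivative_eq_intros)
          have lin: "c differentiable (at (?y \<theta>))" using E(8) d2[OF near[OF \<theta>]] by (simp add: c_def)
          then have 2: "(c has_derivative frechet_derivative c (at (?y \<theta>))) (at (?y \<theta>))"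
            by (simp add: frechet_derivative_works)
          have "((\<lambda>\<theta>. c (?y \<theta>) + \<delta> *\<^sub>R a) has_derivative (\<lambda>k. frechet_derivative c (at (?y \<theta>)) (k *\<^sub>R (h *\<^sub>R e)))) (at \<theta>)"
            using has_derivative_add[OF diff_chain_at[OF 1 2] has_derivative_const[of "\<delta> *\<^sub>R a"]] by (simp add: o_def)
          from diff_chain_at[OF this has_derivative_grad[OF \<phi>[OF inS[OF \<theta>]]]]
          show ?thesis
            unfolding has_field_derivative_def o_def
            by (rule has_derivative_eq_rhs)
               (simp add: fun_eq_iff D_def linear_cmul[OF linear_frechet_derivative[OF lin]])
        qed
        then obtain \<theta> where \<theta>: "0 < \<theta>" "\<theta> < 1"
          "\<phi> t (c (?y 1) + \<delta> *\<^sub>R a) - \<phi> t (c (?y 0) + \<delta> *\<^sub>R a)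
            = (1 - 0) * (grad (\<phi> t) (c (?y \<theta>) + \<delta> *\<^sub>R a) \<bullet> D (?y \<theta>) * h)"
          using MVT2[of 0 1 "\<lambda>\<theta>. \<phi> t (c (?y \<theta>) + \<delta> *\<^sub>R a)"
              "\<lambda>\<theta>. grad (\<phi> t) (c (?y \<theta>) + \<delta> *\<^sub>R a) \<bullet> D (?y \<theta>) * h"] by auto
        have "\<bar>grad (\<phi> t) (c (?y \<theta>) + \<delta> *\<^sub>R a) \<bullet> D (?y \<theta>) - p \<bullet> D s\<bar> < \<epsilon> / 2"
          using \<theta>(1,2) by (intro \<eta> d1(2) inS dx) (use d2[OF near[of \<theta>]] in auto)
        then have "\<bar>h\<bar> * \<bar>grad (\<phi> t) (c (?y \<theta>) + \<delta> *\<^sub>R a) \<bullet> D (?y \<theta>) - p \<bullet> D s\<bar> \<le> \<bar>h\<bar> * (\<epsilon> / 2)"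
          by (intro mult_left_mono) auto
        then show ?thesis using \<theta>(3) by (simp add: abs_mult[symmetric] right_diff_distrib mult.commute)
      qed
      \<comment> \<open>Along the shift the bulk values converge to the trace at the unshifted
        point, so both end values of the estimate converge to values of \<open>f\<close>.\<close>
      have lim: "((\<lambda>\<delta>. \<phi> t (c y + \<delta> *\<^sub>R a)) \<longlongrightarrow> f y) (at_right 0)" if "dist y s < d2" for y
      proof -
        have y: "y \<in> params G" "c y \<in> ball x r" using d2[OF that] by (auto simp: dist_commute)
        have "f y = one_sided S (\<phi> t) (c y)" using f(1)[OF y(1)] by (simp add: c_def)
        then show ?thesis
          using filterlim_compose[OF has_traces_tendsto[OF G tr t cG[OF y(1)] S]
              shift_tendsto[OF notin[OF cG[OF y(1)]] r shift[OF cG[OF y(1)] y(2)]]] by simp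
      qed
      have "((\<lambda>\<delta>. \<bar>\<phi> t (c (s + h *\<^sub>R e) + \<delta> *\<^sub>R a) - \<phi> t (c s + \<delta> *\<^sub>R a) - h * (p \<bullet> D s)\<bar>)
          \<longlongrightarrow> \<bar>g h - g 0 - h * (p \<bullet> D s)\<bar>) (at_right 0)"
        unfolding g_def using lim[of "s + h *\<^sub>R e"] lim[of s] near[of 1] \<open>0 < d2\<close>
        by (intro tendsto_intros) auto
      moreover have "\<forall>\<^sub>F \<delta> in at_right 0.
          \<bar>\<phi> t (c (s + h *\<^sub>R e) + \<delta> *\<^sub>R a) - \<phi> t (c s + \<delta> *\<^sub>R a) - h * (p \<bullet> D s)\<bar> \<le> \<bar>h\<bar> * (\<epsilon> / 2)"
      proof -
        have "\<forall>\<^sub>F \<delta> in at_right 0. \<delta> \<in> {0<..<min r (d1 / 2)}"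
          by (rule eventually_at_right_real) (use r d1(1) in simp)
        then show ?thesis by eventually_elim (rule bound, auto)
      qed
      ultimately have "\<bar>g h - g 0 - h * (p \<bullet> D s)\<bar> \<le> \<bar>h\<bar> * (\<epsilon> / 2)"
        by (rule tendsto_upperbound) simp
      moreover have "dist ((g (0 + h) - g 0) / h) (p \<bullet> D s) = \<bar>g h - g 0 - h * (p \<bullet> D s)\<bar> / \<bar>h\<bar>"
        using h0 by (simp add: dist_real_def abs_divide[symmetric] diff_divide_distrib)
      ultimately have "dist ((g (0 + h) - g 0) / h) (p \<bullet> D s) \<le> \<epsilon> / 2"
        using h0 by (simp add: divide_le_eq mult.commute)
      then show "dist ((g (0 + h) - g 0) / h) (p \<bullet> D s) < \<epsilon>" using \<open>0 < \<epsilon>\<close> by simp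
    qed
  qed
  then have "(g has_real_derivative p \<bullet> D s) (at 0)" by (simp add: DERIV_def)
  from DERIV_unique[OF Dg this] show ?thesis by (simp add: p_def D_def c_def x_def)
qed

lemma surf_grad_trace:
  fixes \<phi> :: "real \<Rightarrow> real^3 \<Rightarrow> real" and f :: "real^2 \<Rightarrow> real"
  assumes "evolving_interface G" "t \<in> {0..<Tf G}" "s \<in> params G" "S \<in> {liquid G t, vapor G t}"
    and "\<And>x. x \<in> S \<Longrightarrow> \<phi> t differentiable (at x)" "has_traces G \<phi>"
    and "\<And>s'. s' \<in> params G \<Longrightarrow> f s' = one_sided S (\<phi> t) (chart G t s')" "f differentiable (at s)"
    and "x = chart G t s" "p = one_sided S (grad (\<phi> t)) x"
  shows "surf_grad G t f s = p - (p \<bullet> nu G t x) *\<^sub>R nu G t x"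
  unfolding assms(9,10)
  by (rule surf_grad_projection[OF assms(1-3) trace_tangential_derivative[OF assms(1-8)]])

lemma has_real_derivative_deriv:
  "(f has_real_derivative D) (at z) \<Longrightarrow> (f has_real_derivative deriv f z) (at z)"
  by (simp add: DERIV_imp_deriv)

text \<open>\<open>deriv f z = 0\<close> acquires its meaning from any witness of differentiability;
  the value of \<open>D\<close> is immaterial.\<close>

lemma has_real_derivative_zero:
  assumes "(f has_real_derivative D) (at z)" "deriv f z = 0"
  shows "(f has_real_derivative 0) (at z)"
  using has_real_derivative_deriv[OF assms(1)] assms(2) by simp

section \<open>The inner profile across the interface\<close>

text \<open>The inner equations at one point of the interface; \<open>g\<close> is the surface gradient of \<open>\<Phi>\<^sub>0\<close>. The far field
  values are indexed by the filter \<open>Z\<close>, which is \<open>at_top\<close> on the liquid and \<open>at_bot\<close> on the vapor side.\<close>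

locale inner_profile =
  fixes P :: fluid_data and R R1 :: "nat \<Rightarrow> real \<Rightarrow> real" and V :: "real \<Rightarrow> real^3"
    and X X1 \<Phi>1 :: "real \<Rightarrow> real" and n g :: "real^3" and w \<kappa> :: real
    and \<sigma> d :: "real filter \<Rightarrow> real" and r m :: "real filter \<Rightarrow> nat \<Rightarrow> real" and u :: "real filter \<Rightarrow> real^3"
  assumes P: "fluid P"
    and R: "\<And>\<alpha>. \<alpha> \<in> {1..nc P} \<Longrightarrow> twice_differentiable (R \<alpha>)" "\<And>\<alpha> z. \<alpha> \<in> {1..nc P} \<Longrightarrow> 0 < R \<alpha> z"
    and R1: "\<And>\<alpha>. \<alpha> \<in> {1..nc P} \<Longrightarrow> twice_differentiable (R1 \<alpha>)"
    and V: "\<And>z. (V has_vector_derivative vector_derivative V (at z)) (at z)"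
    and X: "twice_differentiable X" and X1: "twice_differentiable X1" and \<Phi>1: "twice_differentiable \<Phi>1"
    and n: "n \<bullet> n = 1"
    and diffusion: "\<And>\<alpha> z. \<alpha> \<in> {1..nc P - 1} \<Longrightarrow> deriv (\<lambda>z. \<Sum>\<beta>=1..nc P - 1. diff_mob P \<alpha> \<beta> *
        deriv (\<lambda>z. mu P \<beta> (\<lambda>\<alpha>. R \<alpha> z) (X z) - mu P (nc P) (\<lambda>\<alpha>. R \<alpha> z) (X z)) z) z = 0"
    and profile: "\<And>z. cap P * deriv (deriv X) z = deriv dwell (X z)"
    and mass: "\<And>z. deriv (\<lambda>z. (\<Sum>\<alpha>=1..nc P. R \<alpha> z) * (V z \<bullet> n - w)) z = 0"
    and momentum: "\<And>z. 0 = ((\<Sum>\<alpha>=1..nc P. R \<alpha> z) * (V z \<bullet> n - w)) *\<^sub>R vector_derivative V (at z)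
        + (deriv (\<lambda>z. (\<Sum>\<alpha>=1..nc P. R \<alpha> z * mu P \<alpha> (\<lambda>\<alpha>. R \<alpha> z) (X z)) - rhof P (\<lambda>\<alpha>. R \<alpha> z) (X z)
              - deriv dwell (X z) * X1 z) z
          + cap P * (deriv X z * deriv (deriv X1) z + deriv (deriv X) z * deriv X1 z - \<kappa> * (deriv X z)\<^sup>2)
          + eps0 P / 2 * ((deriv \<Phi>1 z)\<^sup>2 + (norm g)\<^sup>2) * deriv (\<lambda>z. 1 + sus P (X z)) z) *\<^sub>R n"
    and phase: "\<And>z. 0 = ((\<Sum>\<alpha>=1..nc P. R \<alpha> z) * (V z \<bullet> n - w)) / relax P * deriv X z
        + deriv (deriv dwell) (X z) * X1 z - cap P * deriv (deriv X1) z + cap P * \<kappa> * deriv X z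
        + drhof_dchi P (\<lambda>\<alpha>. R \<alpha> z) (X z)
        - eps0 P / 2 * deriv (sus P) (X z) * ((deriv \<Phi>1 z)\<^sup>2 + (norm g)\<^sup>2)"
    and charge: "\<And>z. deriv (\<lambda>z. (1 + sus P (X z)) * deriv \<Phi>1 z) z = 0"
    and species: "\<And>\<alpha> z. \<alpha> \<in> {1..nc P - 1} \<Longrightarrow> 0 = deriv (\<lambda>z. R \<alpha> z * (V z \<bullet> n - w)) z
        - (\<Sum>\<beta>=1..nc P - 1. diff_mob P \<alpha> \<beta> *
            (deriv (deriv (\<lambda>z.
                ((\<Sum>\<alpha>=1..nc P. dmu_drho P \<beta> \<alpha> (\<lambda>\<alpha>. R \<alpha> z) (X z) * R1 \<alpha> z) + dmu_dchi P \<beta> (\<lambda>\<alpha>. R \<alpha> z) (X z) * X1 z)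
              - ((\<Sum>\<alpha>=1..nc P. dmu_drho P (nc P) \<alpha> (\<lambda>\<alpha>. R \<alpha> z) (X z) * R1 \<alpha> z) + dmu_dchi P (nc P) (\<lambda>\<alpha>. R \<alpha> z) (X z) * X1 z))) z
            - \<kappa> * deriv (\<lambda>z. mu P \<beta> (\<lambda>\<alpha>. R \<alpha> z) (X z) - mu P (nc P) (\<lambda>\<alpha>. R \<alpha> z) (X z)) z
            + zm P \<beta> * deriv (deriv \<Phi>1) z))"
    and \<sigma>: "\<sigma> at_top = 1" "\<sigma> at_bot = - 1"
    and r: "\<And>Z \<alpha>. Z \<in> {at_top, at_bot} \<Longrightarrow> \<alpha> \<in> {1..nc P} \<Longrightarrow> (R \<alpha> \<longlongrightarrow> r Z \<alpha>) Z"
      "\<And>Z \<alpha>. Z \<in> {at_top, at_bot} \<Longrightarrow> \<alpha> \<in> {1..nc P} \<Longrightarrow> 0 < r Z \<alpha>"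
    and M0: "\<And>Z \<alpha>. Z \<in> {at_top, at_bot} \<Longrightarrow> \<alpha> \<in> {1..nc P} \<Longrightarrow>
      (deriv (\<lambda>z. mu P \<alpha> (\<lambda>\<alpha>. R \<alpha> z) (X z)) \<longlongrightarrow> 0) Z"
    and m: "\<And>Z \<beta>. Z \<in> {at_top, at_bot} \<Longrightarrow> \<beta> \<in> {1..nc P} \<Longrightarrow>
      (deriv (\<lambda>z. (\<Sum>\<alpha>=1..nc P. dmu_drho P \<beta> \<alpha> (\<lambda>\<alpha>. R \<alpha> z) (X z) * R1 \<alpha> z)
        + dmu_dchi P \<beta> (\<lambda>\<alpha>. R \<alpha> z) (X z) * X1 z) \<longlongrightarrow> m Z \<beta>) Z"
    and u: "\<And>Z. Z \<in> {at_top, at_bot} \<Longrightarrow> (V \<longlongrightarrow> u Z) Z"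
    and X_lim: "\<And>Z. Z \<in> {at_top, at_bot} \<Longrightarrow> (X \<longlongrightarrow> \<sigma> Z) Z" "\<And>Z. Z \<in> {at_top, at_bot} \<Longrightarrow> (deriv X \<longlongrightarrow> 0) Z"
    and X1_lim: "\<And>Z. Z \<in> {at_top, at_bot} \<Longrightarrow> (X1 \<longlongrightarrow> 0) Z" "\<And>Z. Z \<in> {at_top, at_bot} \<Longrightarrow> (deriv X1 \<longlongrightarrow> 0) Z"
    and d: "\<And>Z. Z \<in> {at_top, at_bot} \<Longrightarrow> (deriv \<Phi>1 \<longlongrightarrow> d Z) Z"
begin

definition Rt :: "real \<Rightarrow> real" where "Rt z = (\<Sum>\<alpha>=1..nc P. R \<alpha> z)"
definition M :: "nat \<Rightarrow> real \<Rightarrow> real" where "M \<beta> z = mu P \<beta> (\<lambda>\<alpha>. R \<alpha> z) (X z)"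
text \<open>The first-order chemical potential of the inner expansion, that is, the linearization of
  \<open>mu\<close> in the direction \<open>(R1, X1)\<close>. The prime marks the order and is not a
  derivative in \<open>z\<close>.\<close>

definition M' :: "nat \<Rightarrow> real \<Rightarrow> real" where
  "M' \<beta> z = (\<Sum>\<alpha>=1..nc P. dmu_drho P \<beta> \<alpha> (\<lambda>\<alpha>. R \<alpha> z) (X z) * R1 \<alpha> z) + dmu_dchi P \<beta> (\<lambda>\<alpha>. R \<alpha> z) (X z) * X1 z"
definition E :: "real \<Rightarrow> real" where "E z = 1 + sus P (X z)"
definition N :: "real \<Rightarrow> real" where "N z = ndens P (\<lambda>\<alpha>. R \<alpha> z)"
definition K :: "real \<Rightarrow> real" where "K z = bulk_mod P (X z)"
definition flux :: "real filter \<Rightarrow> real" where "flux Z = (\<Sum>\<alpha>=1..nc P. r Z \<alpha>) * (u Z \<bullet> n - w)"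

lemma N_pos: "0 < N z"
  unfolding N_def by (rule ndens_pos[OF P R(2)])

lemma Rt_pos: "0 < Rt z"
  unfolding Rt_def using fluidD(1)[OF P] by (intro sum_pos R(2)) auto

lemma last_in: "nc P \<in> {1..nc P}" and pred_in: "\<beta> \<in> {1..nc P - 1} \<Longrightarrow> \<beta> \<in> {1..nc P}"
  using fluidD(1)[OF P] by auto

lemma Rt_td: "twice_differentiable Rt"
  unfolding Rt_def[abs_def] by (intro twice_differentiable_sum R(1))

lemma N_td: "twice_differentiable N"
  unfolding N_def[abs_def] ndens_def by (intro twice_differentiable_sum twice_differentiable_divide_const R(1))

lemma K_td: "twice_differentiable K"
  unfolding K_def[abs_def] by (rule twice_differentiable_compose[OF bulk_mod_twice_differentiable[OF P] X])

lemma E_td: "twice_differentiable E"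
  unfolding E_def[abs_def]
  by (intro twice_differentiable_add twice_differentiable_const twice_differentiable_compose[OF sus_twice_differentiable[OF P] X])

lemma M_eq:
  assumes "\<beta> \<in> {1..nc P}"
  shows "M \<beta> z = chem_pot P (K z) \<beta> (\<lambda>\<alpha>. R \<alpha> z)"
  unfolding M_def K_def by (rule mu_eq[OF P R(2) assms])

lemma ln_N_td: "twice_differentiable (\<lambda>z. ln (N z / nref P))"
  using N_pos fluidD(15)[OF P] by (intro twice_differentiable_ln twice_differentiable_divide_const N_td) simp

lemma M_td:
  assumes "\<beta> \<in> {1..nc P}"
  shows "twice_differentiable (M \<beta>)"
proof -
  have "twice_differentiable (\<lambda>z. R \<beta> z / mass P \<beta> / N z)"
    unfolding divide_inverse[of _ "N _"]
    by (intro twice_differentiable_mult twice_differentiable_divide_const twice_differentiable_inverse N_td R(1) assms)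
       (metis N_pos less_irrefl)
  then have "twice_differentiable (\<lambda>z. ln (R \<beta> z / mass P \<beta> / N z))"
    using N_pos R(2)[OF assms] fluidD(2)[OF P assms] by (intro twice_differentiable_ln) auto
  then have "twice_differentiable (\<lambda>z. chem_pot P (K z) \<beta> (\<lambda>\<alpha>. R \<alpha> z))"
    unfolding chem_pot_def N_def[symmetric]
    by (intro twice_differentiable_add twice_differentiable_mult twice_differentiable_divide_const
        twice_differentiable_const K_td ln_N_td)
  moreover have "M \<beta> = (\<lambda>z. chem_pot P (K z) \<beta> (\<lambda>\<alpha>. R \<alpha> z))" using M_eq[OF assms] by auto
  ultimately show ?thesis by simp
qed

text \<open>The species equation differentiates \<open>M'\<close> twice. The factor
  \<open>h'(X)\<close> in \<open>dmu_dchi\<close> requires the smoothness of \<open>h\<close> beyond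
  its second derivative here.\<close>

lemma M'_td:
  assumes "\<beta> \<in> {1..nc P}"
  shows "twice_differentiable (M' \<beta>)"
proof -
  have iN: "twice_differentiable (\<lambda>z. inverse (N z))"
    by (rule twice_differentiable_inverse[OF N_td]) (metis N_pos less_irrefl)
  have iR: "twice_differentiable (\<lambda>z. inverse (R \<beta> z))"
    by (rule twice_differentiable_inverse[OF R(1)[OF assms]]) (metis R(2)[OF assms] less_irrefl)
  have "twice_differentiable (\<lambda>z. dmu_drho P \<beta> \<alpha> (\<lambda>\<alpha>. R \<alpha> z) (X z))" if "\<alpha> \<in> {1..nc P}" for \<alpha>
  proof -
    have "dmu_drho P \<beta> \<alpha> (\<lambda>\<alpha>. R \<alpha> z) (X z) = K z / (mass P \<beta> * nref P) * (1 / mass P \<alpha> * inverse (N z))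
     + boltz P * temp P / mass P \<beta> * ((if \<alpha> = \<beta> then 1 else 0) * inverse (R \<beta> z) - 1 / mass P \<alpha> * inverse (N z))" for z
      unfolding K_def N_def by (rule dmu_drho_eq[OF P R(2) that assms])
    then show ?thesis
    by (simp only:) (intro twice_differentiable_add twice_differentiable_diff twice_differentiable_mult
        twice_differentiable_divide_const twice_differentiable_const K_td iN iR)
  qed
  moreover have "twice_differentiable (\<lambda>z. dmu_dchi P \<beta> (\<lambda>\<alpha>. R \<alpha> z) (X z))"
  proof -
    have "dmu_dchi P \<beta> (\<lambda>\<alpha>. R \<alpha> z) (X z) = deriv (hint P) (X z) * (bulkL P - bulkV P) / (mass P \<beta> * nref P)
        * ln (N z / nref P)" for z
      unfolding N_def by (rule dmu_dchi_eq[OF P R(2) assms])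
    then show ?thesis
    by (simp only:) (intro twice_differentiable_mult twice_differentiable_divide_const twice_differentiable_const ln_N_td
        twice_differentiable_compose[OF hint_twice_differentiable(2)[OF P] X])
  qed
  ultimately show ?thesis
    unfolding M'_def[abs_def] by (intro twice_differentiable_add twice_differentiable_sum twice_differentiable_mult R1 X1)
qed

lemma M_lim:
  assumes Z: "Z \<in> {at_top, at_bot}" and \<beta>: "\<beta> \<in> {1..nc P}"
  shows "(M \<beta> \<longlongrightarrow> mu P \<beta> (r Z) (\<sigma> Z)) Z"
  unfolding M_def[abs_def] by (rule mu_tendsto[OF P \<beta> r(1)[OF Z] r(2)[OF Z] _ X_lim(1)[OF Z]]) (use R(2) in auto)

lemma Rt_lim:
  assumes Z: "Z \<in> {at_top, at_bot}"
  shows "(Rt \<longlongrightarrow> (\<Sum>\<alpha>=1..nc P. r Z \<alpha>)) Z"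
  unfolding Rt_def[abs_def] by (intro tendsto_sum r(1) Z)

lemma r_sum_pos:
  assumes Z: "Z \<in> {at_top, at_bot}"
  shows "0 < (\<Sum>\<alpha>=1..nc P. r Z \<alpha>)"
  using fluidD(1)[OF P] by (intro sum_pos r(2)[OF Z]) auto

lemma E_lim:
  assumes Z: "Z \<in> {at_top, at_bot}"
  shows "(E \<longlongrightarrow> 1 + sus P (\<sigma> Z)) Z"
  unfolding E_def[abs_def]
  by (intro tendsto_intros isCont_tendsto_compose[OF DERIV_isCont[OF twice_differentiable_deriv(1)[OF
        sus_twice_differentiable[OF P]]] X_lim(1)[OF Z]])

section \<open>Inner quantities that are constant in the stretched coordinate\<close>

text \<open>Each diffusion flux is constant in \<open>z\<close> and tends to 0 by matching, hence is
  identically 0. Definiteness of the mobility matrix then annihilates every difference of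
  derivatives separately.\<close>

lemma M_deriv_eq:
  assumes \<beta>: "\<beta> \<in> {1..nc P - 1}"
  shows "deriv (M \<beta>) z = deriv (M (nc P)) z"
proof -
  let ?D = "\<lambda>\<beta> z. deriv (M \<beta>) z - deriv (M (nc P)) z"
  note td = twice_differentiable_deriv[OF M_td]
  have eq: "deriv (\<lambda>z. M \<beta> z - M (nc P) z) = ?D \<beta>" if "\<beta> \<in> {1..nc P - 1}" for \<beta>
    using DERIV_diff[OF td(1)[OF pred_in[OF that]] td(1)[OF last_in]] by (auto intro: DERIV_imp_deriv)
  have "(\<Sum>\<beta>=1..nc P - 1. diff_mob P \<alpha> \<beta> * ?D \<beta> z) = 0" if \<alpha>: "\<alpha> \<in> {1..nc P - 1}" for \<alpha>
  proof -
    let ?S = "\<lambda>z. \<Sum>\<beta>=1..nc P - 1. diff_mob P \<alpha> \<beta> * ?D \<beta> z"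
    have S: "?S = (\<lambda>z. \<Sum>\<beta>=1..nc P - 1. diff_mob P \<alpha> \<beta> * deriv (\<lambda>z. M \<beta> z - M (nc P) z) z)"
      by (intro ext sum.cong refl) (simp only: eq)
    have 1: "(?S has_real_derivative (\<Sum>\<beta>=1..nc P - 1. diff_mob P \<alpha> \<beta> * (deriv (deriv (M \<beta>)) z - deriv (deriv (M (nc P))) z))) (at z)" for z
      by (intro DERIV_sum DERIV_cmult DERIV_diff td(2) pred_in last_in)
    have 2: "deriv ?S z = 0" for z using diffusion[OF \<alpha>, of z] unfolding S M_def .
    have 3: "(?S has_real_derivative 0) (at z)" for z by (rule has_real_derivative_zero[OF 1 2])
    have 4: "(?S \<longlongrightarrow> (\<Sum>\<beta>=1..nc P - 1. diff_mob P \<alpha> \<beta> * (0 - 0))) Z" if "Z \<in> {at_top, at_bot}" for Z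
      using M0[OF that, folded M_def] pred_in last_in by (intro tendsto_intros) auto
    show ?thesis using constant_of_deriv_zero(1)[OF 3 4[of at_top] 4[of at_bot], of z] by simp
  qed
  from diff_mob_injective[OF P this \<beta>] show ?thesis by simp
qed

lemma mu_jump:
  assumes \<beta>: "\<beta> \<in> {1..nc P - 1}"
  shows "mu P \<beta> (r at_top) 1 - mu P (nc P) (r at_top) 1 = mu P \<beta> (r at_bot) (-1) - mu P (nc P) (r at_bot) (-1)"
proof -
  let ?g = "\<lambda>z. M \<beta> z - M (nc P) z"
  have D: "(?g has_real_derivative 0) (at z)" for z
    using DERIV_diff[OF twice_differentiable_deriv(1)[OF M_td[OF pred_in[OF \<beta>]]] twice_differentiable_deriv(1)[OF M_td[OF last_in]]]
    by (simp add: M_deriv_eq[OF \<beta>])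
  have l: "(?g \<longlongrightarrow> mu P \<beta> (r Z) (\<sigma> Z) - mu P (nc P) (r Z) (\<sigma> Z)) Z" if "Z \<in> {at_top, at_bot}" for Z
    by (intro tendsto_diff M_lim that pred_in[OF \<beta>] last_in)
  show ?thesis
    using constant_of_deriv_zero[OF D l[of at_top] l[of at_bot]] \<sigma> by simp
qed

lemma V_n_deriv: "((\<lambda>z. V z \<bullet> n - w) has_real_derivative vector_derivative V (at z) \<bullet> n) (at z)"
proof -
  have "((\<lambda>z. V z \<bullet> n) has_vector_derivative vector_derivative V (at z) \<bullet> n) (at z)"
    by (rule bounded_linear.has_vector_derivative[OF bounded_linear_inner_left V])
  then show ?thesis
    by (auto intro!: derivative_eq_intros simp: has_real_derivative_iff_has_vector_derivative)
qed

lemma flux_const: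
  shows "Rt z * (V z \<bullet> n - w) = flux at_top" and "flux at_bot = flux at_top"
proof -
  let ?j = "\<lambda>z. Rt z * (V z \<bullet> n - w)"
  have "deriv ?j z = 0" for z using mass[of z] unfolding Rt_def .
  then have D: "(?j has_real_derivative 0) (at z)" for z
    by (rule has_real_derivative_zero[OF DERIV_mult[OF twice_differentiable_deriv(1)[OF Rt_td] V_n_deriv]])
  have l: "(?j \<longlongrightarrow> flux Z) Z" if "Z \<in> {at_top, at_bot}" for Z
    unfolding flux_def by (intro tendsto_intros Rt_lim u that)
  note c = constant_of_deriv_zero[OF D l[of at_top] l[of at_bot]]
  show "?j z = flux at_top" using c(1) by simp
  show "flux at_bot = flux at_top" using c by simp
qed

lemma E_d_deriv: "((\<lambda>z. E z * deriv \<Phi>1 z) has_real_derivative 0) (at z)"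
proof -
  have "deriv (\<lambda>z. E z * deriv \<Phi>1 z) z = 0" using charge[of z] unfolding E_def .
  then show ?thesis
    by (rule has_real_derivative_zero[OF DERIV_mult[OF twice_differentiable_deriv(1)[OF E_td] twice_differentiable_deriv(2)[OF \<Phi>1]]])
qed

lemma displacement_jump: "(1 + sus P 1) * d at_top = (1 + sus P (-1)) * d at_bot"
proof -
  have l: "((\<lambda>z. E z * deriv \<Phi>1 z) \<longlongrightarrow> (1 + sus P (\<sigma> Z)) * d Z) Z" if "Z \<in> {at_top, at_bot}" for Z
    by (intro tendsto_intros E_lim d that)
  show ?thesis using constant_of_deriv_zero[OF E_d_deriv l[of at_top] l[of at_bot]] \<sigma> by simp
qed

lemma species_jump:
  assumes \<alpha>: "\<alpha> \<in> {1..nc P - 1}"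
  shows "r at_top \<alpha> * (u at_top \<bullet> n - w) - (\<Sum>\<beta>=1..nc P - 1. diff_mob P \<alpha> \<beta> * ((m at_top \<beta> - m at_top (nc P)) + zm P \<beta> * d at_top))
    = r at_bot \<alpha> * (u at_bot \<bullet> n - w) - (\<Sum>\<beta>=1..nc P - 1. diff_mob P \<alpha> \<beta> * ((m at_bot \<beta> - m at_bot (nc P)) + zm P \<beta> * d at_bot))"
proof -
  let ?f = "\<lambda>z. R \<alpha> z * (V z \<bullet> n - w)"
  let ?s = "\<lambda>z. \<Sum>\<beta>=1..nc P - 1. diff_mob P \<alpha> \<beta> * ((deriv (M' \<beta>) z - deriv (M' (nc P)) z) + zm P \<beta> * deriv \<Phi>1 z)"
  note td = twice_differentiable_deriv[OF M'_td]
  have f: "(?f has_real_derivative deriv ?f z) (at z)" for z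
    by (rule has_real_derivative_deriv[OF DERIV_mult[OF twice_differentiable_deriv(1)[OF R(1)[OF pred_in[OF \<alpha>]]] V_n_deriv]])
  have s: "(?s has_real_derivative (\<Sum>\<beta>=1..nc P - 1. diff_mob P \<alpha> \<beta> *
      ((deriv (deriv (M' \<beta>)) z - deriv (deriv (M' (nc P))) z) + zm P \<beta> * deriv (deriv \<Phi>1) z))) (at z)" for z
    by (intro DERIV_sum DERIV_cmult DERIV_diff DERIV_add td(2) twice_differentiable_deriv(2)[OF \<Phi>1] pred_in last_in)
  have eq1: "deriv (deriv (\<lambda>z. M' \<beta> z - M' (nc P) z)) z = deriv (deriv (M' \<beta>)) z - deriv (deriv (M' (nc P))) z"
    if "\<beta> \<in> {1..nc P - 1}" for \<beta> z
  proof -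
    have "deriv (\<lambda>z. M' \<beta> z - M' (nc P) z) = (\<lambda>z. deriv (M' \<beta>) z - deriv (M' (nc P)) z)"
      using DERIV_diff[OF td(1)[OF pred_in[OF that]] td(1)[OF last_in]] by (auto intro: DERIV_imp_deriv)
    then show ?thesis
      using DERIV_diff[OF td(2)[OF pred_in[OF that]] td(2)[OF last_in]] by (simp add: DERIV_imp_deriv)
  qed
  \<comment> \<open>This removes the curvature term of the species equation, the one term there that
    is not a total derivative by form alone.\<close>
  have eq2: "deriv (\<lambda>z. M \<beta> z - M (nc P) z) z = 0" if "\<beta> \<in> {1..nc P - 1}" for \<beta> z
    using DERIV_diff[OF twice_differentiable_deriv(1)[OF M_td[OF pred_in[OF that]]] twice_differentiable_deriv(1)[OF M_td[OF last_in]]]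
    by (simp add: M_deriv_eq[OF that] DERIV_imp_deriv)
  have "deriv ?f z = (\<Sum>\<beta>=1..nc P - 1. diff_mob P \<alpha> \<beta> *
      ((deriv (deriv (M' \<beta>)) z - deriv (deriv (M' (nc P))) z) + zm P \<beta> * deriv (deriv \<Phi>1) z))" for z
  proof -
    have "deriv ?f z = (\<Sum>\<beta>=1..nc P - 1. diff_mob P \<alpha> \<beta> * (deriv (deriv (\<lambda>z. M' \<beta> z - M' (nc P) z)) z
        - \<kappa> * deriv (\<lambda>z. M \<beta> z - M (nc P) z) z + zm P \<beta> * deriv (deriv \<Phi>1) z))"
      using species[OF \<alpha>, of z] unfolding M'_def M_def by (simp only: eq_iff_diff_eq_0[symmetric] eq_commute[of 0])
    also have "\<dots> = (\<Sum>\<beta>=1..nc P - 1. diff_mob P \<alpha> \<beta> *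
      ((deriv (deriv (M' \<beta>)) z - deriv (deriv (M' (nc P))) z) + zm P \<beta> * deriv (deriv \<Phi>1) z))"
      by (intro sum.cong refl) (simp only: eq1 eq2 mult_zero_right diff_zero)
    finally show ?thesis .
  qed
  then have D: "((\<lambda>z. ?f z - ?s z) has_real_derivative 0) (at z)" for z
    using DERIV_diff[OF f s, of z] by (simp only: diff_self)
  have l: "((\<lambda>z. ?f z - ?s z) \<longlongrightarrow> r Z \<alpha> * (u Z \<bullet> n - w) -
      (\<Sum>\<beta>=1..nc P - 1. diff_mob P \<alpha> \<beta> * ((m Z \<beta> - m Z (nc P)) + zm P \<beta> * d Z))) Z"
    if Z: "Z \<in> {at_top, at_bot}" for Z
    by (intro tendsto_intros r(1) u d Z pred_in[OF \<alpha>] m[OF Z, folded M'_def] pred_in last_in)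
  show ?thesis using constant_of_deriv_zero[OF D l[of at_top] l[of at_bot]] by simp
qed

section \<open>Momentum and energy balances across the profile\<close>

lemma X_deriv_square_integrable: "integrable lborel (\<lambda>z. (deriv X z)\<^sup>2)"
  using profile_integrable[OF X fluidD(3)[OF P] profile] X_lim[of at_top] X_lim[of at_bot] \<sigma> by simp

text \<open>The pressure along the profile, in the logarithm-free form of
  \<open>pressure_eq\<close>.\<close>

definition Pi :: "real \<Rightarrow> real" where "Pi z = pref P + K z * (N z / nref P - 1)"

lemma Pi_td: "twice_differentiable Pi"
  unfolding Pi_def[abs_def]
  by (intro twice_differentiable_add twice_differentiable_diff twice_differentiable_mult
      twice_differentiable_divide_const twice_differentiable_const K_td N_td)

lemma N_deriv: "deriv N z = ndens P (\<lambda>\<alpha>. deriv (R \<alpha>) z)"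
proof (rule DERIV_imp_deriv)
  show "(N has_real_derivative ndens P (\<lambda>\<alpha>. deriv (R \<alpha>) z)) (at z)"
    unfolding N_def[abs_def] ndens_def by (intro DERIV_sum DERIV_cdivide twice_differentiable_deriv(1) R(1))
qed

lemma K_deriv: "deriv K z = deriv (bulk_mod P) (X z) * deriv X z"
  unfolding K_def[abs_def]
  by (intro DERIV_imp_deriv DERIV_chain2 twice_differentiable_deriv(1) bulk_mod_twice_differentiable P X)

lemma M_deriv:
  assumes "\<beta> \<in> {1..nc P}"
  shows "deriv (M \<beta>) z = (deriv K z * ln (N z / nref P) + K z * (deriv N z / N z)) / (mass P \<beta> * nref P)
     + boltz P * temp P / mass P \<beta> * (deriv (R \<beta>) z / R \<beta> z - deriv N z / N z)"
proof (rule DERIV_imp_deriv)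
  have M: "M \<beta> = (\<lambda>z. chem_pot P (K z) \<beta> (\<lambda>\<alpha>. R \<alpha> z))" using M_eq[OF assms] by auto
  have N': "ndens P (\<lambda>\<alpha>. deriv (R \<alpha>) z * h) = deriv N z * h" for h
    using ndens_linear[of P h "\<lambda>\<alpha>. deriv (R \<alpha>) z"] by (simp add: N_deriv mult.commute)
  have D: "((\<lambda>z. chem_pot P (K z) \<beta> (\<lambda>\<alpha>. R \<alpha> z)) has_derivative
     (\<lambda>h. (deriv K z * h * ln (ndens P (\<lambda>\<beta>. R \<beta> z) / nref P)
             + K z * (ndens P (\<lambda>\<beta>. deriv (R \<beta>) z * h) / ndens P (\<lambda>\<beta>. R \<beta> z))) / (mass P \<beta> * nref P)
         + boltz P * temp P / mass P \<beta> * (deriv (R \<beta>) z * h / R \<beta> z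
             - ndens P (\<lambda>\<beta>. deriv (R \<beta>) z * h) / ndens P (\<lambda>\<beta>. R \<beta> z)))) (at z)"
    by (rule chem_pot_has_derivative[OF P _ assms])
       (use R(2) twice_differentiable_deriv(1)[OF R(1)] twice_differentiable_deriv(1)[OF K_td]
         in \<open>auto simp: has_field_derivative_def\<close>)
  have "((\<lambda>z. chem_pot P (K z) \<beta> (\<lambda>\<alpha>. R \<alpha> z)) has_real_derivative
     (deriv K z * ln (N z / nref P) + K z * (deriv N z / N z)) / (mass P \<beta> * nref P)
     + boltz P * temp P / mass P \<beta> * (deriv (R \<beta>) z / R \<beta> z - deriv N z / N z)) (at z)"
    unfolding has_field_derivative_def
    by (rule has_derivative_eq_rhs[OF D[folded N_def, unfolded N']]) (simp add: fun_eq_iff divide_inverse algebra_simps)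
  then show "(M \<beta> has_real_derivative (deriv K z * ln (N z / nref P) + K z * (deriv N z / N z)) / (mass P \<beta> * nref P)
     + boltz P * temp P / mass P \<beta> * (deriv (R \<beta>) z / R \<beta> z - deriv N z / N z)) (at z)"
    by (simp only: M)
qed

text \<open>Weighted by the densities, the mixing terms of the chemical potentials cancel, since the
  weighted density derivatives add up to the derivative of the number density. The term with
  \<open>drhof_dchi\<close> accounts for the bulk modulus changing along the profile.\<close>

lemma gibbs_duhem:
  "deriv Pi z + drhof_dchi P (\<lambda>\<alpha>. R \<alpha> z) (X z) * deriv X z = (\<Sum>\<alpha>=1..nc P. R \<alpha> z * deriv (M \<alpha>) z)"
proof -
  have nR: "0 < nref P" using fluidD[OF P] by simp
  have "(Pi has_real_derivative deriv K z * (N z / nref P - 1) + K z * (deriv N z / nref P)) (at z)"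
    unfolding Pi_def[abs_def]
    by (rule DERIV_cong[OF DERIV_add[OF DERIV_const DERIV_mult[OF twice_differentiable_deriv(1)[OF K_td]
          DERIV_diff[OF DERIV_cdivide[OF twice_differentiable_deriv(1)[OF N_td]] DERIV_const]]]]) simp
  then have 1: "deriv Pi z = deriv K z * (N z / nref P - 1) + K z * (deriv N z / nref P)"
    by (rule DERIV_imp_deriv)
  have 2: "drhof_dchi P (\<lambda>\<alpha>. R \<alpha> z) (X z) * deriv X z
      = deriv K z * (1 - N z / nref P + N z / nref P * ln (N z / nref P))"
    by (simp add: drhof_dchi_eq[OF P] K_deriv N_def)
  let ?a = "(deriv K z * ln (N z / nref P) + K z * (deriv N z / N z)) / nref P" and ?b = "deriv N z / N z"
  have "R \<alpha> z * deriv (M \<alpha>) z = R \<alpha> z / mass P \<alpha> * ?a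
      + boltz P * temp P * (deriv (R \<alpha>) z / mass P \<alpha> - R \<alpha> z / mass P \<alpha> * ?b)" if "\<alpha> \<in> {1..nc P}" for \<alpha>
  proof -
    have alg: "x * (a / (k * l) + c / k * (y / x - b)) = x / k * (a / l) + c * (y / k - x / k * b)"
      if "x \<noteq> 0" for x a k l c y b :: real
      using that by (simp add: divide_inverse algebra_simps)
    show ?thesis unfolding M_deriv[OF that] by (rule alg) (use R(2)[OF that, of z] in simp)
  qed
  then have "(\<Sum>\<alpha>=1..nc P. R \<alpha> z * deriv (M \<alpha>) z) = (\<Sum>\<alpha>=1..nc P. R \<alpha> z / mass P \<alpha> * ?a
      + boltz P * temp P * (deriv (R \<alpha>) z / mass P \<alpha> - R \<alpha> z / mass P \<alpha> * ?b))"
    by (intro sum.cong refl)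
  also have "\<dots> = N z * ?a + boltz P * temp P * (deriv N z - N z * ?b)"
    unfolding N_deriv unfolding N_def ndens_def
    by (simp only: sum.distrib sum_distrib_left[symmetric] sum_distrib_right[symmetric] sum_subtractf)
  also have "\<dots> = N z * ?a" using N_pos[of z] by simp
  finally have 3: "(\<Sum>\<alpha>=1..nc P. R \<alpha> z * deriv (M \<alpha>) z) = N z * ?a" .
  show ?thesis
    unfolding 1 2 3 using N_pos[of z] nR by (simp add: field_simps)
qed

lemma well_force_td: "twice_differentiable (\<lambda>z. deriv dwell (X z) * X1 z)"
  by (intro twice_differentiable_mult twice_differentiable_compose[OF twice_differentiable_deriv_dwell X] X1)

text \<open>The derivative of \<open>W'(X) X1\<close> is kept as a separate term: the momentum
  balance integrates it as it stands, whereas the energy balance expands it by the product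
  rule.\<close>

lemma Pi_deriv:
  "deriv (\<lambda>z. (\<Sum>\<alpha>=1..nc P. R \<alpha> z * mu P \<alpha> (\<lambda>\<alpha>. R \<alpha> z) (X z)) - rhof P (\<lambda>\<alpha>. R \<alpha> z) (X z)
      - deriv dwell (X z) * X1 z) z = deriv Pi z - deriv (\<lambda>z. deriv dwell (X z) * X1 z) z"
proof -
  have "(\<lambda>z. (\<Sum>\<alpha>=1..nc P. R \<alpha> z * mu P \<alpha> (\<lambda>\<alpha>. R \<alpha> z) (X z)) - rhof P (\<lambda>\<alpha>. R \<alpha> z) (X z)
      - deriv dwell (X z) * X1 z) = (\<lambda>z. Pi z - deriv dwell (X z) * X1 z)"
    by (intro ext arg_cong2[where f = "(-)"] refl)
       (simp only: pressure_eq[where \<rho> = "\<lambda>\<alpha>. R \<alpha> _", OF P R(2)] Pi_def K_def N_def)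
  then show ?thesis
    using DERIV_imp_deriv[OF DERIV_diff[OF twice_differentiable_deriv(1)[OF Pi_td] twice_differentiable_deriv(1)[OF well_force_td]]]
    by simp
qed

text \<open>The jump of the stress uses the momentum equation as a total derivative: since \<open>E \<Phi>\<^sub>1'\<close> is constant,
  \<open>E' \<Phi>\<^sub>1'\<^sup>2 = - (E \<Phi>\<^sub>1'\<^sup>2)'\<close>.\<close>

lemma momentum_jump:
  defines "B \<equiv> \<lambda>Z. flux at_top *\<^sub>R u Z + (pref P + bulk_mod P (\<sigma> Z) * (ndens P (r Z) / nref P - 1)) *\<^sub>R n
    + (eps0 P / 2 * (1 + sus P (\<sigma> Z)) * ((norm g)\<^sup>2 - (d Z)\<^sup>2)) *\<^sub>R n"
  shows "B at_top - B at_bot = (cap P * \<kappa> * (LINT z|lborel. (deriv X z)\<^sup>2)) *\<^sub>R n"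
proof -
  let ?W = "\<lambda>z. deriv dwell (X z) * X1 z"
  let ?Q = "\<lambda>z. Pi z - ?W z + cap P * (deriv X z * deriv X1 z)
    + eps0 P / 2 * ((norm g)\<^sup>2 * E z - E z * deriv \<Phi>1 z * deriv \<Phi>1 z)"
  let ?H = "\<lambda>z. flux at_top *\<^sub>R V z + ?Q z *\<^sub>R n"
  note tX = twice_differentiable_deriv[OF X] and tX1 = twice_differentiable_deriv[OF X1]
    and t\<Phi> = twice_differentiable_deriv[OF \<Phi>1] and tE = twice_differentiable_deriv[OF E_td]
    and tPi = twice_differentiable_deriv[OF Pi_td]
  have H: "(?H has_vector_derivative (deriv X z)\<^sup>2 *\<^sub>R ((cap P * \<kappa>) *\<^sub>R n)) (at z)" for z
  proof -
    let ?q = "deriv Pi z - deriv ?W z + cap P * (deriv (deriv X) z * deriv X1 z + deriv (deriv X1) z * deriv X z)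
      + eps0 P / 2 * ((norm g)\<^sup>2 * deriv E z - (0 * deriv \<Phi>1 z + deriv (deriv \<Phi>1) z * (E z * deriv \<Phi>1 z)))"
    have Q: "(?Q has_real_derivative ?q) (at z)"
      by (intro DERIV_add DERIV_diff DERIV_mult DERIV_cmult tPi(1) twice_differentiable_deriv(1)[OF well_force_td]
          tX(2) tX1(2) tE(1) E_d_deriv t\<Phi>(2))
    have "0 = deriv E z * deriv \<Phi>1 z + deriv (deriv \<Phi>1) z * E z"
      by (rule DERIV_unique[OF E_d_deriv DERIV_mult[OF tE(1) t\<Phi>(2)]])
    then have Ed: "deriv (deriv \<Phi>1) z * (E z * deriv \<Phi>1 z) = - deriv E z * (deriv \<Phi>1 z)\<^sup>2"
      by (simp add: power2_eq_square) algebra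
    have HD: "(?H has_vector_derivative flux at_top *\<^sub>R vector_derivative V (at z) + ?q *\<^sub>R n) (at z)"
      by (rule has_vector_derivative_eq_rhs[OF has_vector_derivative_add[OF
            bounded_linear.has_vector_derivative[OF bounded_linear_scaleR_right V]
            bounded_linear.has_vector_derivative[OF bounded_linear_scaleR_left
              Q[unfolded has_real_derivative_iff_has_vector_derivative]]]]) simp
    have "flux at_top *\<^sub>R vector_derivative V (at z) + ?q *\<^sub>R n
        = (((Rt z) * (V z \<bullet> n - w)) *\<^sub>R vector_derivative V (at z)
        + (deriv Pi z - deriv ?W z
          + cap P * (deriv X z * deriv (deriv X1) z + deriv (deriv X) z * deriv X1 z - \<kappa> * (deriv X z)\<^sup>2)
          + eps0 P / 2 * ((deriv \<Phi>1 z)\<^sup>2 + (norm g)\<^sup>2) * deriv E z) *\<^sub>R n)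
        + (deriv X z)\<^sup>2 *\<^sub>R ((cap P * \<kappa>) *\<^sub>R n)"
      unfolding flux_const(1) Ed by (simp add: algebra_simps)
    also have "\<dots> = (deriv X z)\<^sup>2 *\<^sub>R ((cap P * \<kappa>) *\<^sub>R n)"
      using momentum[of z] unfolding Pi_deriv Rt_def E_def[abs_def] by simp
    finally show ?thesis using HD by simp
  qed
  have lim: "(?H \<longlongrightarrow> B Z) Z" if Z: "Z \<in> {at_top, at_bot}" for Z
  proof -
    \<comment> \<open>\<open>W'\<close> vanishes at both wells and \<open>X1\<close> tends to 0, so
      the term \<open>W'(X) X1\<close> of the total derivative contributes nothing at
      infinity.\<close>
    have "isCont (deriv dwell) (\<sigma> Z)" using DERIV_isCont[OF has_real_derivative_deriv_dwell] .
    moreover have "deriv dwell (\<sigma> Z) = 0" using Z \<sigma> by (auto simp: deriv_dwell)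
    ultimately have W: "((\<lambda>z. deriv dwell (X z)) \<longlongrightarrow> 0) Z"
      using isCont_tendsto_compose[OF _ X_lim(1)[OF Z]] by metis
    have N: "(N \<longlongrightarrow> ndens P (r Z)) Z"
      unfolding N_def[abs_def] ndens_def using fluidD(2)[OF P]
      by (intro tendsto_sum tendsto_divide tendsto_const r(1)[OF Z]) force+
    have K: "(K \<longlongrightarrow> bulk_mod P (\<sigma> Z)) Z"
      unfolding K_def[abs_def]
      by (rule isCont_tendsto_compose[OF DERIV_isCont[OF twice_differentiable_deriv(1)[OF
            bulk_mod_twice_differentiable[OF P]]] X_lim(1)[OF Z]])
    have nR: "nref P \<noteq> 0" using fluidD[OF P] by simp
    have L: "(?H \<longlongrightarrow> flux at_top *\<^sub>R u Z + (pref P + bulk_mod P (\<sigma> Z) * (ndens P (r Z) / nref P - 1)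
        - 0 * 0 + cap P * (0 * 0) + eps0 P / 2 * ((norm g)\<^sup>2 * (1 + sus P (\<sigma> Z)) - (1 + sus P (\<sigma> Z)) * d Z * d Z)) *\<^sub>R n) Z"
      unfolding Pi_def by (intro tendsto_intros u W N K nR X_lim X1_lim d E_lim Z)
    have alg: "p - 0 * 0 + c * (0 * 0) + e / 2 * (a * b - b * x * x) = p + e / 2 * b * (a - x\<^sup>2)"
      for p c e a b x :: real by (simp add: algebra_simps power2_eq_square diff_divide_distrib)
    show ?thesis using L[unfolded alg] unfolding B_def by (simp only: scaleR_add_left add.assoc)
  qed
  have "continuous_on UNIV (\<lambda>z. (deriv X z)\<^sup>2)"
    by (intro continuous_intros twice_differentiable_continuous[OF X])
  from LINT_derivative[OF H this X_deriv_square_integrable lim[of at_bot] lim[of at_top]]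
  show ?thesis by (simp add: mult_ac)
qed

text \<open>Pointwise positivity alone would allow the density to approach 0. The positive far-field
  limits exclude this near infinity, and compactness excludes it in between.\<close>

lemma inverse_Rt_bounded: "\<exists>C. \<forall>z. \<bar>1 / Rt z\<bar> \<le> C"
proof -
  let ?f = "\<lambda>z. 1 / Rt z"
  have cont: "continuous_on S ?f" for S
    using Rt_pos by (intro continuous_intros twice_differentiable_continuous[OF Rt_td]) (metis less_irrefl)
  have ev: "\<exists>C. \<forall>\<^sub>F z in Z. \<bar>?f z\<bar> \<le> C" if Z: "Z \<in> {at_top, at_bot}" for Z
  proof -
    have "((\<lambda>z. \<bar>?f z\<bar>) \<longlongrightarrow> \<bar>1 / (\<Sum>\<alpha>=1..nc P. r Z \<alpha>)\<bar>) Z"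
      using r_sum_pos[OF Z] by (intro tendsto_intros Rt_lim Z) simp
    then have "\<forall>\<^sub>F z in Z. \<bar>?f z\<bar> < \<bar>1 / (\<Sum>\<alpha>=1..nc P. r Z \<alpha>)\<bar> + 1" by (rule order_tendstoD) simp
    then have "\<forall>\<^sub>F z in Z. \<bar>?f z\<bar> \<le> \<bar>1 / (\<Sum>\<alpha>=1..nc P. r Z \<alpha>)\<bar> + 1" by (rule eventually_mono) simp
    then show ?thesis by (rule exI)
  qed
  obtain C1 a where 1: "\<And>z. a \<le> z \<Longrightarrow> \<bar>?f z\<bar> \<le> C1"
    using ev[of at_top] by (auto simp: eventually_at_top_linorder)
  obtain C2 b where 2: "\<And>z. z \<le> b \<Longrightarrow> \<bar>?f z\<bar> \<le> C2"
    using ev[of at_bot] by (auto simp: eventually_at_bot_linorder)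
  have "bounded (?f ` {b..a})" by (intro compact_imp_bounded compact_continuous_image cont) simp
  then obtain C3 where "\<forall>x\<in>?f ` {b..a}. norm x \<le> C3" unfolding bounded_iff by blast
  then have 3: "\<And>z. z \<in> {b..a} \<Longrightarrow> \<bar>?f z\<bar> \<le> C3" by fastforce
  have "\<bar>?f z\<bar> \<le> max C1 (max C2 C3)" for z
    using 1[of z] 2[of z] 3[of z] by (cases "a \<le> z"; cases "z \<le> b") auto
  then show ?thesis by blast
qed

lemma dissipation_integrable: "integrable lborel (\<lambda>z. 1 / Rt z * (deriv X z)\<^sup>2)"
proof -
  obtain C where C: "\<And>z. \<bar>1 / Rt z\<bar> \<le> C" using inverse_Rt_bounded by blast
  show ?thesis
  proof (rule Bochner_Integration.integrable_bound)
    show "integrable lborel (\<lambda>z. C * (deriv X z)\<^sup>2)" using X_deriv_square_integrable by simp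
    have "continuous_on UNIV (\<lambda>z. 1 / Rt z * (deriv X z)\<^sup>2)"
      using Rt_pos by (intro continuous_intros twice_differentiable_continuous[OF Rt_td]
          twice_differentiable_continuous[OF X]) (metis less_irrefl)
    then show "(\<lambda>z. 1 / Rt z * (deriv X z)\<^sup>2) \<in> borel_measurable lborel"
      by (simp add: borel_measurable_continuous_onI)
    have "\<bar>1 / Rt z\<bar> * (deriv X z)\<^sup>2 \<le> \<bar>C\<bar> * (deriv X z)\<^sup>2" for z
      using C[of z] by (intro mult_right_mono) auto
    then show "AE z in lborel. norm (1 / Rt z * (deriv X z)\<^sup>2) \<le> norm (C * (deriv X z)\<^sup>2)"
      by (simp add: abs_mult)
  qed
qed

text \<open>Adding \<open>X'\<close> times the phase field equation to the normal momentum balance and dividing by the density gives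
  \<open>(J\<^sup>2 / (2 Rt\<^sup>2) + M\<^sub>N)' = - (J / \<tau>) X'\<^sup>2 / Rt\<close>, by the Gibbs-Duhem relation.\<close>

lemma energy_jump:
  defines "B \<equiv> \<lambda>Z. (flux at_top)\<^sup>2 / (2 * (\<Sum>\<alpha>=1..nc P. r Z \<alpha>)\<^sup>2) + mu P (nc P) (r Z) (\<sigma> Z)"
  shows "B at_top - B at_bot = - (flux at_top / relax P * (LINT z|lborel. 1 / Rt z * (deriv X z)\<^sup>2))"
proof -
  let ?J = "flux at_top"
  let ?H = "\<lambda>z. ?J\<^sup>2 / (2 * (Rt z)\<^sup>2) + M (nc P) z"
  note tX = twice_differentiable_deriv[OF X] and tX1 = twice_differentiable_deriv[OF X1]
    and tR = twice_differentiable_deriv[OF Rt_td]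
  have H: "(?H has_vector_derivative (1 / Rt z * (deriv X z)\<^sup>2) *\<^sub>R (- (?J / relax P))) (at z)" for z
  proof -
    let ?v = "vector_derivative V (at z) \<bullet> n"
    let ?W = "\<lambda>z. deriv dwell (X z) * X1 z"
    let ?S = "deriv (sus P) (X z)" and ?g = "(deriv \<Phi>1 z)\<^sup>2 + (norm g)\<^sup>2"
    have Rp: "0 < Rt z" by (rule Rt_pos)
    \<comment> \<open>Differentiating the constant mass flux expresses the derivative of the normal
      velocity through that of the density, which turns \<open>?J * ?v\<close> into a derivative of
      a kinetic term after division by the density.\<close>
    have "Rt z * (V z \<bullet> n - w) = ?J" for z by (rule flux_const(1))
    from DERIV_unique[OF DERIV_mult[OF tR(1) V_n_deriv, unfolded this] DERIV_const]
    have v: "deriv Rt z * (V z \<bullet> n - w) + ?v * Rt z = 0" by simp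
    have vw: "V z \<bullet> n - w = ?J / Rt z" using flux_const(1)[of z] Rp by (simp add: field_simps)
    have W: "deriv ?W z = deriv (deriv dwell) (X z) * deriv X z * X1 z + deriv X1 z * deriv dwell (X z)"
      by (intro DERIV_imp_deriv DERIV_mult DERIV_chain2 twice_differentiable_deriv(1)[OF twice_differentiable_deriv_dwell] tX(1) tX1(1))
    have E': "deriv (\<lambda>z. 1 + sus P (X z)) z = ?S * deriv X z"
      by (rule DERIV_imp_deriv, rule DERIV_cong[OF DERIV_add[OF DERIV_const DERIV_chain2[OF twice_differentiable_deriv(1)[OF
              sus_twice_differentiable[OF P]] tX(1)]]]) simp
    have mom: "0 = ?J * ?v + (deriv Pi z - deriv ?W z
          + cap P * (deriv X z * deriv (deriv X1) z + deriv (deriv X) z * deriv X1 z - \<kappa> * (deriv X z)\<^sup>2)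
          + eps0 P / 2 * ?g * (?S * deriv X z))"
      using arg_cong[OF momentum[of z], of "\<lambda>x. x \<bullet> n"] n
      unfolding Pi_deriv E' Rt_def[symmetric] flux_const(1) by (simp add: inner_add_left)
    have ph: "0 = ?J / relax P * deriv X z
        + deriv (deriv dwell) (X z) * X1 z - cap P * deriv (deriv X1) z + cap P * \<kappa> * deriv X z
        + drhof_dchi P (\<lambda>\<alpha>. R \<alpha> z) (X z) - eps0 P / 2 * ?S * ?g"
      using phase[of z] unfolding Rt_def[symmetric] flux_const(1) .
    have "(\<Sum>\<alpha>=1..nc P. R \<alpha> z * deriv (M \<alpha>) z) = (\<Sum>\<alpha>=1..nc P. R \<alpha> z * deriv (M (nc P)) z)"
    proof (intro sum.cong refl)
      show "R \<alpha> z * deriv (M \<alpha>) z = R \<alpha> z * deriv (M (nc P)) z" if "\<alpha> \<in> {1..nc P}" for \<alpha>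
      proof (cases "\<alpha> = nc P")
        case False
        then have "\<alpha> \<in> {1..nc P - 1}" using that by (simp, linarith)
        then show ?thesis by (simp only: M_deriv_eq)
      qed simp
    qed
    then have gd: "deriv Pi z + drhof_dchi P (\<lambda>\<alpha>. R \<alpha> z) (X z) * deriv X z = Rt z * deriv (M (nc P)) z"
      using gibbs_duhem[of z] by (simp add: Rt_def sum_distrib_right)
    \<comment> \<open>In the sum of the normal momentum balance and \<open>X'\<close> times the
      phase field equation, the curvature, electric and \<open>X1''\<close> terms cancel in pairs,
      as do those with \<open>W''\<close>. The remaining terms with \<open>X1'\<close> cancel by the
      profile equation, and Gibbs-Duhem collects the pressure terms.\<close>
    have balance: "?J / relax P * (deriv X z)\<^sup>2 + Rt z * deriv (M (nc P)) z + ?J * ?v = 0"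
      using mom arg_cong[OF ph, of "\<lambda>x. x * deriv X z"] gd profile[of z]
      unfolding W power2_eq_square by algebra
    have Jv: "?J * ?v = - (?J\<^sup>2 * deriv Rt z / (Rt z)\<^sup>2)"
      using v Rp unfolding vw by (simp add: field_simps power2_eq_square) algebra
    have "a / R + b = (1 / R * q) * (- k)" if "k * q + R * b + a = 0" "0 < R" for a b k q R :: real
    proof -
      have "a = - (k * q) - R * b" using that(1) by linarith
      then show ?thesis using that(2) by (simp add: diff_divide_distrib)
    qed
    from this[OF balance[unfolded Jv] Rp]
    have "- (?J\<^sup>2 * deriv Rt z / (Rt z)\<^sup>2) / Rt z + deriv (M (nc P)) z
        = (1 / Rt z * (deriv X z)\<^sup>2) * (- (?J / relax P))" .
    moreover have "(?H has_real_derivative - (?J\<^sup>2 * deriv Rt z / (Rt z)\<^sup>2) / Rt z + deriv (M (nc P)) z) (at z)"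
    proof -
      have "((\<lambda>z. ?J\<^sup>2 / 2 * (inverse (Rt z))\<^sup>2) has_real_derivative - (?J\<^sup>2 * deriv Rt z / (Rt z)\<^sup>2) / Rt z) (at z)"
      proof -
        have q: "((\<lambda>z. inverse (Rt z)) has_real_derivative - (inverse (Rt z) * deriv Rt z * inverse (Rt z))) (at z)"
          by (rule DERIV_inverse'[OF tR(1)]) (use Rp in simp)
        have "b / 2 * (real 2 * (- (inverse x * x' * inverse x) * inverse x ^ (2 - Suc 0))) = - (b * x' / x\<^sup>2) / x"
          if "0 < x" for b x x' :: real using that by (simp add: field_simps power2_eq_square)
        from DERIV_cong[OF DERIV_cmult[OF DERIV_power[OF q, of 2], of "?J\<^sup>2 / 2"] this[OF Rp]] show ?thesis .
      qed
      moreover have "b / 2 * (inverse x)\<^sup>2 = b / (2 * x\<^sup>2)" for b x :: real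
        by (cases "x = 0") (simp_all add: field_simps power2_eq_square)
      ultimately have "((\<lambda>z. ?J\<^sup>2 / (2 * (Rt z)\<^sup>2)) has_real_derivative - (?J\<^sup>2 * deriv Rt z / (Rt z)\<^sup>2) / Rt z) (at z)"
        by (simp only:)
      then show ?thesis by (intro DERIV_add twice_differentiable_deriv(1)[OF M_td[OF last_in]])
    qed
    ultimately show ?thesis by (simp add: has_real_derivative_iff_has_vector_derivative)
  qed
  have lim: "(?H \<longlongrightarrow> B Z) Z" if Z: "Z \<in> {at_top, at_bot}" for Z
    unfolding B_def using r_sum_pos[OF Z] by (intro tendsto_intros Rt_lim M_lim Z last_in) auto
  have "continuous_on UNIV (\<lambda>z. 1 / Rt z * (deriv X z)\<^sup>2)"
    using Rt_pos by (intro continuous_intros twice_differentiable_continuous[OF Rt_td]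
        twice_differentiable_continuous[OF X]) (metis less_irrefl)
  from LINT_derivative[OF H this dissipation_integrable lim[of at_bot] lim[of at_top]]
  show ?thesis by (simp add: mult_ac)
qed

end

section \<open>Matching solutions\<close>

text \<open>Needed because the filter itself serves as the label of a bulk side, and a case
  distinction on \<open>Z = at_top\<close> must tell the two sides apart.\<close>

lemma at_bot_neq_at_top: "(at_bot :: real filter) \<noteq> at_top"
proof
  assume "(at_bot :: real filter) = at_top"
  then have "\<forall>\<^sub>F x in at_top. x < (0::real)" by (metis eventually_gt_at_bot)
  moreover have "\<forall>\<^sub>F x in at_top. (0::real) < x" by (rule eventually_gt_at_top)
  ultimately have "\<forall>\<^sub>F x in (at_top :: real filter). False" by eventually_elim simp
  then show False by simp
qed

lemma maxwell_stress_normal: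
  "((1/2 * (norm p)\<^sup>2) *\<^sub>R mat 1 - outer p p) *v n = (1/2 * (norm p)\<^sup>2) *\<^sub>R n - (p \<bullet> n) *\<^sub>R (p :: real^3)"
proof -
  have "outer p p *v n = (p \<bullet> n) *\<^sub>R p"
    by (simp add: vec_eq_iff outer_def matrix_vector_mult_def inner_vec_def sum_distrib_left sum_distrib_right mult_ac)
  then show ?thesis
    by (simp add: matrix_vector_mult_diff_rdistrib scaleR_matrix_vector_assoc[symmetric])
qed

lemma surf_grad_compose:
  assumes "f differentiable (at s)" "(h has_real_derivative h') (at (f s))"
  shows "surf_grad G t (\<lambda>s. h (f s)) s = h' *\<^sub>R surf_grad G t f s"
proof -
  have "(f has_derivative frechet_derivative f (at s)) (at s)"
    using assms(1) by (simp add: frechet_derivative_works)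
  from diff_chain_at[OF this assms(2)[unfolded has_field_derivative_def]]
  have "frechet_derivative (\<lambda>s. h (f s)) (at s) = (\<lambda>e. h' * frechet_derivative f (at s) e)"
    by (simp add: frechet_derivative_at[symmetric] o_def)
  then show ?thesis
    unfolding surf_grad_def by (simp add: scaleR_sum_right mult_ac)
qed

lemma surf_grad_cong_open:
  assumes "open S" "s \<in> S" "\<And>s'. s' \<in> S \<Longrightarrow> f s' = f' s'"
  shows "surf_grad G t f s = surf_grad G t f' s"
proof -
  have "frechet_derivative f (at s) = frechet_derivative f' (at s)" by (rule frechet_derivative_cong_open[OF assms])
  then show ?thesis unfolding surf_grad_def by simp
qed

lemma C1_s_differentiable:
  assumes "C1_s G f" "open (params G)" "t \<in> {0..<Tf G}" "s \<in> params G"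
  shows "(\<lambda>s. f t s z) differentiable (at s)"
proof -
  have "(\<lambda>s. f t s z) differentiable_on params G" using assms(1,3) by (simp add: C1_s_def)
  then show ?thesis using assms(2,4) by (meson differentiable_on_eq_differentiable_at)
qed

section \<open>Bulk phases of a matching solution\<close>

locale matched_phases =
  fixes P :: fluid_data and G :: geometry
    and rho :: "nat \<Rightarrow> real \<Rightarrow> real^3 \<Rightarrow> real" and v :: "real \<Rightarrow> real^3 \<Rightarrow> real^3"
    and chi0 chi1 \<phi> :: "real \<Rightarrow> real^3 \<Rightarrow> real"
    and R0 R1 :: "nat \<Rightarrow> inner_scalar" and V0 :: inner_vector
    and X0 X1 \<Phi>0 \<Phi>1 :: inner_scalar
  assumes P: "fluid P" and G: "evolving_interface G"
    and matching: "matching_solution P G rho v chi0 chi1 \<phi> R0 R1 V0 X0 X1 \<Phi>0 \<Phi>1"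
begin

text \<open>Indexing a bulk region by the filter at which the profile meets it lets both phases be
  treated by one argument, with \<open>sgn_side\<close> as the value of the phase variable.\<close>

definition side :: "real filter \<Rightarrow> real \<Rightarrow> (real^3) set" where
  "side Z t = (if Z = at_top then liquid G t else vapor G t)"

definition sgn_side :: "real filter \<Rightarrow> real" where
  "sgn_side Z = (if Z = at_top then 1 else - 1)"

lemma side_simps: "side at_top t = liquid G t" "side at_bot t = vapor G t"
  "sgn_side at_top = 1" "sgn_side at_bot = - 1" "side Z t \<in> {liquid G t, vapor G t}" "\<bar>sgn_side Z\<bar> = 1"
  by (simp_all add: side_def sgn_side_def at_bot_neq_at_top)

lemma spacetime_cases:
  assumes "(t, x) \<in> spacetime G (liquid G) \<union> spacetime G (vapor G)"
  obtains Z where "Z \<in> {at_top, at_bot}" "t \<in> {0..<Tf G}" "x \<in> side Z t"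
  using assms side_simps(1,2)[of t] unfolding spacetime_def by blast

lemmas outer = matching[unfolded matching_solution_def, THEN conjunct1, unfolded outer_solution_def]
lemmas inner = matching[unfolded matching_solution_def, THEN conjunct2, THEN conjunct1, unfolded inner_solution_def Let_def]
lemmas outer_eqs = outer[THEN conjunct2, THEN conjunct2, THEN conjunct2, THEN conjunct2, THEN conjunct2, THEN conjunct2,
    THEN conjunct2, THEN conjunct2]

lemma traces: "\<And>\<alpha>. \<alpha> \<in> {1..nc P} \<Longrightarrow> has_traces G (rho \<alpha>)" "has_traces G v" "has_traces G \<phi>"
  using outer[THEN conjunct2] by blast+

context
  fixes t x Z
  assumes t: "t \<in> {0..<Tf G}" and x: "x \<in> side Z t"
begin

lemma in_spacetime: "\<exists>Q\<in>{spacetime G (liquid G), spacetime G (vapor G)}. (t, x) \<in> Q"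
  using t x by (auto simp: side_def spacetime_def split: if_splits)

lemma in_bulk: "(t, x) \<in> spacetime G (liquid G) \<union> spacetime G (vapor G)"
  using in_spacetime by blast

lemma bulk_regular:
  "\<And>\<alpha>. \<alpha> \<in> {1..nc P} \<Longrightarrow> rho \<alpha> t differentiable (at x)" "\<And>\<alpha>. \<alpha> \<in> {1..nc P} \<Longrightarrow> 0 < rho \<alpha> t x"
  "\<phi> t differentiable (at x)" "grad (\<phi> t) differentiable (at x)"
proof -
  obtain Q where Q: "Q \<in> {spacetime G (liquid G), spacetime G (vapor G)}" "(t, x) \<in> Q" using in_spacetime by blast
  note q = outer[THEN conjunct1, THEN bspec, OF Q(1)]
  have two: "space_Ck 2 Q f \<Longrightarrow> f t differentiable (at x)" for f :: "real \<Rightarrow> real^3 \<Rightarrow> real"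
    using space_Ck_differentiable[of 1 Q f] Q(2) by (simp add: numeral_2_eq_2)
  show "rho \<alpha> t differentiable (at x)" "0 < rho \<alpha> t x" if "\<alpha> \<in> {1..nc P}" for \<alpha>
    using q[THEN conjunct1, THEN bspec, OF that] two Q(2) by auto
  have "space_Ck 2 Q \<phi>" using q by (elim conjE)
  then show "\<phi> t differentiable (at x)" "grad (\<phi> t) differentiable (at x)"
    using two space_Ck_grad_differentiable[OF _ Q(2)] by auto
qed

lemmas bulk_equation_list = outer_eqs[THEN bspec, OF in_bulk, unfolded case_prod_conv]

lemmas bulk_equations = bulk_equation_list[THEN conjunct1, THEN bspec]
  bulk_equation_list[THEN conjunct2, THEN conjunct1]
  bulk_equation_list[THEN conjunct2, THEN conjunct2, THEN conjunct1]
  bulk_equation_list[THEN conjunct2, THEN conjunct2, THEN conjunct2, THEN conjunct1]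
  bulk_equation_list[THEN conjunct2, THEN conjunct2, THEN conjunct2, THEN conjunct2, THEN conjunct1]
  bulk_equation_list[THEN conjunct2, THEN conjunct2, THEN conjunct2, THEN conjunct2, THEN conjunct2]

lemma bulk_phase: "chi0 t x = sgn_side Z" "chi1 t x = 0"
proof -
  have "0 < chi0 t x \<or> chi0 t x < 0" "Z = at_top \<longrightarrow> 0 < chi0 t x" "Z \<noteq> at_top \<longrightarrow> chi0 t x < 0"
  proof -
    note s = outer[THEN conjunct2, THEN conjunct2, THEN conjunct2, THEN conjunct2, THEN conjunct2, THEN conjunct2]
    show "Z = at_top \<longrightarrow> 0 < chi0 t x" "Z \<noteq> at_top \<longrightarrow> chi0 t x < 0"
      using s[THEN conjunct1, THEN bspec, of "(t, x)"] s[THEN conjunct2, THEN conjunct1, THEN bspec, of "(t, x)"] t x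
      by (auto simp: side_def spacetime_def)
    then show "0 < chi0 t x \<or> chi0 t x < 0" by blast
  qed
  moreover have "chi0 t x * ((chi0 t x)\<^sup>2 - 1) = 0" using bulk_equations(3) by (simp add: deriv_dwell)
  ultimately have "(chi0 t x)\<^sup>2 = 1" by auto
  then have "chi0 t x = 1 \<or> chi0 t x = -1" by (simp add: power2_eq_1_iff)
  then show c: "chi0 t x = sgn_side Z"
    using \<open>Z = at_top \<longrightarrow> 0 < chi0 t x\<close> \<open>Z \<noteq> at_top \<longrightarrow> chi0 t x < 0\<close> by (auto simp: sgn_side_def)
  have "(chi0 t x)\<^sup>2 = 1" by fact
  \<comment> \<open>The second derivative of the double well equals 8 at both wells, so the
    first-order phase equation reduces to 8 times \<open>chi1\<close>.\<close>
  then show "chi1 t x = 0"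
    using bulk_equations(5) drhof_dchi_pure[OF P, of "chi0 t x"] side_simps(6)[of Z]
    by (simp add: c deriv_deriv_dwell)
qed

end

lemma open_side: "t \<in> {0..<Tf G} \<Longrightarrow> open (side Z t)"
  using bulk_side(1)[OF G _ side_simps(5)] .

definition Kmod :: "real filter \<Rightarrow> real" where "Kmod Z = bulk_mod P (sgn_side Z)"

lemma bulk_pressure:
  assumes "t \<in> {0..<Tf G}" "y \<in> side Z t"
  shows "(\<Sum>\<alpha>=1..nc P. rho \<alpha> t y * mu_out P rho chi0 \<alpha> t y) - rhof_out P rho chi0 t y
    = pref P + Kmod Z * (ndens P (\<lambda>\<beta>. rho \<beta> t y) / nref P - 1)"
  unfolding mu_out_def rhof_out_def bulk_phase(1)[OF assms] Kmod_def
  by (rule pressure_eq[OF P bulk_regular(2)[OF assms]])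

text \<open>On an open bulk region the phase variable is constant and \<open>chi1\<close> is zero,
  so the gradient of \<open>W'(\<chi>) \<chi>1\<close> disappears and the permittivity is a constant
  that commutes with the divergence.\<close>

lemma bulk_momentum:
  assumes t: "t \<in> {0..<Tf G}" and x: "x \<in> side Z t"
  shows "0 = time_deriv (Tf G) (\<lambda>t y. rho_tot P rho t y *\<^sub>R v t y) t x
          + tensor_dvg (\<lambda>y. rho_tot P rho t y *\<^sub>R outer (v t y) (v t y)) x
          + grad (\<lambda>y. (\<Sum>\<alpha>=1..nc P. rho \<alpha> t y * mu_out P rho chi0 \<alpha> t y) - rhof_out P rho chi0 t y
                      + eps0 P / 2 * (1 + sus P (chi0 t y)) * (norm (grad (\<phi> t) y))\<^sup>2) x
          - tensor_dvg (\<lambda>y. (eps0 P * (1 + sus P (chi0 t y))) *\<^sub>R outer (grad (\<phi> t) y) (grad (\<phi> t) y)) x"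
proof -
  let ?\<Pi> = "\<lambda>y. (\<Sum>\<alpha>=1..nc P. rho \<alpha> t y * mu_out P rho chi0 \<alpha> t y) - rhof_out P rho chi0 t y"
  let ?c = "1 + sus P (sgn_side Z)"
  note op = open_side[OF t, of Z]
  note chi = bulk_phase(1)[OF t]
  \<comment> \<open>The gradient of a sum may be split only where the summands are differentiable;
    for the pressure this is read off from its affine form in the number density.\<close>
  have "?\<Pi> differentiable (at x)"
  proof -
    have "\<And>\<beta>. \<beta> \<in> {1..nc P} \<Longrightarrow> (rho \<beta> t has_derivative frechet_derivative (rho \<beta> t) (at x)) (at x)"
      using bulk_regular(1)[OF t x] by (simp add: frechet_derivative_works)
    from ndens_has_derivative[of P "\<lambda>\<beta>. rho \<beta> t", OF this]
    have "(\<lambda>y. ndens P (\<lambda>\<beta>. rho \<beta> t y)) differentiable (at x)" unfolding differentiable_def by blast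
    then have "(\<lambda>y. pref P + Kmod Z * (ndens P (\<lambda>\<beta>. rho \<beta> t y) / nref P - 1)) differentiable (at x)"
      unfolding divide_inverse by (intro derivative_intros)
    then obtain D where "((\<lambda>y. pref P + Kmod Z * (ndens P (\<lambda>\<beta>. rho \<beta> t y) / nref P - 1)) has_derivative D) (at x)"
      unfolding differentiable_def by blast
    then have "(?\<Pi> has_derivative D) (at x)"
      by (rule has_derivative_transform_within_open[OF _ op x]) (rule bulk_pressure[OF t, symmetric])
    then show ?thesis unfolding differentiable_def by blast
  qed
  note stress = maxwell_stress_divergence[OF bulk_regular(4)[OF t x] this, of "eps0 P" ?c]
  have "grad (\<lambda>y. deriv dwell (chi0 t y) * chi1 t y) x = grad (\<lambda>y. 0) x"
    by (rule grad_cong_open[OF op x]) (simp add: bulk_phase(2)[OF t])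
  also have "\<dots> = 0" by (rule grad_eqI) simp
  finally have "grad (\<lambda>y. deriv dwell (chi0 t y) * chi1 t y) x = 0" .
  moreover have "tensor_dvg (\<lambda>y. (1 + sus P (chi0 t y)) *\<^sub>R
         ((1/2 * (norm (grad (\<phi> t) y))\<^sup>2) *\<^sub>R mat 1 - outer (grad (\<phi> t) y) (grad (\<phi> t) y))) x
     = tensor_dvg (\<lambda>y. ?c *\<^sub>R ((1/2 * (norm (grad (\<phi> t) y))\<^sup>2) *\<^sub>R mat 1 - outer (grad (\<phi> t) y) (grad (\<phi> t) y))) x"
    by (rule tensor_dvg_cong_open[OF op x]) (simp only: chi)
  moreover have "tensor_dvg (\<lambda>y. (eps0 P * (1 + sus P (chi0 t y))) *\<^sub>R outer (grad (\<phi> t) y) (grad (\<phi> t) y)) x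
      = tensor_dvg (\<lambda>y. (eps0 P * ?c) *\<^sub>R outer (grad (\<phi> t) y) (grad (\<phi> t) y)) x"
    by (rule tensor_dvg_cong_open[OF op x]) (simp only: chi)
  moreover have "grad (\<lambda>y. ?\<Pi> y + eps0 P / 2 * (1 + sus P (chi0 t y)) * (norm (grad (\<phi> t) y))\<^sup>2) x
      = grad (\<lambda>y. ?\<Pi> y + eps0 P / 2 * ?c * (norm (grad (\<phi> t) y))\<^sup>2) x"
    by (rule grad_cong_open[OF op x]) (simp only: chi)
  moreover note bulk_equations(4)[OF t x]
  ultimately show ?thesis using stress by (simp only: add_diff_eq[symmetric]) (simp add: algebra_simps)
qed

lemma matches_side:
  assumes "t \<in> {0..<Tf G}" "s \<in> params G" "Z \<in> {at_top, at_bot}"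
  shows "matches P G t s (side Z t) Z rho v chi0 chi1 \<phi> R0 R1 V0 X0 X1 \<Phi>0 \<Phi>1"
  using matching[unfolded matching_solution_def, THEN conjunct2, THEN conjunct2, THEN bspec, OF assms(1), THEN bspec, OF assms(2)]
    assms(3) side_simps(1,2)[of t] by auto

lemmas inner_regularity = inner[THEN conjunct2, THEN conjunct1] inner[THEN conjunct2, THEN conjunct2, THEN conjunct2, THEN conjunct1]
  inner[THEN conjunct2, THEN conjunct2, THEN conjunct2, THEN conjunct2, THEN conjunct1]
  inner[THEN conjunct2, THEN conjunct2, THEN conjunct2, THEN conjunct2, THEN conjunct2, THEN conjunct1]
  inner[THEN conjunct2, THEN conjunct2, THEN conjunct2, THEN conjunct2, THEN conjunct2, THEN conjunct2, THEN conjunct1]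
lemmas inner_eqs = inner[THEN conjunct2, THEN conjunct2, THEN conjunct2, THEN conjunct2, THEN conjunct2, THEN conjunct2,
    THEN conjunct2, THEN bspec, THEN bspec, THEN spec]

end

section \<open>Traces and matching at one interface point\<close>

locale matched_point = matched_phases +
  fixes t :: real and s :: "real^2"
  assumes t: "t \<in> {0..<Tf G}" and s: "s \<in> params G"
begin

definition x :: "real^3" where "x = chart G t s"
definition n :: "real^3" where "n = nu G t x"
definition r :: "real filter \<Rightarrow> nat \<Rightarrow> real" where "r Z \<alpha> = one_sided (side Z t) (rho \<alpha> t) x"
definition u :: "real filter \<Rightarrow> real^3" where "u Z = one_sided (side Z t) (v t) x"
definition p :: "real filter \<Rightarrow> real^3" where "p Z = one_sided (side Z t) (grad (\<phi> t)) x"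
text \<open>The normal gradient in the sense used by the matching condition. That the underlying
  limit exists is established in \<open>grad_mu_trace\<close>.\<close>

definition m :: "real filter \<Rightarrow> nat \<Rightarrow> real" where
  "m Z \<beta> = one_sided (side Z t) (grad (mu_out P rho chi0 \<beta> t)) x \<bullet> n"
text \<open>The choice of \<open>z = 0\<close> is a representative: \<open>\<Phi>0\<close> does not
  depend on \<open>z\<close>.\<close>

definition g :: "real^3" where "g = surf_grad G t (\<lambda>s'. \<Phi>0 t s' 0) s"

lemma x_in: "x \<in> Gam G t"
  using evolving_interfaceD(6)[OF G t] s by (auto simp: x_def)

lemma n_unit: "n \<bullet> n = 1"
  unfolding n_def by (rule norm_nu[OF G t x_in])

lemma trace_eq:
  assumes "(f \<longlongrightarrow> l) (at x within side Z t)"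
  shows "one_sided (side Z t) f x = l"
  by (rule one_sided_eq[OF G t x_in side_simps(5) assms])

lemma jump_eq:
  assumes "\<And>Z. Z \<in> {at_top, at_bot} \<Longrightarrow> (f \<longlongrightarrow> l Z) (at x within side Z t)"
  shows "jump G t f x = l at_top - l at_bot"
  using trace_eq[OF assms[of at_top]] trace_eq[OF assms[of at_bot]] by (simp add: jump_def side_simps)

lemma eventually_side: "\<forall>\<^sub>F y in at x within side Z t. y \<in> side Z t"
  by (simp add: eventually_at_filter)

lemma tendsto_cong_side:
  assumes "(f \<longlongrightarrow> l) (at x within side Z t)" "\<And>y. y \<in> side Z t \<Longrightarrow> f y = h y"
  shows "(h \<longlongrightarrow> l) (at x within side Z t)"
  by (rule Lim_transform_eventually[OF assms(1)]) (use eventually_side in \<open>rule eventually_mono\<close>, rule assms(2))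

lemma rho_trace: "\<alpha> \<in> {1..nc P} \<Longrightarrow> (rho \<alpha> t \<longlongrightarrow> r Z \<alpha>) (at x within side Z t)"
  unfolding r_def by (rule has_traces_tendsto[OF G traces(1) t x_in side_simps(5)])

lemma v_trace: "(v t \<longlongrightarrow> u Z) (at x within side Z t)"
  unfolding u_def by (rule has_traces_tendsto[OF G traces(2) t x_in side_simps(5)])

lemma grad_phi_trace: "(grad (\<phi> t) \<longlongrightarrow> p Z) (at x within side Z t)"
  unfolding p_def by (rule has_traces_grad_tendsto[OF G traces(3) t x_in side_simps(5)])

lemma chi0_trace: "(chi0 t \<longlongrightarrow> sgn_side Z) (at x within side Z t)"
  by (rule tendsto_cong_side[OF tendsto_const]) (simp add: bulk_phase(1)[OF t])

text \<open>These values remove the constant and the linear term from the matching condition for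
  \<open>X1\<close>, so that \<open>X1\<close> and its derivative tend to 0.\<close>

lemma chi_traces: "one_sided (side Z t) (chi0 t) x = sgn_side Z" "one_sided (side Z t) (chi1 t) x = 0"
  "one_sided (side Z t) (grad (chi0 t)) x = 0"
proof -
  show "one_sided (side Z t) (chi0 t) x = sgn_side Z" by (rule trace_eq[OF chi0_trace])
  show "one_sided (side Z t) (chi1 t) x = 0"
    by (rule trace_eq, rule tendsto_cong_side[OF tendsto_const]) (simp add: bulk_phase(2)[OF t])
  have "grad (chi0 t) y = 0" if "y \<in> side Z t" for y
  proof -
    have "grad (chi0 t) y = grad (\<lambda>_. sgn_side Z) y"
      by (rule grad_cong_open[OF open_side[OF t] that]) (rule bulk_phase(1)[OF t])
    then show ?thesis using grad_eqI[of "\<lambda>_. sgn_side Z" 0 y] by simp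
  qed
  then show "one_sided (side Z t) (grad (chi0 t)) x = 0"
    by (intro trace_eq tendsto_cong_side[OF tendsto_const]) simp
qed

lemma match:
  assumes Z: "Z \<in> {at_top, at_bot}"
  shows "\<And>\<alpha>. \<alpha> \<in> {1..nc P} \<Longrightarrow> 0 < r Z \<alpha>"
    "\<And>\<alpha>. \<alpha> \<in> {1..nc P} \<Longrightarrow> (R0 \<alpha> t s \<longlongrightarrow> r Z \<alpha>) Z"
    "\<And>\<alpha>. \<alpha> \<in> {1..nc P} \<Longrightarrow> (deriv (mu_in0 P R0 X0 \<alpha> t s) \<longlongrightarrow> 0) Z"
    "\<And>\<alpha>. \<alpha> \<in> {1..nc P} \<Longrightarrow> (deriv (mu_in1 P R0 R1 X0 X1 \<alpha> t s) \<longlongrightarrow> m Z \<alpha>) Z"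
    "(V0 t s \<longlongrightarrow> u Z) Z" "(X0 t s \<longlongrightarrow> sgn_side Z) Z" "(deriv (X0 t s) \<longlongrightarrow> 0) Z"
    "(X1 t s \<longlongrightarrow> 0) Z" "(deriv (X1 t s) \<longlongrightarrow> 0) Z" "(deriv (\<Phi>1 t s) \<longlongrightarrow> p Z \<bullet> n) Z"
  using matches_side[OF t s Z]
  unfolding matches_def Let_def x_def[symmetric] n_def[symmetric] r_def[symmetric] m_def[symmetric]
    u_def[symmetric] p_def[symmetric] chi_traces
  by simp_all

end

context matched_phases
begin

text \<open>Minus half of the permittivity factor times the square of the derivative of
  \<open>\<Phi>0\<close> is constant and tends to 0; the factor is at least 1, so the derivative
  vanishes. The identity is proved at every parameter point because it is afterwards differentiated
  in \<open>s\<close>.\<close>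

lemma Phi0_trace:
  assumes t: "t \<in> {0..<Tf G}" and s: "s \<in> params G" and Z: "Z \<in> {at_top, at_bot}"
  shows "\<Phi>0 t s z = one_sided (side Z t) (\<phi> t) (chart G t s)"
proof -
  interpret matched_point P G rho v chi0 chi1 \<phi> R0 R1 V0 X0 X1 \<Phi>0 \<Phi>1 t s
    by unfold_locales (rule t s)+
  have td: "twice_differentiable (\<Phi>0 t s)" "twice_differentiable (X0 t s)"
    using inner_regularity(3) t s by (auto simp: Ck_z_def intro!: Ck_on_2_twice_differentiable)
  let ?E = "\<lambda>z. 1 + sus P (X0 t s z)"
  let ?f = "\<lambda>z. 1/2 * ?E z * (deriv (\<Phi>0 t s) z)\<^sup>2 - ?E z * (deriv (\<Phi>0 t s) z)\<^sup>2"
  have lim: "(\<Phi>0 t s \<longlongrightarrow> one_sided (side Z t) (\<phi> t) x) Z" "(deriv (\<Phi>0 t s) \<longlongrightarrow> 0) Z" if "Z \<in> {at_top, at_bot}" for Z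
    using matches_side[OF t s that] unfolding matches_def Let_def x_def[symmetric] by simp_all
  have E: "twice_differentiable ?E"
    by (intro twice_differentiable_add twice_differentiable_const twice_differentiable_compose[OF sus_twice_differentiable[OF P] td(2)])
  have "(?f has_real_derivative 0) (at z)" for z
  proof (rule has_real_derivative_zero)
    show "(?f has_real_derivative (deriv ?E z * 1/2 * (deriv (\<Phi>0 t s) z)\<^sup>2
        + ?E z * 1/2 * (2 * deriv (\<Phi>0 t s) z * deriv (deriv (\<Phi>0 t s)) z))
        - (deriv ?E z * (deriv (\<Phi>0 t s) z)\<^sup>2 + ?E z * (2 * deriv (\<Phi>0 t s) z * deriv (deriv (\<Phi>0 t s)) z))) (at z)"
      by (rule derivative_eq_intros twice_differentiable_deriv[OF E] twice_differentiable_deriv[OF td(1)] refl)+ simp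
    show "deriv ?f z = 0"
      using inner_eqs[OF t s, of z, THEN conjunct1] by (rule sym)
  qed
  moreover have "(?f \<longlongrightarrow> 1/2 * (1 + sus P (sgn_side Z)) * 0\<^sup>2 - (1 + sus P (sgn_side Z)) * 0\<^sup>2) Z" if Z: "Z \<in> {at_top, at_bot}" for Z
    by (intro tendsto_intros lim(2)[OF Z] isCont_tendsto_compose[OF DERIV_isCont[OF twice_differentiable_deriv(1)[OF
          sus_twice_differentiable[OF P]]] match(6)[OF Z]])
  ultimately have "?f z = 0" for z
    using constant_of_deriv_zero(1)[of ?f 0 0 z] by simp
  then have "?E z * (deriv (\<Phi>0 t s) z)\<^sup>2 = 0" for z by (smt (verit) mult.assoc mult_cancel_right2 field_sum_of_halves)
  moreover have "0 < ?E z" for z using sus_nonneg[OF P, of "X0 t s z"] by simp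
  ultimately have "deriv (\<Phi>0 t s) z = 0" for z
    by (metis less_irrefl mult_eq_0_iff zero_eq_power2)
  then have D: "(\<Phi>0 t s has_real_derivative 0) (at z)" for z
    using twice_differentiable_deriv(1)[OF td(1)] by metis
  show ?thesis
    using constant_of_deriv_zero[OF D lim(1)[of at_top] lim(1)[of at_bot]] Z by (auto simp: x_def)
qed

end

context matched_point
begin

lemma Phi0_surf_grad: "surf_grad G t (\<lambda>s'. \<Phi>0 t s' z) s = g"
  unfolding g_def
  by (rule surf_grad_cong_open[OF evolving_interfaceD(3)[OF G t] s]) (simp add: Phi0_trace[OF t, of _ at_top])

lemma grad_phi_decomposition:
  assumes "Z \<in> {at_top, at_bot}"
  shows "p Z = (p Z \<bullet> n) *\<^sub>R n + g"
proof -
  have "g = p Z - (p Z \<bullet> nu G t x) *\<^sub>R nu G t x"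
    unfolding g_def
  proof (rule surf_grad_trace[OF G t s side_simps(5) _ traces(3) _ _ x_def p_def])
    show "y \<in> side Z t \<Longrightarrow> \<phi> t differentiable (at y)" for y by (rule bulk_regular(3)[OF t])
    show "s' \<in> params G \<Longrightarrow> \<Phi>0 t s' 0 = one_sided (side Z t) (\<phi> t) (chart G t s')" for s'
      by (rule Phi0_trace[OF t _ assms])
    show "(\<lambda>s'. \<Phi>0 t s' 0) differentiable (at s)"
      by (rule C1_s_differentiable[OF inner_regularity(5) evolving_interfaceD(3)[OF G t] t s])
  qed
  then show ?thesis by (simp add: n_def)
qed

text \<open>With the profile equation, this makes the two surface gradient terms of the momentum
  equation cancel.\<close>

lemma inner_X_gradient:
  "surf_grad G t (\<lambda>s'. dwell (X0 t s' z)) s = deriv dwell (X0 t s z) *\<^sub>R surf_grad G t (\<lambda>s'. X0 t s' z) s"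
  by (rule surf_grad_compose)
     (use C1_s_differentiable[OF inner_regularity(4) evolving_interfaceD(3)[OF G t] t s] has_real_derivative_dwell
       in \<open>simp_all add: deriv_dwell\<close>)

sublocale inner_profile P "\<lambda>\<alpha>. R0 \<alpha> t s" "\<lambda>\<alpha>. R1 \<alpha> t s" "V0 t s" "X0 t s" "X1 t s" "\<Phi>1 t s" n g
  "normal_vel G t s" "mean_curv G t s" sgn_side "\<lambda>Z. p Z \<bullet> n" r m u
proof
  note e = inner_eqs[OF t s]
  note e2 = e[THEN conjunct2] note e3 = e2[THEN conjunct2] note e4 = e3[THEN conjunct2]
  note e5 = e4[THEN conjunct2] note e6 = e5[THEN conjunct2] note e7 = e6[THEN conjunct2] note e8 = e7[THEN conjunct2]
  show "fluid P" "n \<bullet> n = 1" by (rule P n_unit)+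
  show "twice_differentiable (R0 \<alpha> t s)" "0 < R0 \<alpha> t s z" "twice_differentiable (R1 \<alpha> t s)" if "\<alpha> \<in> {1..nc P}" for \<alpha> z
    using inner_regularity(1)[THEN bspec, OF that] t s by (auto simp: Ck_z_def intro!: Ck_on_2_twice_differentiable)
  show "twice_differentiable (X0 t s)" "twice_differentiable (X1 t s)" "twice_differentiable (\<Phi>1 t s)"
    using inner_regularity(3) t s by (auto simp: Ck_z_def intro!: Ck_on_2_twice_differentiable)
  have "Ck_on (Suc 0) UNIV (V0 t s)" using inner_regularity(2) t s by (simp add: Ck_z_def)
  then show "(V0 t s has_vector_derivative vector_derivative (V0 t s) (at z)) (at z)" for z
    using Ck_on_Suc_real(1) by (metis vector_derivative_at)
  show "sgn_side at_top = 1" "sgn_side at_bot = - 1" by (rule side_simps)+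
  show "deriv (\<lambda>z. \<Sum>\<beta>=1..nc P - 1. diff_mob P \<alpha> \<beta> *
        deriv (\<lambda>z. mu P \<beta> (\<lambda>\<alpha>. R0 \<alpha> t s z) (X0 t s z) - mu P (nc P) (\<lambda>\<alpha>. R0 \<alpha> t s z) (X0 t s z)) z) z = 0"
    if "\<alpha> \<in> {1..nc P - 1}" for \<alpha> z
    using e2[THEN conjunct1, THEN bspec, OF that, of z] unfolding mu_in0_def[abs_def] by (rule sym)
  show profile: "cap P * deriv (deriv (X0 t s)) z = deriv dwell (X0 t s z)" for z
    using e3[THEN conjunct1, of z] by simp
  show "deriv (\<lambda>z. (\<Sum>\<alpha>=1..nc P. R0 \<alpha> t s z) * (V0 t s z \<bullet> n - normal_vel G t s)) z = 0" for z
    using e4[THEN conjunct1, of z] unfolding R_tot_def[abs_def] x_def[symmetric] n_def[symmetric] by (rule sym)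
  show charge: "deriv (\<lambda>z. (1 + sus P (X0 t s z)) * deriv (\<Phi>1 t s) z) z = 0" for z
    using e7[THEN conjunct1, of z] by (rule sym)
  show "0 = ((\<Sum>\<alpha>=1..nc P. R0 \<alpha> t s z) * (V0 t s z \<bullet> n - normal_vel G t s)) *\<^sub>R vector_derivative (V0 t s) (at z)
        + (deriv (\<lambda>z. (\<Sum>\<alpha>=1..nc P. R0 \<alpha> t s z * mu P \<alpha> (\<lambda>\<alpha>. R0 \<alpha> t s z) (X0 t s z)) - rhof P (\<lambda>\<alpha>. R0 \<alpha> t s z) (X0 t s z)
              - deriv dwell (X0 t s z) * X1 t s z) z
          + cap P * (deriv (X0 t s) z * deriv (deriv (X1 t s)) z + deriv (deriv (X0 t s)) z * deriv (X1 t s) z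
              - mean_curv G t s * (deriv (X0 t s) z)\<^sup>2)
          + eps0 P / 2 * ((deriv (\<Phi>1 t s) z)\<^sup>2 + (norm g)\<^sup>2) * deriv (\<lambda>z. 1 + sus P (X0 t s z)) z) *\<^sub>R n" for z
    \<comment> \<open>The charge equation removes the product with \<open>\<Phi>1' n + g\<close>,
      and the chain rule with the profile equation removes the surface gradients of
      \<open>X0\<close>; outside the inertial term only multiples of the normal are left.\<close>
    using e5[THEN conjunct1, of z]
    unfolding mu_in0_def[abs_def] R_tot_def[abs_def] x_def[symmetric] n_def[symmetric] Phi0_surf_grad inner_X_gradient
      charge profile
    by (simp add: scaleR_add_left add.assoc)
  show "0 = ((\<Sum>\<alpha>=1..nc P. R0 \<alpha> t s z) * (V0 t s z \<bullet> n - normal_vel G t s)) / relax P * deriv (X0 t s) z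
        + deriv (deriv dwell) (X0 t s z) * X1 t s z - cap P * deriv (deriv (X1 t s)) z
        + cap P * mean_curv G t s * deriv (X0 t s) z
        + drhof_dchi P (\<lambda>\<alpha>. R0 \<alpha> t s z) (X0 t s z)
        - eps0 P / 2 * deriv (sus P) (X0 t s z) * ((deriv (\<Phi>1 t s) z)\<^sup>2 + (norm g)\<^sup>2)" for z
    using e6[THEN conjunct1, of z]
    unfolding R_tot_def[abs_def] x_def[symmetric] n_def[symmetric] Phi0_surf_grad .
  show "0 = deriv (\<lambda>z. R0 \<alpha> t s z * (V0 t s z \<bullet> n - normal_vel G t s)) z
        - (\<Sum>\<beta>=1..nc P - 1. diff_mob P \<alpha> \<beta> *
            (deriv (deriv (\<lambda>z.
                ((\<Sum>\<alpha>=1..nc P. dmu_drho P \<beta> \<alpha> (\<lambda>\<alpha>. R0 \<alpha> t s z) (X0 t s z) * R1 \<alpha> t s z) + dmu_dchi P \<beta> (\<lambda>\<alpha>. R0 \<alpha> t s z) (X0 t s z) * X1 t s z)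
              - ((\<Sum>\<alpha>=1..nc P. dmu_drho P (nc P) \<alpha> (\<lambda>\<alpha>. R0 \<alpha> t s z) (X0 t s z) * R1 \<alpha> t s z) + dmu_dchi P (nc P) (\<lambda>\<alpha>. R0 \<alpha> t s z) (X0 t s z) * X1 t s z))) z
            - mean_curv G t s * deriv (\<lambda>z. mu P \<beta> (\<lambda>\<alpha>. R0 \<alpha> t s z) (X0 t s z) - mu P (nc P) (\<lambda>\<alpha>. R0 \<alpha> t s z) (X0 t s z)) z
            + zm P \<beta> * deriv (deriv (\<Phi>1 t s)) z))" if "\<alpha> \<in> {1..nc P - 1}" for \<alpha> z
    using e8[THEN bspec, OF that, of z]
    unfolding mu_in0_def[abs_def] mu_in1_def[abs_def] x_def[symmetric] n_def[symmetric] .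
  fix Z :: "real filter" assume Z: "Z \<in> {at_top, at_bot}"
  show "0 < r Z \<alpha>" "(R0 \<alpha> t s \<longlongrightarrow> r Z \<alpha>) Z"
    "(deriv (\<lambda>z. mu P \<alpha> (\<lambda>\<alpha>. R0 \<alpha> t s z) (X0 t s z)) \<longlongrightarrow> 0) Z"
    "(deriv (\<lambda>z. (\<Sum>\<gamma>=1..nc P. dmu_drho P \<alpha> \<gamma> (\<lambda>\<alpha>. R0 \<alpha> t s z) (X0 t s z) * R1 \<gamma> t s z)
        + dmu_dchi P \<alpha> (\<lambda>\<alpha>. R0 \<alpha> t s z) (X0 t s z) * X1 t s z) \<longlongrightarrow> m Z \<alpha>) Z" if "\<alpha> \<in> {1..nc P}" for \<alpha>
    using match(1-4)[OF Z that] unfolding mu_in0_def[abs_def] mu_in1_def[abs_def] .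
  show "(V0 t s \<longlongrightarrow> u Z) Z" "(X0 t s \<longlongrightarrow> sgn_side Z) Z" "(deriv (X0 t s) \<longlongrightarrow> 0) Z"
    "(X1 t s \<longlongrightarrow> 0) Z" "(deriv (X1 t s) \<longlongrightarrow> 0) Z" "(deriv (\<Phi>1 t s) \<longlongrightarrow> p Z \<bullet> n) Z"
    by (rule match(5-10)[OF Z])+
qed

section \<open>Traces of the derived bulk quantities\<close>

lemma rho_tot_trace: "(rho_tot P rho t \<longlongrightarrow> (\<Sum>\<alpha>=1..nc P. r Z \<alpha>)) (at x within side Z t)"
  unfolding rho_tot_def[abs_def] by (intro tendsto_sum rho_trace)

lemma mu_trace:
  assumes "Z \<in> {at_top, at_bot}" "\<alpha> \<in> {1..nc P}"
  shows "(mu_out P rho chi0 \<alpha> t \<longlongrightarrow> mu P \<alpha> (r Z) (sgn_side Z)) (at x within side Z t)"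
  unfolding mu_out_def[abs_def]
proof (rule mu_tendsto[OF P assms(2) _ match(1)[OF assms(1)] _ chi0_trace])
  show "((\<lambda>y. rho \<beta> t y) \<longlongrightarrow> r Z \<beta>) (at x within side Z t)" if "\<beta> \<in> {1..nc P}" for \<beta> using rho_trace[OF that] .
  show "\<forall>\<^sub>F y in at x within side Z t. \<forall>\<beta>\<in>{1..nc P}. 0 < rho \<beta> t y"
    using eventually_side by (rule eventually_mono) (use bulk_regular(2)[OF t] in blast)
qed

lemma ndens_trace: "((\<lambda>y. ndens P (\<lambda>\<beta>. rho \<beta> t y)) \<longlongrightarrow> ndens P (r Z)) (at x within side Z t)"
  unfolding ndens_def using fluidD(2)[OF P]
  by (intro tendsto_sum tendsto_divide tendsto_const rho_trace) force+

lemma sus_trace: "((\<lambda>y. sus P (chi0 t y)) \<longlongrightarrow> sus P (sgn_side Z)) (at x within side Z t)"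
  by (rule isCont_tendsto_compose[OF DERIV_isCont[OF twice_differentiable_deriv(1)[OF sus_twice_differentiable[OF P]]] chi0_trace])

lemma pressure_trace:
  "((\<lambda>y. (\<Sum>\<alpha>=1..nc P. rho \<alpha> t y * mu_out P rho chi0 \<alpha> t y) - rhof_out P rho chi0 t y)
    \<longlongrightarrow> pref P + bulk_mod P (sgn_side Z) * (ndens P (r Z) / nref P - 1)) (at x within side Z t)"
proof (rule tendsto_cong_side)
  show "((\<lambda>y. pref P + Kmod Z * (ndens P (\<lambda>\<beta>. rho \<beta> t y) / nref P - 1))
      \<longlongrightarrow> pref P + bulk_mod P (sgn_side Z) * (ndens P (r Z) / nref P - 1)) (at x within side Z t)"
    unfolding Kmod_def using fluidD(15)[OF P] by (intro tendsto_intros ndens_trace) simp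
qed (rule bulk_pressure[OF t, symmetric])

text \<open>The gradient of a chemical potential in a pure phase, where the modulus is constant. It
  is expressed through the densities and their gradients, whose traces are available.\<close>

definition mu_gradient :: "real filter \<Rightarrow> nat \<Rightarrow> real^3 \<Rightarrow> real^3" where
  "mu_gradient Z \<alpha> y =
     (let N = ndens P (\<lambda>\<beta>. rho \<beta> t y); D = \<Sum>\<beta>=1..nc P. (1 / mass P \<beta>) *\<^sub>R grad (rho \<beta> t) y in
      (Kmod Z / N / (mass P \<alpha> * nref P)) *\<^sub>R D
      + (boltz P * temp P / mass P \<alpha>) *\<^sub>R ((1 / rho \<alpha> t y) *\<^sub>R grad (rho \<alpha> t) y - (1 / N) *\<^sub>R D))"

lemma mu_out_has_derivative:
  assumes y: "y \<in> side Z t" and \<alpha>: "\<alpha> \<in> {1..nc P}"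
  shows "(mu_out P rho chi0 \<alpha> t has_derivative (\<lambda>h. mu_gradient Z \<alpha> y \<bullet> h)) (at y)"
proof -
  have "((\<lambda>y. chem_pot P (Kmod Z) \<alpha> (\<lambda>\<beta>. rho \<beta> t y)) has_derivative
     (\<lambda>h. (0 * ln (ndens P (\<lambda>\<beta>. rho \<beta> t y) / nref P)
             + Kmod Z * (ndens P (\<lambda>\<beta>. grad (rho \<beta> t) y \<bullet> h) / ndens P (\<lambda>\<beta>. rho \<beta> t y))) / (mass P \<alpha> * nref P)
         + boltz P * temp P / mass P \<alpha> * (grad (rho \<alpha> t) y \<bullet> h / rho \<alpha> t y
             - ndens P (\<lambda>\<beta>. grad (rho \<beta> t) y \<bullet> h) / ndens P (\<lambda>\<beta>. rho \<beta> t y)))) (at y)"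
  proof (rule chem_pot_has_derivative[OF P _ \<alpha>])
    show "0 < rho \<beta> t y" "(rho \<beta> t has_derivative (\<lambda>h. grad (rho \<beta> t) y \<bullet> h)) (at y)" if "\<beta> \<in> {1..nc P}" for \<beta>
      using bulk_regular(2)[OF t y that] has_derivative_grad[OF bulk_regular(1)[OF t y that]] .
  qed simp
  moreover have "ndens P (\<lambda>\<beta>. grad (rho \<beta> t) y \<bullet> h) = (\<Sum>\<beta>=1..nc P. (1 / mass P \<beta>) *\<^sub>R grad (rho \<beta> t) y) \<bullet> h" for h
    by (simp add: ndens_def inner_sum_left)
  ultimately have "((\<lambda>y. chem_pot P (Kmod Z) \<alpha> (\<lambda>\<beta>. rho \<beta> t y)) has_derivative (\<lambda>h. mu_gradient Z \<alpha> y \<bullet> h)) (at y)"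
    unfolding mu_gradient_def Let_def
    by (elim has_derivative_eq_rhs) (simp add: fun_eq_iff inner_add_left inner_diff_left)
  then show ?thesis
  proof (rule has_derivative_transform_within_open[OF _ open_side[OF t] y])
    show "chem_pot P (Kmod Z) \<alpha> (\<lambda>\<beta>. rho \<beta> t y) = mu_out P rho chi0 \<alpha> t y" if "y \<in> side Z t" for y
      unfolding mu_out_def bulk_phase(1)[OF t that] Kmod_def
      by (rule mu_eq[OF P bulk_regular(2)[OF t that] \<alpha>, symmetric])
  qed
qed

lemma grad_rho_trace:
  "\<alpha> \<in> {1..nc P} \<Longrightarrow> (grad (rho \<alpha> t) \<longlongrightarrow> one_sided (side Z t) (grad (rho \<alpha> t)) x) (at x within side Z t)"
  by (rule has_traces_grad_tendsto[OF G traces(1) t x_in side_simps(5)])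

text \<open>Existence of this trace is inherited from the densities and their gradients through
  \<open>mu_gradient\<close>; the limit then agrees with the \<open>one_sided\<close> value that
  enters \<open>m\<close>.\<close>

lemma grad_mu_trace:
  assumes Z: "Z \<in> {at_top, at_bot}" and \<alpha>: "\<alpha> \<in> {1..nc P}"
  shows "((\<lambda>y. grad (mu_out P rho chi0 \<alpha> t) y \<bullet> n) \<longlongrightarrow> m Z \<alpha>) (at x within side Z t)"
proof -
  have "0 < ndens P (r Z)" by (rule ndens_pos[OF P match(1)[OF Z]])
  then have N: "ndens P (r Z) \<noteq> 0" by simp
  have R: "r Z \<alpha> \<noteq> 0" using match(1)[OF Z \<alpha>] by simp
  have mnz: "mass P \<beta> \<noteq> 0" if "\<beta> \<in> {1..nc P}" for \<beta> using fluidD(2)[OF P that] by simp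
  then have c: "mass P \<alpha> * nref P \<noteq> 0" using \<alpha> fluidD(15)[OF P] by simp
  let ?D = "\<Sum>\<beta>=1..nc P. (1 / mass P \<beta>) *\<^sub>R one_sided (side Z t) (grad (rho \<beta> t)) x"
  let ?N = "ndens P (r Z)"
  have "(mu_gradient Z \<alpha> \<longlongrightarrow> (Kmod Z / ?N / (mass P \<alpha> * nref P)) *\<^sub>R ?D
      + (boltz P * temp P / mass P \<alpha>) *\<^sub>R ((1 / r Z \<alpha>) *\<^sub>R one_sided (side Z t) (grad (rho \<alpha> t)) x - (1 / ?N) *\<^sub>R ?D))
      (at x within side Z t)"
    unfolding mu_gradient_def[abs_def] Let_def
    by (intro tendsto_intros ndens_trace rho_trace grad_rho_trace N R c mnz \<alpha>)
  then have "(grad (mu_out P rho chi0 \<alpha> t) \<longlongrightarrow> (Kmod Z / ?N / (mass P \<alpha> * nref P)) *\<^sub>R ?D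
      + (boltz P * temp P / mass P \<alpha>) *\<^sub>R ((1 / r Z \<alpha>) *\<^sub>R one_sided (side Z t) (grad (rho \<alpha> t)) x - (1 / ?N) *\<^sub>R ?D))
      (at x within side Z t)"
    by (rule tendsto_cong_side) (rule grad_eqI[OF mu_out_has_derivative[OF _ \<alpha>], symmetric])
  with trace_eq[OF this] show ?thesis unfolding m_def by (intro tendsto_intros) simp
qed

lemma diffusion_flux_trace:
  assumes Z: "Z \<in> {at_top, at_bot}"
  shows "((\<lambda>y. \<Sum>\<beta>=1..nc P - 1. diff_mob P \<alpha> \<beta> *
        (grad (\<lambda>y. mu_out P rho chi0 \<beta> t y - mu_out P rho chi0 (nc P) t y + zm P \<beta> * \<phi> t y) y \<bullet> n))
     \<longlongrightarrow> (\<Sum>\<beta>=1..nc P - 1. diff_mob P \<alpha> \<beta> * ((m Z \<beta> - m Z (nc P)) + zm P \<beta> * (p Z \<bullet> n)))) (at x within side Z t)"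
proof (rule tendsto_cong_side)
  let ?f = "\<lambda>y. \<Sum>\<beta>=1..nc P - 1. diff_mob P \<alpha> \<beta> * ((grad (mu_out P rho chi0 \<beta> t) y \<bullet> n
      - grad (mu_out P rho chi0 (nc P) t) y \<bullet> n) + zm P \<beta> * (grad (\<phi> t) y \<bullet> n))"
  show "(?f \<longlongrightarrow> (\<Sum>\<beta>=1..nc P - 1. diff_mob P \<alpha> \<beta> * ((m Z \<beta> - m Z (nc P)) + zm P \<beta> * (p Z \<bullet> n)))) (at x within side Z t)"
    by (intro tendsto_intros grad_mu_trace Z pred_in last_in grad_phi_trace)
  fix y assume y: "y \<in> side Z t"
  show "?f y = (\<Sum>\<beta>=1..nc P - 1. diff_mob P \<alpha> \<beta> *
        (grad (\<lambda>y. mu_out P rho chi0 \<beta> t y - mu_out P rho chi0 (nc P) t y + zm P \<beta> * \<phi> t y) y \<bullet> n))"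
  proof (intro sum.cong refl)
    fix \<beta> assume \<beta>: "\<beta> \<in> {1..nc P - 1}"
    note D = mu_out_has_derivative[OF y]
    have "grad (\<lambda>y. mu_out P rho chi0 \<beta> t y - mu_out P rho chi0 (nc P) t y + zm P \<beta> * \<phi> t y) y
        = mu_gradient Z \<beta> y - mu_gradient Z (nc P) y + zm P \<beta> *\<^sub>R grad (\<phi> t) y"
      by (rule grad_eqI, rule has_derivative_eq_rhs[OF has_derivative_add[OF has_derivative_diff[OF D[OF pred_in[OF \<beta>]] D[OF last_in]]
            has_derivative_mult_right[OF has_derivative_grad[OF bulk_regular(3)[OF t y]]]]])
         (simp add: fun_eq_iff inner_add_left inner_diff_left)
    then show "diff_mob P \<alpha> \<beta> * ((grad (mu_out P rho chi0 \<beta> t) y \<bullet> n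
        - grad (mu_out P rho chi0 (nc P) t) y \<bullet> n) + zm P \<beta> * (grad (\<phi> t) y \<bullet> n))
      = diff_mob P \<alpha> \<beta> * (grad (\<lambda>y. mu_out P rho chi0 \<beta> t y - mu_out P rho chi0 (nc P) t y + zm P \<beta> * \<phi> t y) y \<bullet> n)"
      by (simp add: grad_eqI[OF D[OF pred_in[OF \<beta>]]] grad_eqI[OF D[OF last_in]] inner_add_left inner_diff_left)
  qed
qed

lemma mass_flux_eq:
  "mass_flux P G rho v (liquid G) t s = flux at_top" "mass_flux P G rho v (vapor G) t s = flux at_top"
proof -
  have "one_sided (side Z t) (rho_tot P rho t) x = (\<Sum>\<alpha>=1..nc P. r Z \<alpha>)" for Z
    by (rule trace_eq[OF rho_tot_trace])
  note * = this[of at_top, unfolded side_simps] this[of at_bot, unfolded side_simps]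
  have u: "u at_top = one_sided (liquid G t) (v t) x" "u at_bot = one_sided (vapor G t) (v t) x"
    by (simp_all add: u_def side_simps)
  show "mass_flux P G rho v (liquid G) t s = flux at_top"
    unfolding mass_flux_def flux_def x_def[symmetric] n_def[symmetric] * u ..
  have "mass_flux P G rho v (vapor G) t s = flux at_bot"
    unfolding mass_flux_def flux_def x_def[symmetric] n_def[symmetric] * u ..
  then show "mass_flux P G rho v (vapor G) t s = flux at_top" by (simp only: flux_const(2))
qed

section \<open>Jump conditions at the interface\<close>

lemma mu_difference_jump:
  assumes "\<alpha> \<in> {1..nc P - 1}"
  shows "jump G t (\<lambda>y. mu_out P rho chi0 \<alpha> t y - mu_out P rho chi0 (nc P) t y) x = 0"
  using jump_eq[OF tendsto_diff[OF mu_trace[OF _ pred_in[OF assms]] mu_trace[OF _ last_in]]] mu_jump[OF assms]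
  by (simp add: side_simps)

lemma mass_jump: "jump G t (\<lambda>y. rho_tot P rho t y * (v t y \<bullet> n - normal_vel G t s)) x = 0"
proof -
  have "jump G t (\<lambda>y. rho_tot P rho t y * (v t y \<bullet> n - normal_vel G t s)) x = flux at_top - flux at_bot"
    unfolding flux_def by (rule jump_eq) (intro tendsto_intros rho_tot_trace v_trace)
  then show ?thesis by (simp add: flux_const(2))
qed

lemma species_interface_jump:
  assumes "\<alpha> \<in> {1..nc P - 1}"
  shows "jump G t (\<lambda>y. rho \<alpha> t y * (v t y \<bullet> n - normal_vel G t s)) x
       = jump G t (\<lambda>y. \<Sum>\<beta>=1..nc P - 1. diff_mob P \<alpha> \<beta> *
           (grad (\<lambda>y. mu_out P rho chi0 \<beta> t y - mu_out P rho chi0 (nc P) t y + zm P \<beta> * \<phi> t y) y \<bullet> n)) x"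
proof -
  have "jump G t (\<lambda>y. rho \<alpha> t y * (v t y \<bullet> n - normal_vel G t s)) x
      = r at_top \<alpha> * (u at_top \<bullet> n - normal_vel G t s) - r at_bot \<alpha> * (u at_bot \<bullet> n - normal_vel G t s)"
    by (rule jump_eq) (intro tendsto_intros rho_trace v_trace pred_in[OF assms])
  moreover have "jump G t (\<lambda>y. \<Sum>\<beta>=1..nc P - 1. diff_mob P \<alpha> \<beta> *
           (grad (\<lambda>y. mu_out P rho chi0 \<beta> t y - mu_out P rho chi0 (nc P) t y + zm P \<beta> * \<phi> t y) y \<bullet> n)) x
      = (\<Sum>\<beta>=1..nc P - 1. diff_mob P \<alpha> \<beta> * ((m at_top \<beta> - m at_top (nc P)) + zm P \<beta> * (p at_top \<bullet> n)))
      - (\<Sum>\<beta>=1..nc P - 1. diff_mob P \<alpha> \<beta> * ((m at_bot \<beta> - m at_bot (nc P)) + zm P \<beta> * (p at_bot \<bullet> n)))"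
    by (rule jump_eq) (rule diffusion_flux_trace)
  ultimately show ?thesis using species_jump[OF assms] by linarith
qed

text \<open>The profile balance contains only the normal part of the Maxwell traction. The full
  traction differs from it by the normal displacement times \<open>g\<close>; the displacement is
  continuous and \<open>g\<close> is the same on both sides, so this difference does not
  jump.\<close>

lemma momentum_interface_jump:
  "jump G t (\<lambda>y. flux at_top *\<^sub>R v t y
      + ((\<Sum>\<alpha>=1..nc P. rho \<alpha> t y * mu_out P rho chi0 \<alpha> t y) - rhof_out P rho chi0 t y) *\<^sub>R n
      + (eps0 P * (1 + sus P (chi0 t y))) *\<^sub>R
        (((1/2 * (norm (grad (\<phi> t) y))\<^sup>2) *\<^sub>R mat 1 - outer (grad (\<phi> t) y) (grad (\<phi> t) y)) *v n)) x
    = (cap P * mean_curv G t s * (LINT z|lborel. (deriv (X0 t s) z)\<^sup>2)) *\<^sub>R n"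
proof -
  let ?Pi = "\<lambda>Z. pref P + bulk_mod P (sgn_side Z) * (ndens P (r Z) / nref P - 1)"
  let ?L = "\<lambda>Z. flux at_top *\<^sub>R u Z + ?Pi Z *\<^sub>R n
      + (eps0 P * (1 + sus P (sgn_side Z))) *\<^sub>R ((1/2 * (norm (p Z))\<^sup>2) *\<^sub>R n - (p Z \<bullet> n) *\<^sub>R p Z)"
  let ?B = "\<lambda>Z. flux at_top *\<^sub>R u Z + ?Pi Z *\<^sub>R n
      + (eps0 P / 2 * (1 + sus P (sgn_side Z)) * ((norm g)\<^sup>2 - (p Z \<bullet> n)\<^sup>2)) *\<^sub>R n"
  have L: "?L Z = ?B Z - (eps0 P * ((1 + sus P (sgn_side Z)) * (p Z \<bullet> n))) *\<^sub>R g" if Z: "Z \<in> {at_top, at_bot}" for Z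
  proof -
    define d where "d = p Z \<bullet> n"
    have pZ: "p Z = d *\<^sub>R n + g" using grad_phi_decomposition[OF Z] by (simp add: d_def)
    \<comment> \<open>Taking the normal component of the decomposition of \<open>p Z\<close> shows
      that \<open>g\<close> is tangential.\<close>
    have "d = d + g \<bullet> n" using arg_cong[OF pZ, of "\<lambda>q. q \<bullet> n"] n_unit by (simp add: d_def[symmetric] inner_add_left)
    then have gn: "g \<bullet> n = 0" by simp
    have sq: "(norm (p Z))\<^sup>2 = d\<^sup>2 + (norm g)\<^sup>2"
      unfolding pZ power2_norm_eq_inner using gn n_unit by (simp add: inner_add_left inner_add_right inner_commute power2_eq_square)
    have "(1/2 * (norm (p Z))\<^sup>2) *\<^sub>R n - d *\<^sub>R p Z = (1/2 * ((norm g)\<^sup>2 - d\<^sup>2)) *\<^sub>R n - d *\<^sub>R g"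
    proof -
      have "a *\<^sub>R n - d *\<^sub>R (d *\<^sub>R n + g) = (a - d * d) *\<^sub>R n - d *\<^sub>R g" for a
        by (simp add: scaleR_diff_left scaleR_add_right)
      moreover have "1/2 * (d\<^sup>2 + (norm g)\<^sup>2) - d * d = 1/2 * ((norm g)\<^sup>2 - d\<^sup>2)"
        by (simp add: field_simps power2_eq_square)
      ultimately show ?thesis unfolding sq unfolding pZ by (simp only:)
    qed
    then show ?thesis unfolding d_def[symmetric] by (simp add: scaleR_diff_right mult_ac)
  qed
  have "jump G t (\<lambda>y. flux at_top *\<^sub>R v t y
      + ((\<Sum>\<alpha>=1..nc P. rho \<alpha> t y * mu_out P rho chi0 \<alpha> t y) - rhof_out P rho chi0 t y) *\<^sub>R n
      + (eps0 P * (1 + sus P (chi0 t y))) *\<^sub>R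
        (((1/2 * (norm (grad (\<phi> t) y))\<^sup>2) *\<^sub>R mat 1 - outer (grad (\<phi> t) y) (grad (\<phi> t) y)) *v n)) x
      = ?L at_top - ?L at_bot"
    unfolding maxwell_stress_normal
    by (rule jump_eq) (intro tendsto_intros v_trace pressure_trace sus_trace grad_phi_trace)
  also have "\<dots> = ?B at_top - ?B at_bot"
    using L[of at_top] L[of at_bot] displacement_jump by (simp add: side_simps)
  finally show ?thesis using momentum_jump by simp
qed

lemmas profile_integrals = X_deriv_square_integrable dissipation_integrable

lemma R_tot_eq: "R_tot P R0 t s z = Rt z"
  by (simp add: R_tot_def Rt_def)

lemma energy_interface_jump:
  "jump G t (\<lambda>y. (flux at_top)\<^sup>2 / (2 * (rho_tot P rho t y)\<^sup>2) + mu_out P rho chi0 (nc P) t y) x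
    = - (flux at_top / relax P * (LINT z|lborel. 1 / R_tot P R0 t s z * (deriv (X0 t s) z)\<^sup>2))"
proof -
  have "jump G t (\<lambda>y. (flux at_top)\<^sup>2 / (2 * (rho_tot P rho t y)\<^sup>2) + mu_out P rho chi0 (nc P) t y) x
     = ((flux at_top)\<^sup>2 / (2 * (\<Sum>\<alpha>=1..nc P. r at_top \<alpha>)\<^sup>2) + mu P (nc P) (r at_top) (sgn_side at_top))
     - ((flux at_top)\<^sup>2 / (2 * (\<Sum>\<alpha>=1..nc P. r at_bot \<alpha>)\<^sup>2) + mu P (nc P) (r at_bot) (sgn_side at_bot))"
  proof (rule jump_eq)
    fix Z :: "real filter" assume Z: "Z \<in> {at_top, at_bot}"
    show "((\<lambda>y. (flux at_top)\<^sup>2 / (2 * (rho_tot P rho t y)\<^sup>2) + mu_out P rho chi0 (nc P) t y) \<longlongrightarrow>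
        (flux at_top)\<^sup>2 / (2 * (\<Sum>\<alpha>=1..nc P. r Z \<alpha>)\<^sup>2) + mu P (nc P) (r Z) (sgn_side Z)) (at x within side Z t)"
      using r_sum_pos[OF Z] by (intro tendsto_intros rho_tot_trace mu_trace[OF Z] last_in) simp
  qed
  then show ?thesis using energy_jump by (simp add: R_tot_eq)
qed

lemma displacement_interface_jump: "jump G t (\<lambda>y. (1 + sus P (chi0 t y)) * (grad (\<phi> t) y \<bullet> n)) x = 0"
proof -
  have "jump G t (\<lambda>y. (1 + sus P (chi0 t y)) * (grad (\<phi> t) y \<bullet> n)) x
    = (1 + sus P (sgn_side at_top)) * (p at_top \<bullet> n) - (1 + sus P (sgn_side at_bot)) * (p at_bot \<bullet> n)"
    by (rule jump_eq) (intro tendsto_intros sus_trace grad_phi_trace)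
  then show ?thesis using displacement_jump by (simp add: side_simps)
qed

lemma potential_jump: "jump G t (\<phi> t) x = 0"
  using Phi0_trace[OF t s, of at_top 0] Phi0_trace[OF t s, of at_bot 0] by (simp add: jump_def side_simps x_def)

lemma tangential_gradient_jump: "jump G t (\<lambda>y. grad (\<phi> t) y - (grad (\<phi> t) y \<bullet> n) *\<^sub>R n) x = 0"
proof -
  have "jump G t (\<lambda>y. grad (\<phi> t) y - (grad (\<phi> t) y \<bullet> n) *\<^sub>R n) x
    = (p at_top - (p at_top \<bullet> n) *\<^sub>R n) - (p at_bot - (p at_bot \<bullet> n) *\<^sub>R n)"
    by (rule jump_eq) (intro tendsto_intros grad_phi_trace)
  also have "\<dots> = g - g"
    using grad_phi_decomposition[of at_top] grad_phi_decomposition[of at_bot] by (metis add_diff_cancel_left' insertCI)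
  finally show ?thesis by simp
qed

end

theorem theorem5p1:
  fixes P :: fluid_data and G :: geometry
    and rho :: "nat \<Rightarrow> real \<Rightarrow> real^3 \<Rightarrow> real" and v :: "real \<Rightarrow> real^3 \<Rightarrow> real^3"
    and chi0 chi1 \<phi> :: "real \<Rightarrow> real^3 \<Rightarrow> real"
    and R0 R1 :: "nat \<Rightarrow> inner_scalar" and V0 :: inner_vector
    and X0 X1 \<Phi>0 \<Phi>1 :: inner_scalar
  assumes "fluid P" and "evolving_interface G"
    and "matching_solution P G rho v chi0 chi1 \<phi> R0 R1 V0 X0 X1 \<Phi>0 \<Phi>1"
  shows
    "(\<forall>(t, x)\<in>spacetime G (liquid G). chi0 t x = 1) \<and>
     (\<forall>(t, x)\<in>spacetime G (vapor G). chi0 t x = -1) \<and>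
     (\<forall>(t, x)\<in>spacetime G (liquid G) \<union> spacetime G (vapor G).
        chi1 t x = 0 \<and>
        (\<forall>\<alpha>\<in>{1..nc P - 1}.
           0 = time_deriv (Tf G) (rho \<alpha>) t x + dvg (\<lambda>y. rho \<alpha> t y *\<^sub>R v t y) x
             - dvg (\<lambda>y. \<Sum>\<beta>=1..nc P - 1. diff_mob P \<alpha> \<beta> *\<^sub>R
                 grad (\<lambda>y. mu_out P rho chi0 \<beta> t y - mu_out P rho chi0 (nc P) t y + zm P \<beta> * \<phi> t y) y) x
             - (\<Sum>i=1..nr P. mass P \<alpha> * stoich P i \<alpha> * react_mob P i *
                 (1 - exp (\<Sum>\<beta>=1..nc P. mass P \<beta> * stoich P i \<beta> * mu_out P rho chi0 \<beta> t x)))) \<and>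
        0 = time_deriv (Tf G) (rho_tot P rho) t x + dvg (\<lambda>y. rho_tot P rho t y *\<^sub>R v t y) x \<and>
        0 = time_deriv (Tf G) (\<lambda>t y. rho_tot P rho t y *\<^sub>R v t y) t x
          + tensor_dvg (\<lambda>y. rho_tot P rho t y *\<^sub>R outer (v t y) (v t y)) x
          + grad (\<lambda>y. (\<Sum>\<alpha>=1..nc P. rho \<alpha> t y * mu_out P rho chi0 \<alpha> t y) - rhof_out P rho chi0 t y
                      + eps0 P / 2 * (1 + sus P (chi0 t y)) * (norm (grad (\<phi> t) y))\<^sup>2) x
          - tensor_dvg (\<lambda>y. (eps0 P * (1 + sus P (chi0 t y))) *\<^sub>R outer (grad (\<phi> t) y) (grad (\<phi> t) y)) x \<and>
        0 = eps0 P * dvg (\<lambda>y. (1 + sus P (chi0 t y)) *\<^sub>R grad (\<phi> t) y) x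
          + (\<Sum>\<alpha>=1..nc P. charge P \<alpha> / mass P \<alpha> * rho \<alpha> t x)) \<and>
     (\<forall>t\<in>{0..<Tf G}. \<forall>s\<in>params G.
       (let x = chart G t s; n = nu G t x; w = normal_vel G t s;
            j0 = mass_flux P G rho v (liquid G) t s
        in
          mass_flux P G rho v (vapor G) t s = j0 \<and>
          (\<forall>\<alpha>\<in>{1..nc P - 1}.
             0 = jump G t (\<lambda>y. mu_out P rho chi0 \<alpha> t y - mu_out P rho chi0 (nc P) t y) x) \<and>
          0 = jump G t (\<lambda>y. rho_tot P rho t y * (v t y \<bullet> n - w)) x \<and>
          (\<forall>\<alpha>\<in>{1..nc P - 1}.
             0 = jump G t (\<lambda>y. rho \<alpha> t y * (v t y \<bullet> n - w)) x
               - jump G t (\<lambda>y. \<Sum>\<beta>=1..nc P - 1. diff_mob P \<alpha> \<beta> *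
                   (grad (\<lambda>y. mu_out P rho chi0 \<beta> t y - mu_out P rho chi0 (nc P) t y + zm P \<beta> * \<phi> t y) y \<bullet> n)) x) \<and>
          integrable lborel (\<lambda>z. (deriv (X0 t s) z)\<^sup>2) \<and>
          0 = jump G t (\<lambda>y. j0 *\<^sub>R v t y
                + ((\<Sum>\<alpha>=1..nc P. rho \<alpha> t y * mu_out P rho chi0 \<alpha> t y) - rhof_out P rho chi0 t y) *\<^sub>R n
                + (eps0 P * (1 + sus P (chi0 t y))) *\<^sub>R
                  (((1/2 * (norm (grad (\<phi> t) y))\<^sup>2) *\<^sub>R mat 1 - outer (grad (\<phi> t) y) (grad (\<phi> t) y)) *v n)) x
            - (cap P * mean_curv G t s * (LINT z|lborel. (deriv (X0 t s) z)\<^sup>2)) *\<^sub>R n \<and>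
          integrable lborel (\<lambda>z. 1 / R_tot P R0 t s z * (deriv (X0 t s) z)\<^sup>2) \<and>
          0 = jump G t (\<lambda>y. j0\<^sup>2 / (2 * (rho_tot P rho t y)\<^sup>2) + mu_out P rho chi0 (nc P) t y) x
            + j0 / relax P * (LINT z|lborel. 1 / R_tot P R0 t s z * (deriv (X0 t s) z)\<^sup>2) \<and>
          0 = jump G t (\<lambda>y. (1 + sus P (chi0 t y)) * (grad (\<phi> t) y \<bullet> n)) x \<and>
          0 = jump G t (\<phi> t) x)) \<and>
     (\<forall>t\<in>{0..<Tf G}.
        (\<forall>x\<in>Gam G t. jump G t (\<phi> t) x = 0) \<longrightarrow>
        (\<forall>x\<in>Gam G t. jump G t (\<lambda>y. grad (\<phi> t) y - (grad (\<phi> t) y \<bullet> nu G t x) *\<^sub>R nu G t x) x = 0))"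
proof -
  interpret matched_phases P G rho v chi0 chi1 \<phi> R0 R1 V0 X0 X1 \<Phi>0 \<Phi>1
    by unfold_locales (rule assms)+
  have point: "matched_point P G rho v chi0 chi1 \<phi> R0 R1 V0 X0 X1 \<Phi>0 \<Phi>1 t s"
    if "t \<in> {0..<Tf G}" "s \<in> params G" for t s
    by unfold_locales (rule that)+
  note defs = matched_point.n_def[OF point] matched_point.x_def[OF point]
  show ?thesis
  \<comment> \<open>The goals follow the order of the conjuncts: 1 to 7 are the bulk equations, 8 to
    17 the conditions at a parameter point, 18 the tangential gradient.\<close>
  proof ((intro conjI ballI impI; (unfold split_paired_all case_prod_conv Let_def)?; (intro conjI ballI)?), goal_cases)
    case (1 t x)
    then show ?case using bulk_phase(1)[of t x at_top] by (auto simp: side_simps spacetime_def)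
  next
    case (2 t x)
    then show ?case using bulk_phase(1)[of t x at_bot] by (auto simp: side_simps spacetime_def)
  next
    case (3 t x)
    then show ?case by (rule spacetime_cases) (rule bulk_phase(2))
  next
    case (4 t x \<alpha>)
    from 4(1) show ?case by (rule spacetime_cases) (rule bulk_equations(1)[OF _ _ 4(2)])
  next
    case (5 t x)
    then show ?case by (rule spacetime_cases) (rule bulk_equations(2))
  next
    case (6 t x)
    then show ?case by (rule spacetime_cases) (rule bulk_momentum)
  next
    case (7 t x)
    then show ?case by (rule spacetime_cases) (rule bulk_equations(6))
  next
    case (8 t s)
    then show ?case by (simp only: matched_point.mass_flux_eq[OF point])
  next
    case (9 t s \<alpha>)
    from matched_point.mu_difference_jump[OF point[OF 9(1,2)] 9(3)] show ?case by (simp only: defs 9)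
  next
    case (10 t s)
    from matched_point.mass_jump[OF point[OF 10]] show ?case by (simp only: defs 10)
  next
    case (11 t s \<alpha>)
    from matched_point.species_interface_jump[OF point[OF 11(1,2)] 11(3)] show ?case by (simp only: defs 11 diff_self)
  next
    case (12 t s)
    from matched_point.profile_integrals(1)[OF point[OF 12]] show ?case .
  next
    case (13 t s)
    from matched_point.momentum_interface_jump[OF point[OF 13]] show ?case
      unfolding matched_point.mass_flux_eq[OF point[OF 13]] by (simp only: defs 13 diff_self)
  next
    case (14 t s)
    from matched_point.profile_integrals(2)[OF point[OF 14]] show ?case
      by (simp only: matched_point.R_tot_eq[OF point[OF 14]])
  next
    case (15 t s)
    from matched_point.energy_interface_jump[OF point[OF 15]] show ?case
      unfolding matched_point.mass_flux_eq[OF point[OF 15]] by (simp only: defs 15 add.left_inverse)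
  next
    case (16 t s)
    from matched_point.displacement_interface_jump[OF point[OF 16]] show ?case by (simp only: defs 16)
  next
    case (17 t s)
    from matched_point.potential_jump[OF point[OF 17]] show ?case by (simp only: defs 17)
  next
    case (18 t x)
    \<comment> \<open>The chart maps onto \<open>Gam G t\<close>, so the statement at parameter
      points reaches every point of the interface.\<close>
    obtain s where s: "s \<in> params G" "x = chart G t s"
      using evolving_interfaceD(6)[OF assms(2) 18(1)] 18(3) by blast
    from matched_point.tangential_gradient_jump[OF point[OF 18(1) s(1)]] show ?case by (simp only: defs 18 s)
  qed
qed

end
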